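(* Let $R$ be a ring (with unit $1\neq0$) equipped with the discrete norm, and let $G$ be a group of type $\mathrm{FP}_2(R)$. If $G$ satisfies a subquadratic isoperimetric inequality over $R$, then it satisfies a linear isoperimetric inequality over $R$; i.e. if the $1$-isoperimetric class $f_1^{R,G}$ is subquadratic, then it is linear.
   Context: The discrete norm on $R$ is $|r|_d=0$ if $r=0$ and $|r|_d=1$ otherwise. A free $RG$-module with fixed basis $\Lambda$ is given the $\ell^1$-norm obtained by viewing it as a free $R$-module with basis $\Lambda\times G$: $|\sum a_y y|=\sum|a_y|_d$. $G$ is of type $\mathrm{FP}_n(R)$ if there is an exact sequence $P_n\to\dots\to P_0\to R\to0$ with all $P_i$ finitely generated projective $RG$-modules. A projective resolution $(C_k,\partial_k)$ of the trivial $RG$-module $R$ is $n$-admissible if $C_n,C_{n+1}$ are finitely generated free $RG$-modules with fixed free bases (such a resolution exists if $G$ is of type $\mathrm{FP}_{n+1}(R)$). Its $n$-isoperimetric function $f_n\colon\mathbb{R}_{\ge0}\to\mathbb{R}_{\ge0}\cup\{\infty\}$ is $$f_n(l)=\sup\{\inf\{|c| : c\in C_{n+1},\ \partial_{n+1}(c)=b\}\ :\ b\in\operatorname{Im}(\partial_{n+1}),\ |b|\le l\}.$$ For $f,g\colon\mathbb{R}_{\ge0}\to\mathbb{R}_{\ge0}\cup\{\infty\}$ write $f\preccurlyeq g$ if there are constants $C,K>0$ with $f(x)\le Kg(Kx+C)+Kx+C$ for all $x$, and $f\approx g$ if $f\preccurlyeq g$ and $g\preccurlyeq f$. The $\approx$-class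 of $f_n$ is independent of the $n$-admissible resolution and is denoted $f_n^{R,G}$. It is linear if $f_n^{R,G}\approx x$, and subquadratic if $f_n^{R,G}\preccurlyeq x^2$ and $f_n^{R,G}\not\approx x^2$. *)

theory Defs
  imports "HOL-Library.Poly_Mapping" "HOL-Library.Extended_Nonnegative_Real"
begin

text \<open>
  Groups are types of class \<open>group_add\<close>: the group law is written additively but is not assumed
  commutative. Rings are types of class \<open>ring_1\<close>: not necessarily commutative, with \<open>0 \<noteq> 1\<close>.
  The group ring \<open>RG\<close> is the type \<open>'g \<Rightarrow>\<^sub>0 'r\<close> of finitely supported functions with the convolution
  product of \<open>HOL-Library.Poly_Mapping\<close>.
\<close>

section \<open>Left modules over a not necessarily commutative ring\<close>

text \<open>The library's locale \<open>module\<close> requires a commutative ring of scalars.\<close>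

locale left_module =
  fixes scale :: "'a::ring_1 \<Rightarrow> 'm::ab_group_add \<Rightarrow> 'm"
  assumes scale_right_distrib: "scale a (x + y) = scale a x + scale a y"
    and scale_left_distrib: "scale (a + b) x = scale a x + scale b x"
    and scale_scale: "scale a (scale b x) = scale (a * b) x"
    and scale_one: "scale 1 x = x"

definition submodule :: "('a::ring_1 \<Rightarrow> 'm::ab_group_add \<Rightarrow> 'm) \<Rightarrow> 'm set \<Rightarrow> bool" where
  "submodule scale M \<longleftrightarrow>
     0 \<in> M \<and> (\<forall>x\<in>M. \<forall>y\<in>M. x + y \<in> M) \<and> (\<forall>a. \<forall>x\<in>M. scale a x \<in> M)"

definition module_map ::
  "('a::ring_1 \<Rightarrow> 'm::ab_group_add \<Rightarrow> 'm) \<Rightarrow> 'm set \<Rightarrow>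
   ('a \<Rightarrow> 'n::ab_group_add \<Rightarrow> 'n) \<Rightarrow> 'n set \<Rightarrow> ('m \<Rightarrow> 'n) \<Rightarrow> bool" where
  "module_map s M t N f \<longleftrightarrow>
     f ` M \<subseteq> N \<and> (\<forall>x\<in>M. \<forall>y\<in>M. f (x + y) = f x + f y) \<and> (\<forall>a. \<forall>x\<in>M. f (s a x) = t a (f x))"

definition lincomb ::
  "('a::ring_1 \<Rightarrow> 'm::ab_group_add \<Rightarrow> 'm) \<Rightarrow> ('m \<Rightarrow>\<^sub>0 'a) \<Rightarrow> 'm" where
  "lincomb scale c = (\<Sum>y\<in>Poly_Mapping.keys c. scale (Poly_Mapping.lookup c y) y)"

definition finitely_generated ::
  "('a::ring_1 \<Rightarrow> 'm::ab_group_add \<Rightarrow> 'm) \<Rightarrow> 'm set \<Rightarrow> bool" where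
  "finitely_generated scale M \<longleftrightarrow>
     (\<exists>S. finite S \<and> S \<subseteq> M \<and> (\<forall>x\<in>M. \<exists>c. Poly_Mapping.keys c \<subseteq> S \<and> lincomb scale c = x))"

definition free_basis ::
  "('a::ring_1 \<Rightarrow> 'm::ab_group_add \<Rightarrow> 'm) \<Rightarrow> 'm set \<Rightarrow> 'm set \<Rightarrow> bool" where
  "free_basis scale M B \<longleftrightarrow>
     B \<subseteq> M \<and> (\<forall>x\<in>M. \<exists>!c. Poly_Mapping.keys c \<subseteq> B \<and> lincomb scale c = x)"

definition free_coords ::
  "('a::ring_1 \<Rightarrow> 'm::ab_group_add \<Rightarrow> 'm) \<Rightarrow> 'm set \<Rightarrow> 'm \<Rightarrow> ('m \<Rightarrow>\<^sub>0 'a)" where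
  "free_coords scale B x = (THE c. Poly_Mapping.keys c \<subseteq> B \<and> lincomb scale c = x)"

definition free_scale :: "'a::ring_1 \<Rightarrow> ('i \<Rightarrow>\<^sub>0 'a) \<Rightarrow> ('i \<Rightarrow>\<^sub>0 'a)" where
  "free_scale a = Poly_Mapping.map ((*) a)"

lemma left_module_free_scale: "left_module (free_scale :: 'a::ring_1 \<Rightarrow> ('i \<Rightarrow>\<^sub>0 'a) \<Rightarrow> _)"
proof -
  have *: "Poly_Mapping.lookup (free_scale a x) i = a * Poly_Mapping.lookup x i"
    for a :: 'a and x :: "'i \<Rightarrow>\<^sub>0 'a" and i
    by (simp add: free_scale_def map.rep_eq when_def)
  show ?thesis
    by unfold_locales
       (auto intro!: poly_mapping_eqI simp: * lookup_add distrib_left distrib_right mult.assoc)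
qed

text \<open>
  Projective means isomorphic to a direct summand of a free module, that is, a retract of the free
  module on some set \<open>X\<close>. Drawing \<open>X\<close> from the type of the module itself is no restriction,
  since every module is a quotient of the free module on its own elements.
\<close>

definition projective ::
  "('a::ring_1 \<Rightarrow> 'm::ab_group_add \<Rightarrow> 'm) \<Rightarrow> 'm set \<Rightarrow> bool" where
  "projective scale P \<longleftrightarrow>
     (\<exists>(X :: 'm set) i p.
        module_map scale P free_scale {c. Poly_Mapping.keys c \<subseteq> X} i \<and>
        module_map free_scale {c. Poly_Mapping.keys c \<subseteq> X} scale P p \<and>
        (\<forall>x\<in>P. p (i x) = x))"

section \<open>The trivial module and the finiteness properties\<close>

definition trivial_scale :: "('g::group_add \<Rightarrow>\<^sub>0 'r::ring_1) \<Rightarrow> 'r \<Rightarrow> 'r" where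
  "trivial_scale a r = (\<Sum>g\<in>Poly_Mapping.keys a. Poly_Mapping.lookup a g * r)"

text \<open>
  A finitely generated projective \<open>RG\<close>-module is isomorphic to a submodule of some \<open>(RG)\<^sup>m\<close>, hence
  of the free module \<open>nat \<Rightarrow>\<^sub>0 RG\<close> of countable rank. So \<open>P k\<close> ranges over submodules of the latter
  without loss of generality. \<open>d k\<close> is the boundary map from \<open>P k\<close> to \<open>P (k - 1)\<close>;
  \<open>d 0\<close> is not used.
\<close>

definition type_FP :: "'g::group_add itself \<Rightarrow> 'r::ring_1 itself \<Rightarrow> nat \<Rightarrow> bool" where
  "type_FP G R n \<longleftrightarrow>
     (\<exists>(P :: nat \<Rightarrow> (nat \<Rightarrow>\<^sub>0 ('g \<Rightarrow>\<^sub>0 'r)) set) d (e :: _ \<Rightarrow> 'r).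
        (\<forall>k\<le>n. submodule free_scale (P k) \<and> finitely_generated free_scale (P k) \<and>
                projective free_scale (P k)) \<and>
        (\<forall>k<n. module_map free_scale (P (Suc k)) free_scale (P k) (d (Suc k))) \<and>
        module_map free_scale (P 0) trivial_scale UNIV e \<and>
        e ` P 0 = UNIV \<and>
        (0 < n \<longrightarrow> d 1 ` P 1 = {x \<in> P 0. e x = 0}) \<and>
        (\<forall>k. Suc k < n \<longrightarrow>
           d (Suc (Suc k)) ` P (Suc (Suc k)) = {x \<in> P (Suc k). d (Suc k) x = 0}))"

section \<open>Admissible resolutions\<close>

text \<open>
  All chain modules are submodules of one ambient \<open>RG\<close>-module with scalar multiplication \<open>scal\<close>;
  any resolution has this form, with the direct sum of its modules as ambient module.
  The boundary map \<open>bdry C k\<close> goes from degree \<open>k\<close> to degree \<open>k - 1\<close>, and \<open>bdry C 0\<close> is not used.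
  \<open>basis C k\<close> is relevant only in the degrees in which a free basis is fixed.
\<close>

record (overloaded) ('g, 'r, 'm) based_complex =
  scal :: "('g \<Rightarrow>\<^sub>0 'r::zero) \<Rightarrow> 'm \<Rightarrow> 'm"
  chains :: "nat \<Rightarrow> 'm set"
  bdry :: "nat \<Rightarrow> 'm \<Rightarrow> 'm"
  augm :: "'m \<Rightarrow> 'r"
  basis :: "nat \<Rightarrow> 'm set"

definition projective_resolution ::
  "('g::group_add, 'r::ring_1, 'm::ab_group_add) based_complex \<Rightarrow> bool" where
  "projective_resolution C \<longleftrightarrow>
     left_module (scal C) \<and>
     (\<forall>k. submodule (scal C) (chains C k) \<and> projective (scal C) (chains C k)) \<and>
     (\<forall>k. module_map (scal C) (chains C (Suc k)) (scal C) (chains C k) (bdry C (Suc k))) \<and>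
     module_map (scal C) (chains C 0) trivial_scale UNIV (augm C) \<and>
     augm C ` chains C 0 = UNIV \<and>
     bdry C 1 ` chains C 1 = {x \<in> chains C 0. augm C x = 0} \<and>
     (\<forall>k. bdry C (Suc (Suc k)) ` chains C (Suc (Suc k)) =
           {x \<in> chains C (Suc k). bdry C (Suc k) x = 0})"

definition admissible ::
  "nat \<Rightarrow> ('g::group_add, 'r::ring_1, 'm::ab_group_add) based_complex \<Rightarrow> bool" where
  "admissible n C \<longleftrightarrow>
     projective_resolution C \<and>
     (\<forall>k\<in>{n, Suc n}. finitely_generated (scal C) (chains C k) \<and>
                      free_basis (scal C) (chains C k) (basis C k))"

section \<open>Norms and isoperimetric functions\<close>

definition discrete_norm :: "'r::zero \<Rightarrow> real" where
  "discrete_norm r = (if r = 0 then 0 else 1)"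

text \<open>
  An element with \<open>RG\<close>-coordinates \<open>c\<close> has \<open>R\<close>-coordinate \<open>lookup (lookup c y) g\<close> at the element
  \<open>g y\<close> of the \<open>R\<close>-basis indexed by pairs \<open>(y, g)\<close>.
\<close>

definition l1_norm ::
  "(('g::group_add \<Rightarrow>\<^sub>0 'r::ring_1) \<Rightarrow> 'm::ab_group_add \<Rightarrow> 'm) \<Rightarrow> 'm set \<Rightarrow> 'm \<Rightarrow> real" where
  "l1_norm scale B x =
     (let c = free_coords scale B x in
      \<Sum>y\<in>Poly_Mapping.keys c. \<Sum>g\<in>Poly_Mapping.keys (Poly_Mapping.lookup c y).
        discrete_norm (Poly_Mapping.lookup (Poly_Mapping.lookup c y) g))"

text \<open>
  Functions from the nonnegative reals to the nonnegative extended reals are represented with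
  domain type \<open>real\<close>; only their values at nonnegative arguments matter.
\<close>

definition isoperimetric_function ::
  "nat \<Rightarrow> ('g::group_add, 'r::ring_1, 'm::ab_group_add) based_complex \<Rightarrow> real \<Rightarrow> ennreal" where
  "isoperimetric_function n C l =
     (SUP b \<in> {b \<in> bdry C (Suc n) ` chains C (Suc n). l1_norm (scal C) (basis C n) b \<le> l}.
      INF c \<in> {c \<in> chains C (Suc n). bdry C (Suc n) c = b}.
        ennreal (l1_norm (scal C) (basis C (Suc n)) c))"

definition growth_le :: "(real \<Rightarrow> ennreal) \<Rightarrow> (real \<Rightarrow> ennreal) \<Rightarrow> bool" where
  "growth_le f g \<longleftrightarrow>
     (\<exists>C K :: real. C > 0 \<and> K > 0 \<and>
        (\<forall>x\<ge>0. f x \<le> ennreal K * g (K * x + C) + ennreal (K * x + C)))"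

definition growth_equiv :: "(real \<Rightarrow> ennreal) \<Rightarrow> (real \<Rightarrow> ennreal) \<Rightarrow> bool" where
  "growth_equiv f g \<longleftrightarrow> growth_le f g \<and> growth_le g f"

definition linear_growth :: "(real \<Rightarrow> ennreal) \<Rightarrow> bool" where
  "linear_growth f \<longleftrightarrow> growth_equiv f (\<lambda>x. ennreal x)"

definition subquadratic_growth :: "(real \<Rightarrow> ennreal) \<Rightarrow> bool" where
  "subquadratic_growth f \<longleftrightarrow>
     growth_le f (\<lambda>x. ennreal (x\<^sup>2)) \<and> \<not> growth_equiv f (\<lambda>x. ennreal (x\<^sup>2))"

end

theory Submission
  imports Defs Complex_Main
begin

text \<open>
  The hypothesis provides constants \<open>K\<close> with \<open>f l \<le> K l\<^sup>2 + K\<close> for all \<open>l\<close> and, for every \<open>\<epsilon> > 0\<close>,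
  arbitrarily large \<open>l\<close> with \<open>f l \<le> \<epsilon> l\<^sup>2\<close>. Both are used only for the loops of a word metric of \<open>G\<close>,
  mapped to cycles of \<open>C\<close>. Slicing a filling of a quadrilateral by the distance to one side (the
  coarea inequality) bounds its area below by the product of the distances of opposite sides,
  because a chain with boundary \<open>x - y\<close> is coarsely connected from \<open>x\<close> to \<open>y\<close>. Suppose that loops of
  length at most \<open>l\<close> have area at most \<open>\<epsilon> l\<^sup>2\<close>. A quadrilateral of length just above \<open>l\<close> whose opposite
  sides are far apart has area at most \<open>2 K l\<^sup>2\<close>, so some slice parallel to a side is only linearly
  long; projecting it to that side in short steps produces a smaller quadrilateral violating
  the bound for loops of length \<open>l\<close>. Hence the longer loop has a short chord and can be cut, and the
  smallness propagates from one scale to all larger ones; iterating the cut makes the area of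
  loops linear. Then geodesics towards a base point contract.

  This property of \<open>G\<close> no longer refers to \<open>C\<close>. A cycle of \<open>D\<close> need not be a sum of
  loops of comparable total length, since its support may branch. It is filled by pushing all
  its points level by level towards the base point; after each step the points are moved by a
  bounded amount so that a fixed proportion of the edges collapses.
\<close>

section \<open>Loops in a geodesic graph\<close>

text \<open>The hypothesis and the conclusion concern two unrelated resolutions \<open>C\<close> and
  \<open>D\<close>, so they have to be linked by a property of \<open>G\<close>: the contraction of
  geodesics in one word metric, whose generators are chosen to suit both. Admissibility gives finite
  free bases in degrees 1 and 2 only; in degree 0 the module is merely projective. Hence the
  vertices are the translates of a chosen element of augmentation 1, and the edges are chosen chains
  between them. The geometric estimates never look inside these chains: they rest on the assumption
  \<open>slicing\<close> of the locale \<open>area\<close>. As the norm is discrete, multiplication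
  by \<open>single g s\<close> never increases it, so coefficients in \<open>R\<close> cost nothing.
  Chords proportional to the length \<open>n\<close> of a loop do not suffice for linear area: every
  round of cuts multiplies the total length by a constant, and about log n rounds leave a power of
  \<open>n\<close>. So the gain comes in two stages: an area of order n^(3/2) forces chords of order
  n^(3/4), and their cost over all rounds stays linear.\<close>

locale graph_metric =
  fixes d :: "'v \<Rightarrow> 'v \<Rightarrow> nat"
  assumes d_zero: "d x y = 0 \<longleftrightarrow> x = y"
    and d_sym: "d x y = d y x"
    and d_tri: "d x z \<le> d x y + d y z"
    and d_step: "d x y = Suc n \<Longrightarrow> \<exists>z. d x z = n \<and> d z y = 1"
begin

lemma d_self [simp]: "d x x = 0"
  by (simp add: d_zero)

end

section \<open>Edge walks and their chains\<close>

locale edge_chains = graph_metric d for d :: "'v \<Rightarrow> 'v \<Rightarrow> nat" +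
  fixes E :: "'v \<Rightarrow> 'v \<Rightarrow> 'a::ab_group_add"
  assumes E_anti: "E y x = - E x y"
begin

text \<open>A walk is recorded by its end points, its length, its vertex set and the sum of its edge
  chains, which is all that the estimates refer to. Stationary steps are allowed.\<close>

inductive pth :: "'v \<Rightarrow> 'v \<Rightarrow> nat \<Rightarrow> 'v set \<Rightarrow> 'a \<Rightarrow> bool" where
  pth_nil: "pth x x 0 {x} 0"
| pth_step: "d x y \<le> 1 \<Longrightarrow> pth y z n V a \<Longrightarrow> pth x z (Suc n) (insert x V) (E x y + a)"

lemma pth_start: "pth x y n V a \<Longrightarrow> x \<in> V"
  by (induction rule: pth.induct) auto

lemma pth_finish: "pth x y n V a \<Longrightarrow> y \<in> V"
  by (induction rule: pth.induct) auto

lemma pth_finite: "pth x y n V a \<Longrightarrow> finite V"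
  by (induction rule: pth.induct) auto

lemma pth_append: "pth x y n V a \<Longrightarrow> pth y z m W b \<Longrightarrow> pth x z (n + m) (V \<union> W) (a + b)"
proof (induction rule: pth.induct)
  case (pth_nil x)
  then show ?case using pth_start[OF pth_nil] by (simp add: insert_absorb)
next
  case (pth_step x y z n V a)
  from pth.pth_step[OF pth_step.hyps(1) pth_step.IH[OF pth_step.prems]]
  show ?case by (simp add: add.assoc)
qed

lemma pth_edge: "d x y \<le> 1 \<Longrightarrow> pth x y 1 {x, y} (E x y)"
  using pth_step[OF _ pth_nil, of x y] by simp

lemma pth_rev: "pth x y n V a \<Longrightarrow> pth y x n V (- a)"
proof (induction rule: pth.induct)
  case (pth_nil x)
  then show ?case using pth.pth_nil by simp
next
  case (pth_step x y z n V a)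
  have "pth y x 1 {y, x} (E y x)"
    using pth_edge[of y x] pth_step.hyps(1) by (simp add: d_sym)
  from pth_append[OF pth_step.IH this]
  have "pth z x (Suc n) (V \<union> {y, x}) (- a + E y x)" by simp
  moreover have "V \<union> {y, x} = insert x V"
    using pth_start[OF pth_step.hyps(2)] by auto
  moreover have "- a + E y x = - (E x y + a)"
    using E_anti[of y x] by simp
  ultimately show ?case by simp
qed

lemma pth_split: "pth x y n V a \<Longrightarrow> i \<le> n \<Longrightarrow>
    \<exists>z V1 V2 a1 a2. pth x z i V1 a1 \<and> pth z y (n - i) V2 a2 \<and> V = V1 \<union> V2 \<and> a = a1 + a2"
proof (induction arbitrary: i rule: pth.induct)
  case (pth_nil x)
  then have "pth x x i {x} 0 \<and> pth x x (0 - i) {x} 0 \<and> {x} = {x} \<union> {x} \<and> (0::'a) = 0 + 0"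
    using pth.pth_nil[of x] by simp
  then show ?case by blast
next
  case (pth_step x y z n V a)
  show ?case
  proof (cases i)
    case 0
    have "pth x z (Suc n) (insert x V) (E x y + a)"
      by (rule pth.pth_step[OF pth_step.hyps])
    then have "pth x x i {x} 0 \<and> pth x z (Suc n - i) (insert x V) (E x y + a)
       \<and> insert x V = {x} \<union> insert x V \<and> E x y + a = 0 + (E x y + a)"
      using pth.pth_nil[of x] 0 by simp
    then show ?thesis by blast
  next
    case (Suc j)
    then have "j \<le> n" using pth_step.prems by simp
    from pth_step.IH[OF this] obtain u V1 V2 a1 a2 where
      *: "pth y u j V1 a1" "pth u z (n - j) V2 a2" "V = V1 \<union> V2" "a = a1 + a2" by blast
    have "pth x u (Suc j) (insert x V1) (E x y + a1)"
      by (rule pth.pth_step[OF pth_step.hyps(1) *(1)])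
    moreover have "pth u z (Suc n - Suc j) V2 a2" using *(2) by simp
    ultimately have "pth x u i (insert x V1) (E x y + a1) \<and> pth u z (Suc n - i) V2 a2
       \<and> insert x V = insert x V1 \<union> V2 \<and> E x y + a = (E x y + a1) + a2"
      using * Suc by (simp add: add.assoc)
    then show ?thesis by blast
  qed
qed

lemma pth_split_at: "pth x y n V a \<Longrightarrow> z \<in> V \<Longrightarrow>
    \<exists>i\<le>n. \<exists>V1 V2 a1 a2. pth x z i V1 a1 \<and> pth z y (n - i) V2 a2 \<and> V = V1 \<union> V2 \<and> a = a1 + a2"
proof (induction arbitrary: z rule: pth.induct)
  case (pth_nil x)
  then have "0 \<le> (0::nat) \<and> pth x z 0 {x} 0 \<and> pth z x (0 - 0) {x} 0 \<and> {x} = {x} \<union> {x} \<and> (0::'a) = 0 + 0"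
    using pth.pth_nil[of x] by simp
  then show ?case by blast
next
  case (pth_step x y w n V a)
  show ?case
  proof (cases "z = x")
    case True
    have "pth x w (Suc n) (insert x V) (E x y + a)"
      by (rule pth.pth_step[OF pth_step.hyps])
    then have "pth x z 0 {x} 0 \<and> pth z w (Suc n - 0) (insert x V) (E x y + a)
       \<and> insert x V = {x} \<union> insert x V \<and> E x y + a = 0 + (E x y + a)"
      using pth.pth_nil[of x] True by simp
    then show ?thesis by blast
  next
    case False
    then have "z \<in> V" using pth_step.prems by simp
    from pth_step.IH[OF this] obtain i V1 V2 a1 a2 where
      *: "i \<le> n" "pth y z i V1 a1" "pth z w (n - i) V2 a2" "V = V1 \<union> V2" "a = a1 + a2" by blast
    have "pth x z (Suc i) (insert x V1) (E x y + a1)"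
      by (rule pth.pth_step[OF pth_step.hyps(1) *(2)])
    moreover have "pth z w (Suc n - Suc i) V2 a2" using *(3) by simp
    moreover have "Suc i \<le> Suc n" using *(1) by simp
    ultimately have "Suc i \<le> Suc n \<and> pth x z (Suc i) (insert x V1) (E x y + a1)
       \<and> pth z w (Suc n - Suc i) V2 a2
       \<and> insert x V = insert x V1 \<union> V2 \<and> E x y + a = (E x y + a1) + a2"
      using * by (simp add: add.assoc)
    then show ?thesis by blast
  qed
qed

lemma pth_sub:
  assumes "pth x y n V a" "u \<in> V" "v \<in> V"
  shows "\<exists>m W b. m \<le> n \<and> W \<subseteq> V \<and> pth u v m W b"
proof -
  obtain i V1 V2 a1 a2 where 1: "i \<le> n" "pth x u i V1 a1" "pth u y (n - i) V2 a2" "V = V1 \<union> V2"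
    using pth_split_at[OF assms(1,2)] by blast
  show ?thesis
  proof (cases "v \<in> V2")
    case True
    then obtain j W1 W2 b1 where
      "j \<le> n - i" "pth u v j W1 b1" "V2 = W1 \<union> W2"
      using pth_split_at[OF 1(3)] by blast
    moreover from this have "j \<le> n" "W1 \<subseteq> V" using 1 by auto
    ultimately show ?thesis by blast
  next
    case False
    then have "v \<in> V1" using 1 assms by auto
    then obtain j W1 W2 b2 where
      *: "j \<le> i" "pth v u (i - j) W2 b2" "V1 = W1 \<union> W2"
      using pth_split_at[OF 1(2)] by blast
    have "i - j \<le> n" "W2 \<subseteq> V" using 1 * by auto
    then show ?thesis using pth_rev[OF *(2)] by blast
  qed
qed

lemma geodesic: "\<exists>V a. pth x y (d x y) V a \<and> (\<forall>v\<in>V. d x v + d v y = d x y)"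
proof (induction "d x y" arbitrary: y)
  case 0
  then have "x = y" by (simp add: d_zero)
  then show ?case using pth_nil[of x] by (intro exI[of _ "{x}"] exI[of _ 0]) simp
next
  case (Suc n)
  obtain z where z: "d x z = n" "d z y = 1" using d_step Suc(2) by metis
  obtain V a where V: "pth x z n V a" "\<forall>v\<in>V. d x v + d v z = n"
    using Suc(1)[of z] z by auto
  have "pth x y (n + 1) (V \<union> {z, y}) (a + E z y)"
    using pth_append[OF V(1) pth_edge[of z y]] z by simp
  moreover have "d x v + d v y = d x y" if v: "v \<in> V \<union> {z, y}" for v
  proof -
    consider "v \<in> V" | "v = y" using v pth_finish[OF V(1)] by blast
    then show ?thesis
    proof cases
      case 1
      have "d v y \<le> d v z + 1" "d x y \<le> d x v + d v y"
        using d_tri[of v y z] d_tri[of x y v] z by auto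
      then show ?thesis using V(2) 1 Suc(2) by force
    qed simp
  qed
  ultimately show ?case unfolding Suc(2)[symmetric] Suc_eq_plus1 by blast
qed

lemma pth_dist: "pth x y n V a \<Longrightarrow> v \<in> V \<Longrightarrow> d x v \<le> n"
proof (induction arbitrary: v rule: pth.induct)
  case (pth_step x y z n V a)
  show ?case
  proof (cases "v = x")
    case False
    then have "d y v \<le> n" using pth_step by auto
    then show ?thesis using d_tri[of x v y] pth_step.hyps(1) by linarith
  qed simp
qed simp

text \<open>The geodesic chord from \<open>u\<close> to \<open>v\<close> is run through once in each
  direction, so its chain cancels while its length counts twice. The lower bounds for
  \<open>m1\<close> and \<open>m2\<close> hold because each part keeps one whole side; they make
  both parts substantially shorter than the loop.\<close>

lemma cut_loop:
  assumes "pth p1 p2 n1 V1 a1" "pth p2 p3 n2 V2 a2" "pth p3 p4 n3 V3 a3" "pth p4 p1 n4 V4 a4"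
    and "u \<in> V1" "v \<in> V3"
  shows "\<exists>m1 m2 W1 W2 b1 b2. pth u u m1 W1 b1 \<and> pth v v m2 W2 b2 \<and>
           a1 + a2 + a3 + a4 = b1 + b2 \<and> m1 + m2 = n1 + n2 + n3 + n4 + 2 * d u v \<and>
           n2 \<le> m1 \<and> n4 \<le> m2"
proof -
  obtain i U1 U2 e1 e2 where 1: "i \<le> n1" "pth p1 u i U1 e1" "pth u p2 (n1 - i) U2 e2"
    "a1 = e1 + e2"
    using pth_split_at[OF assms(1,5)] by blast
  obtain j U3 U4 e3 e4 where 2: "j \<le> n3" "pth p3 v j U3 e3" "pth v p4 (n3 - j) U4 e4"
    "a3 = e3 + e4"
    using pth_split_at[OF assms(3,6)] by blast
  obtain Vg g where g: "pth u v (d u v) Vg g" using geodesic by blast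
  note A = pth_append[OF pth_append[OF pth_append[OF 1(3) assms(2)] 2(2)] pth_rev[OF g]]
  note B = pth_append[OF pth_append[OF pth_append[OF 2(3) assms(4)] 1(2)] g]
  have "a1 + a2 + a3 + a4 = (e2 + a2 + e3 + - g) + (e4 + a4 + e1 + g)"
    using 1(4) 2(4) by (simp add: algebra_simps)
  moreover have "(n1 - i + n2 + j + d u v) + (n3 - j + n4 + i + d u v) =
      n1 + n2 + n3 + n4 + 2 * d u v"
    using 1(1) 2(1) by simp
  moreover have "n2 \<le> n1 - i + n2 + j + d u v" "n4 \<le> n3 - j + n4 + i + d u v" by simp_all
  ultimately show ?thesis using A B by blast
qed

end

text \<open>
  \<open>Fil a A\<close> means that the chain \<open>a\<close> has a filling of area at most \<open>A\<close>. In \<open>slicing\<close>, \<open>Z t\<close> stands for the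
  part of a filling at distance about \<open>t\<close> from the first side; together with neighbourhoods of
  the second and the fourth side it joins the two ends of the first side.
\<close>

locale area = edge_chains d E for d :: "'v \<Rightarrow> 'v \<Rightarrow> nat" and E :: "'v \<Rightarrow> 'v \<Rightarrow> 'a::ab_group_add" +
  fixes Fil :: "'a \<Rightarrow> real \<Rightarrow> bool" and r k :: nat
  assumes Fil_mono: "Fil a A \<Longrightarrow> A \<le> B \<Longrightarrow> Fil a B"
    and Fil_add: "Fil a A \<Longrightarrow> Fil b B \<Longrightarrow> Fil (a + b) (A + B)"
    and r_pos: "1 \<le> r"
    and k_pos: "1 \<le> k"
    and slicing: "\<lbrakk>pth p1 p2 n1 V1 a1; pth p2 p3 n2 V2 a2; pth p3 p4 n3 V3 a3; pth p4 p1 n4 V4 a4;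
        Fil (a1 + a2 + a3 + a4) (A::real)\<rbrakk> \<Longrightarrow>
      \<exists>Z. (\<forall>t. finite (Z t)) \<and> (\<forall>T. real (\<Sum>t<T. card (Z t)) \<le> real k * A) \<and>
        (\<forall>t. \<forall>z\<in>Z t. (\<forall>v\<in>V1. t \<le> d v z + r) \<and> (\<exists>v\<in>V1. d v z \<le> t + r)) \<and>
        (\<forall>t\<ge>1. (\<forall>v\<in>V1. \<forall>w\<in>V3. t + r < d v w) \<longrightarrow>
           (p2, p1) \<in> {(x, y). d x y \<le> r \<and>
             x \<in> {x. \<exists>v\<in>V2 \<union> V4. d v x \<le> r} \<union> Z t \<and> y \<in> {x. \<exists>v\<in>V2 \<union> V4. d v x \<le> r} \<union> Z t}\<^sup>*)"
begin

text \<open>A shortest chain from \<open>N\<close> to \<open>M\<close> works: an interior point in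
  \<open>N\<close> or \<open>M\<close> would allow a shorter one, and so would a repetition. Hence
  the interior points are distinct elements of \<open>Z\<close>.\<close>

lemma rtrancl_cross:
  fixes Y N M Z :: "'b set" and R :: "'b rel"
  assumes "(x, y) \<in> R\<^sup>*" "R \<subseteq> (N \<union> M \<union> Z) \<times> (N \<union> M \<union> Z)" "x \<in> N" "y \<in> M" "finite Z"
  shows "\<exists>m q. q 0 \<in> N \<and> q m \<in> M \<and> (\<forall>i<m. (q i, q (Suc i)) \<in> R) \<and>
           (\<forall>i. 0 < i \<longrightarrow> i < m \<longrightarrow> q i \<in> Z) \<and> m \<le> card Z + (1::nat)"
proof -
  define P where "P m \<longleftrightarrow> (\<exists>q. q 0 \<in> N \<and> q m \<in> M \<and> (\<forall>i<m. (q i, q (Suc i)) \<in> R))" for m :: nat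
  obtain n where "(x, y) \<in> R ^^ n" using assms(1) rtrancl_imp_relpow by blast
  then obtain f where "f 0 = x" "f n = y" "\<forall>i<n. (f i, f (Suc i)) \<in> R"
    by (auto simp: relpow_fun_conv)
  then have "P n" unfolding P_def using assms(3,4) by blast
  define m where "m = (LEAST m. P m)"
  have "P m" unfolding m_def using \<open>P n\<close> by (rule LeastI)
  have min: "m \<le> m'" if "P m'" for m' unfolding m_def using that by (rule Least_le)
  obtain q where q: "q 0 \<in> N" "q m \<in> M" "\<forall>i<m. (q i, q (Suc i)) \<in> R"
    using \<open>P m\<close> unfolding P_def by blast
  have int: "q i \<in> Z" if "0 < i" "i < m" for i
  proof -
    have "q i \<notin> N"
    proof
      assume "q i \<in> N"
      then have "P (m - i)" unfolding P_def using q that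
        by (intro exI[of _ "\<lambda>j. q (i + j)"]) auto
      then show False using min that by fastforce
    qed
    moreover have "q i \<notin> M"
    proof
      assume "q i \<in> M"
      then have "P i" unfolding P_def using q that by (intro exI[of _ q]) auto
      then show False using min that by fastforce
    qed
    moreover have "q i \<in> N \<union> M \<union> Z" using q(3) that assms(2) by blast
    ultimately show ?thesis by blast
  qed
  have ne: "q i \<noteq> q j" if "i < j" "j < m" for i j
  proof
    assume eq: "q i = q j"
    define q' where "q' l = (if l \<le> i then q l else q (l + (j - i)))" for l
    have "(q' l, q' (Suc l)) \<in> R" if l: "l < m - (j - i)" for l
    proof -
      consider "l < i" | "l = i" | "l > i" by linarith
      then show ?thesis
      proof cases
        case 1
        then show ?thesis unfolding q'_def using q(3) that \<open>i < j\<close> \<open>j < m\<close> by auto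
      next
        case 2
        have "(q j, q (Suc j)) \<in> R" using q(3) \<open>j < m\<close> by blast
        then show ?thesis unfolding q'_def using 2 eq \<open>i < j\<close> by auto
      next
        case 3
        have "l + (j - i) < m" using l \<open>i < j\<close> \<open>j < m\<close> by linarith
        then show ?thesis unfolding q'_def using 3 q(3) by auto
      qed
    qed
    moreover have "q' 0 \<in> N" unfolding q'_def using q(1) by simp
    moreover have "q' (m - (j - i)) \<in> M" unfolding q'_def using q(2) that by auto
    ultimately have "P (m - (j - i))" unfolding P_def by blast
    then show False using min that by fastforce
  qed
  have "inj_on q {0<..<m}"
    by (rule inj_onI) (metis greaterThanLessThan_iff linorder_neqE_nat ne)
  then have "card {0<..<m} \<le> card Z"
    by (intro card_inj_on_le[of q]) (use int assms(5) in auto)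
  then have "m \<le> card Z + 1" by simp
  then show ?thesis using q int by blast
qed

section \<open>Crossings of a slice and the area of rectangles\<close>

definition crossing where
  "crossing V1 V2 V4 t c m q \<longleftrightarrow>
     (\<exists>v\<in>V2. d v (q 0) \<le> r) \<and> (\<exists>v\<in>V4. d v (q m) \<le> r) \<and> (\<forall>i<m. d (q i) (q (Suc i)) \<le> r) \<and>
     (\<forall>i. 0 < i \<longrightarrow> i < m \<longrightarrow> (\<forall>v\<in>V1. t \<le> d v (q i) + r) \<and> (\<exists>v\<in>V1. d v (q i) \<le> t + r)) \<and>
     m \<le> c + (1::nat)"

lemma slice_path:
  assumes "pth p1 p2 n1 V1 a1" "pth p2 p3 n2 V2 a2" "pth p3 p4 n3 V3 a3" "pth p4 p1 n4 V4 a4"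
    and "Fil (a1 + a2 + a3 + a4) (A::real)"
  shows "\<exists>c. (\<forall>T. real (\<Sum>t<T. c t) \<le> real k * A) \<and>
     (\<forall>t\<ge>1. (\<forall>v\<in>V1. \<forall>w\<in>V3. t + r < d v w) \<longrightarrow> (\<exists>m q. crossing V1 V2 V4 t (c t) m q))"
proof -
  let ?R = "\<lambda>Y. {(x, y). d x y \<le> r \<and> x \<in> {x. \<exists>v\<in>V2 \<union> V4. d v x \<le> r} \<union> Y
              \<and> y \<in> {x. \<exists>v\<in>V2 \<union> V4. d v x \<le> r} \<union> Y}"
  obtain Z where Z: "\<And>t. finite (Z t)" "\<And>T. real (\<Sum>t<T. card (Z t)) \<le> real k * A"
     "\<And>t z. z \<in> Z t \<Longrightarrow> (\<forall>v\<in>V1. t \<le> d v z + r) \<and> (\<exists>v\<in>V1. d v z \<le> t + r)"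
     "\<And>t. 1 \<le> t \<Longrightarrow> (\<forall>v\<in>V1. \<forall>w\<in>V3. t + r < d v w) \<Longrightarrow> (p2, p1) \<in> (?R (Z t))\<^sup>*"
    using slicing[OF assms] by blast
  have "\<exists>m q. crossing V1 V2 V4 t (card (Z t)) m q"
    if t: "1 \<le> t" "\<forall>v\<in>V1. \<forall>w\<in>V3. t + r < d v w" for t
  proof -
    let ?N = "{x. \<exists>v\<in>V2. d v x \<le> r}" and ?M = "{x. \<exists>v\<in>V4. d v x \<le> r}"
    have "p2 \<in> ?N" "p1 \<in> ?M"
      using pth_start[OF assms(2)] pth_finish[OF assms(4)] by force+
    moreover have "?R (Z t) \<subseteq> (?N \<union> ?M \<union> Z t) \<times> (?N \<union> ?M \<union> Z t)" by auto
    ultimately obtain m q where *: "q 0 \<in> ?N" "q m \<in> ?M" "\<forall>i<m. (q i, q (Suc i)) \<in> ?R (Z t)"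
      "\<forall>i. 0 < i \<longrightarrow> i < m \<longrightarrow> q i \<in> Z t" "m \<le> card (Z t) + 1"
      using rtrancl_cross[OF Z(4)[OF t] _ _ _ Z(1)[of t], of ?N ?M] by blast
    have "crossing V1 V2 V4 t (card (Z t)) m q"
      unfolding crossing_def using * Z(3)[of _ t] by blast
    then show ?thesis by blast
  qed
  then show ?thesis using Z(2) by (intro exI[of _ "\<lambda>t. card (Z t)"]) blast
qed

lemma steps_dist: "\<forall>i<m. d (q i) (q (Suc i)) \<le> r \<Longrightarrow> d (q 0) (q m) \<le> r * m" for q :: "nat \<Rightarrow> 'v"
proof (induction m)
  case (Suc m)
  have "d (q 0) (q m) \<le> r * m" "d (q m) (q (Suc m)) \<le> r" using Suc by auto
  then show ?case using d_tri[of "q 0" "q (Suc m)" "q m"] by simp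
qed simp

lemma crossing_length:
  assumes "crossing V1 V2 V4 t c m q" "\<forall>v\<in>V2. \<forall>w\<in>V4. D \<le> d v w"
  shows "D \<le> 2 * r + r * m"
proof -
  obtain v w where vw: "v \<in> V2" "w \<in> V4" "d v (q 0) \<le> r" "d w (q m) \<le> r"
    using assms(1) unfolding crossing_def by blast
  have "d (q 0) (q m) \<le> r * m"
    using assms(1) unfolding crossing_def by (intro steps_dist) blast
  then show ?thesis
    using assms(2) vw d_tri[of v w "q 0"] d_tri[of "q 0" w "q m"] d_sym[of w "q m"] by fastforce
qed

text \<open>For each level from \<open>r\<close> up to \<open>D1 - r\<close> the slice has to lead
  from the second side to the fourth, so it has at least \<open>(D2 - 3 * r) / r\<close> points, and
  all slices together have at most \<open>k * A\<close>. Of the loss \<open>3 * r\<close>, two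
  thirds are due to the ends of a crossing and one to its extra step.\<close>

lemma rectangle:
  assumes "pth p1 p2 n1 V1 a1" "pth p2 p3 n2 V2 a2" "pth p3 p4 n3 V3 a3" "pth p4 p1 n4 V4 a4"
    and "Fil (a1 + a2 + a3 + a4) (A::real)"
    and D1: "\<forall>v\<in>V1. \<forall>w\<in>V3. D1 \<le> d v w" and D2: "\<forall>v\<in>V2. \<forall>w\<in>V4. D2 \<le> d v w"
  shows "real ((D1 - 2 * r) * (D2 - 3 * r)) \<le> real r * real k * A"
proof -
  obtain c where c: "\<And>T. real (\<Sum>t<T. c t) \<le> real k * A"
     "\<And>t. 1 \<le> t \<Longrightarrow> (\<forall>v\<in>V1. \<forall>w\<in>V3. t + r < d v w) \<Longrightarrow> (\<exists>m q. crossing V1 V2 V4 t (c t) m q)"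
    using slice_path[OF assms(1-5)] by blast
  have "D2 - 3 * r \<le> r * c t" if t: "r \<le> t" "t < D1 - r" for t
  proof -
    have "\<forall>v\<in>V1. \<forall>w\<in>V3. t + r < d v w" using t D1 by fastforce
    moreover have "1 \<le> t" using t r_pos by simp
    ultimately obtain m q where mq: "crossing V1 V2 V4 t (c t) m q"
      using c(2)[of t] by blast
    have "m \<le> c t + 1" using mq unfolding crossing_def by blast
    then have "r * m \<le> r * (c t + 1)" by (rule mult_le_mono2)
    then show ?thesis using crossing_length[OF mq D2] by (simp add: algebra_simps)
  qed
  then have "(\<Sum>t\<in>{r..<D1 - r}. D2 - 3 * r) \<le> (\<Sum>t\<in>{r..<D1 - r}. r * c t)"
    by (intro sum_mono) auto
  also have "\<dots> \<le> (\<Sum>t<D1 - r. r * c t)"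
    by (intro sum_mono2) auto
  also have "\<dots> = r * (\<Sum>t<D1 - r. c t)" by (simp add: sum_distrib_left)
  finally have "(D1 - 2 * r) * (D2 - 3 * r) \<le> r * (\<Sum>t<D1 - r. c t)"
    by (simp add: numeral_2_eq_2)
  then have "real ((D1 - 2 * r) * (D2 - 3 * r)) \<le> real r * real (\<Sum>t<D1 - r. c t)"
    by (metis of_nat_le_iff of_nat_mult)
  also have "\<dots> \<le> real r * (k * A)" using c(1)[of "D1 - r"] by (intro mult_left_mono) auto
  finally show ?thesis by (simp add: mult.assoc)
qed

end

section \<open>Short chords\<close>

context area
begin

definition loops_fill :: "nat \<Rightarrow> real \<Rightarrow> bool" where
  "loops_fill L A \<longleftrightarrow> (\<forall>n\<le>L. \<forall>x V a. pth x x n V a \<longrightarrow> Fil a A)"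

lemma geodesic_split:
  assumes "\<tau> \<le> d x y"
  shows "\<exists>u V1 V2 a1 a2. pth x u \<tau> V1 a1 \<and> pth u y (d x y - \<tau>) V2 a2 \<and>
     (\<forall>w\<in>V1. d x w \<le> \<tau>) \<and> (\<forall>w\<in>V2. d w y \<le> d x y - \<tau>)"
proof -
  obtain V a where "pth x y (d x y) V a" using geodesic by blast
  from pth_split[OF this assms] obtain u V1 V2 a1 a2 where
    *: "pth x u \<tau> V1 a1" "pth u y (d x y - \<tau>) V2 a2" by blast
  show ?thesis
    using * pth_dist[OF *(1)] pth_dist[OF pth_rev[OF *(2)]] d_sym by metis
qed

text \<open>The base is the part of the first side between the nearest points \<open>x\<close> and
  \<open>y\<close>, the vertical sides are the first \<open>\<tau>\<close> steps of geodesics to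
  \<open>u\<close> and \<open>v\<close>, and the top consists of the remainders and
  \<open>W\<close>. Since \<open>x\<close> and \<open>y\<close> are nearest, the remainders keep
  distance \<open>\<tau>\<close> from the base. If loops of length \<open>L\<close> have small area,
  points close to each other therefore have projections close to each other.\<close>

lemma small_quadrilateral:
  assumes V1: "pth p1 p2 n1 V1 a1" and fill: "loops_fill L A"
    and xy: "x \<in> V1" "y \<in> V1" and W: "pth u v n W b"
    and dx: "\<forall>z\<in>V1. d x u \<le> d z u" and dy: "\<forall>z\<in>V1. d y v \<le> d z v"
    and \<tau>: "\<forall>z\<in>V1. \<forall>w\<in>W. \<tau> \<le> d z w"
    and len: "n1 + d x u + n + d y v \<le> L"
  shows "real ((\<tau> - 2 * r) * (d x y - 2 * \<tau> - 3 * r)) \<le> real r * real k * A"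
proof -
  have "\<tau> \<le> d x u" "\<tau> \<le> d y v"
    using \<tau> xy pth_start[OF W] pth_finish[OF W] by auto
  then obtain u' X1 X2 c1 c2 v' Y1 Y2 e1 e2 where
    X: "pth x u' \<tau> X1 c1" "pth u' u (d x u - \<tau>) X2 c2"
     "\<forall>w\<in>X1. d x w \<le> \<tau>" "\<forall>w\<in>X2. d w u \<le> d x u - \<tau>" and
    Y: "pth y v' \<tau> Y1 e1" "pth v' v (d y v - \<tau>) Y2 e2"
     "\<forall>w\<in>Y1. d y w \<le> \<tau>" "\<forall>w\<in>Y2. d w v \<le> d y v - \<tau>"
    using geodesic_split[of \<tau> x u] geodesic_split[of \<tau> y v] by metis
  obtain m U f where U: "m \<le> n1" "U \<subseteq> V1" "pth x y m U f"
    using pth_sub[OF V1 xy] by blast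
  note top = pth_append[OF pth_append[OF Y(2) pth_rev[OF W]] pth_rev[OF X(2)]]
  note left = pth_rev[OF X(1)]
  note loop = pth_append[OF pth_append[OF pth_append[OF U(3) Y(1)] top] left]
  have "m + \<tau> + (d y v - \<tau> + n + (d x u - \<tau>)) + \<tau> \<le> L"
    using U(1) len \<open>\<tau> \<le> d x u\<close> \<open>\<tau> \<le> d y v\<close> by linarith
  then have F: "Fil (f + e1 + (e2 + - b + - c2) + - c1) A"
    using fill loop unfolding loops_fill_def by blast
  have D1: "\<forall>z\<in>U. \<forall>w\<in>Y2 \<union> W \<union> X2. \<tau> \<le> d z w"
  proof (intro ballI)
    fix z w assume z: "z \<in> U" and w: "w \<in> Y2 \<union> W \<union> X2"
    have z': "z \<in> V1" using z U(2) by blast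
    consider "w \<in> W" | "w \<in> Y2" | "w \<in> X2" using w by blast
    then show "\<tau> \<le> d z w"
    proof cases
      case 1
      then show ?thesis using \<tau> z' by blast
    next
      case 2
      have "d y v \<le> d z v" "d w v \<le> d y v - \<tau>" using dy z' Y(4) 2 by auto
      then show ?thesis using d_tri[of z v w] \<open>\<tau> \<le> d y v\<close> by linarith
    next
      case 3
      have "d x u \<le> d z u" "d w u \<le> d x u - \<tau>" using dx z' X(4) 3 by auto
      then show ?thesis using d_tri[of z u w] \<open>\<tau> \<le> d x u\<close> by linarith
    qed
  qed
  have D2: "\<forall>z\<in>Y1. \<forall>w\<in>X1. d x y - 2 * \<tau> \<le> d z w"
  proof (intro ballI)
    fix z w assume "z \<in> Y1" "w \<in> X1"
    then have "d y z \<le> \<tau>" "d x w \<le> \<tau>" using X(3) Y(3) by auto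
    then show "d x y - 2 * \<tau> \<le> d z w"
      using d_tri[of x y w] d_tri[of w y z] d_sym[of w z] d_sym[of z y] by linarith
  qed
  show ?thesis by (rule rectangle[OF U(3) Y(1) top left F D1 D2])
qed

lemma coarse_path:
  assumes "\<forall>i<m. d (q i) (q (Suc i)) \<le> r" "i \<le> j" "j \<le> m"
  shows "\<exists>n V a. n \<le> r * (j - i) \<and> pth (q i) (q j) n V a \<and> (\<forall>w\<in>V. \<exists>l. i \<le> l \<and> l \<le> j \<and> d (q l) w \<le> r)"
  using assms(2,3)
proof (induction j rule: dec_induct)
  case base
  then show ?case using pth_nil[of "q i"] by force
next
  case (step j)
  then obtain n V a where IH: "n \<le> r * (j - i)" "pth (q i) (q j) n V a"
    "\<forall>w\<in>V. \<exists>l. i \<le> l \<and> l \<le> j \<and> d (q l) w \<le> r" by (meson Suc_leD)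
  obtain W b where W: "pth (q j) (q (Suc j)) (d (q j) (q (Suc j))) W b" using geodesic by blast
  have dr: "d (q j) (q (Suc j)) \<le> r" using assms(1) step by simp
  have "\<exists>l. i \<le> l \<and> l \<le> Suc j \<and> d (q l) w \<le> r" if "w \<in> V \<union> W" for w
  proof (cases "w \<in> V")
    case True
    then show ?thesis using IH(3) le_Suc_eq by blast
  next
    case False
    then have "d (q j) w \<le> r" using that pth_dist[OF W, of w] dr by fastforce
    then show ?thesis using step by (intro exI[of _ j]) simp
  qed
  moreover have "n + d (q j) (q (Suc j)) \<le> r * (Suc j - i)"
  proof -
    have "r * (Suc j - i) = r * (j - i) + r" using step by (simp add: Suc_diff_le)
    then show ?thesis using IH(1) dr by linarith
  qed
  ultimately show ?case using pth_append[OF IH(2) W] by blast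
qed

lemma blocks:
  fixes P :: "nat \<Rightarrow> 'v"
  assumes "\<And>i j. i \<le> j \<Longrightarrow> j \<le> m \<Longrightarrow> j - i \<le> B \<Longrightarrow> d (P i) (P j) \<le> \<Lambda>" and "0 < B"
  shows "d (P 0) (P m) \<le> (m div B + 1) * \<Lambda>"
proof -
  have "d (P 0) (P (l * B)) \<le> l * \<Lambda>" if "l * B \<le> m" for l
    using that
  proof (induction l)
    case (Suc l)
    have "d (P (l * B)) (P (Suc l * B)) \<le> \<Lambda>" using Suc by (intro assms) auto
    then show ?case using Suc d_tri[of "P 0" "P (Suc l * B)" "P (l * B)"] by simp
  qed simp
  from this[of "m div B"] have "d (P 0) (P (m div B * B)) \<le> m div B * \<Lambda>" by simp
  moreover have "d (P (m div B * B)) (P m) \<le> \<Lambda>"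
  proof -
    have "m - m div B * B = m mod B" by (rule minus_div_mult_eq_mod)
    moreover have "m mod B \<le> B" using \<open>0 < B\<close> by (simp add: less_imp_le)
    ultimately show ?thesis by (intro assms(1)) auto
  qed
  ultimately show ?thesis using d_tri[of "P 0" "P m" "P (m div B * B)"] by simp
qed

end

lemma nat_floor_bounds:
  fixes x :: real
  assumes "0 \<le> x"
  shows "real (nat \<lfloor>x\<rfloor>) \<le> x" "x - 1 \<le> real (nat \<lfloor>x\<rfloor>)"
proof -
  have "real (nat \<lfloor>x\<rfloor>) = of_int \<lfloor>x\<rfloor>" using assms by simp
  then show "real (nat \<lfloor>x\<rfloor>) \<le> x" "x - 1 \<le> real (nat \<lfloor>x\<rfloor>)" by linarith+
qed

context area
begin

text \<open>Two estimates of how far the projection of a slice travels along the first side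
  contradict each other. Its ends lie near the second and the fourth side, which are more than
  \<open>\<mu> * L\<close> apart; but it consists of boundedly many blocks, and
  \<open>small_quadrilateral\<close> bounds the progress of each. The constant \<open>K\<close>
  belongs to the area of the given loop, \<open>\<kappa>\<close> to the better bound for shorter
  loops.\<close>

lemma short_chord_aux:
  fixes L :: nat and K \<mu> \<kappa> Q :: real
  assumes w1: "pth p1 p2 n1 V1 a1" and w2: "pth p2 p3 n2 V2 a2"
    and w3: "pth p3 p4 n3 V3 a3" and w4: "pth p4 p1 n4 V4 a4"
    and fil: "Fil (a1 + a2 + a3 + a4) (K * L\<^sup>2)" and n1: "real n1 \<le> 0.4 * L"
    and K: "K > 0" and mu: "0 < \<mu>" "\<mu> \<le> 1 / 2"
    and Q: "Q = 12960 * k * K * r / \<mu>\<^sup>2" and lam: "\<kappa> = \<mu> / (20 * (Q + 1))"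
    and small: "loops_fill L (\<kappa>\<^sup>2 / (16 * r * k) * L\<^sup>2)"
    and L1: "\<kappa> * L \<ge> 8 + 16 * real r" and L2: "K * k * L \<ge> \<mu>"
    and far13: "\<And>v w. v \<in> V1 \<Longrightarrow> w \<in> V3 \<Longrightarrow> real (d v w) > \<mu> * L"
    and far24: "\<And>v w. v \<in> V2 \<Longrightarrow> w \<in> V4 \<Longrightarrow> real (d v w) > \<mu> * L"
  shows False
proof -
  \<comment> \<open>The slice has at most \<open>81 * k * K * L / \<mu>\<close> steps and a block at
    least \<open>M / (160 * r)\<close>; \<open>81 * 160 = 12960\<close> is the origin of
    \<open>Q\<close>. A block advances by at most \<open>2 * N\<close>, and \<open>\<kappa>\<close>
    is such that \<open>Q + 1\<close> blocks advance by at most \<open>M / 10\<close>.\<close>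
  define M N where "M = \<mu> * L" and "N = \<kappa> * L"
  note L1 = L1[folded N_def] and far13 = far13[folded M_def] and far24 = far24[folded M_def]
  have r1: "real r \<ge> 1" and k1: "real k \<ge> 1" using r_pos k_pos by simp_all
  have Q0: "Q \<ge> 0" using Q K mu r1 k1 by simp
  have lam0: "\<kappa> > 0" using lam Q0 mu by simp
  have lamQ: "\<kappa> * (Q + 1) = \<mu> / 20"
  proof -
    have "\<kappa> * (Q + 1) = (\<mu> * (Q + 1)) / (20 * (Q + 1))" unfolding lam by (rule times_divide_eq_left)
    also have "\<dots> = \<mu> / 20" using Q0 by (intro mult_divide_mult_cancel_right) simp
    finally show ?thesis .
  qed
  have lam_le: "20 * \<kappa> \<le> \<mu>"
  proof -
    have "\<kappa> * 1 \<le> \<kappa> * (Q + 1)" using lam0 Q0 by (intro mult_left_mono) auto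
    then show ?thesis using lamQ by simp
  qed
  have L0: "L > 0" using L1 r1 by (cases "L = 0") (auto simp: N_def)
  have lamL: "20 * N \<le> M" unfolding M_def N_def using lam_le L0 by (simp add: mult.assoc[symmetric])
  have muL: "M \<ge> 160 + 320 * real r" using lamL L1 by linarith
  have muL2: "M \<le> L / 2" unfolding M_def using mu L0 by simp
  obtain c where c: "\<And>T. real (\<Sum>t<T. c t) \<le> k * (K * L\<^sup>2)"
     "\<And>t. 1 \<le> t \<Longrightarrow> (\<forall>v\<in>V1. \<forall>w\<in>V3. t + r < d v w) \<Longrightarrow> (\<exists>m q. crossing V1 V2 V4 t (c t) m q)"
    using slice_path[OF w1 w2 w3 w4 fil] by blast
  \<comment> \<open>Levels above \<open>M / 20\<close> stay clear of the first side; levels below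
    \<open>M / 10\<close> keep the small quadrilaterals shorter than \<open>L\<close> and leave room
    in the final estimate.\<close>
  define lo hi where "lo = nat \<lceil>M / 20\<rceil>" and "hi = nat \<lfloor>M / 10\<rfloor>"
  have lo: "real lo \<ge> M / 20" "real lo \<le> M / 20 + 1"
  proof -
    have "0 \<le> \<lceil>M / 20\<rceil>" using muL r1 by simp
    then show "real lo \<ge> M / 20" "real lo \<le> M / 20 + 1"
      using of_int_ceiling_le_add_one[of "M / 20"] by (simp_all add: lo_def)
  qed
  have hi: "real hi \<le> M / 10" "real hi \<ge> M / 10 - 1"
    unfolding hi_def using nat_floor_bounds[of "M / 10"] muL r1 by auto
  \<comment> \<open>At least \<open>M / 40\<close> levels share \<open>k * K * L\<^sup>2\<close>
    points; if all of them had more than \<open>X\<close>, the total would be twice too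
    large.\<close>
  define X where "X = 80 * k * K * L / \<mu>"
  have "\<exists>t\<in>{lo..hi}. real (c t) \<le> X"
  proof (rule ccontr)
    assume "\<not> ?thesis"
    then have *: "X \<le> real (c t)" if "t \<in> {lo..hi}" for t using that by force
    have "(M / 40) * X \<le> real (card {lo..hi}) * X"
    proof (rule mult_right_mono)
      have card: "real hi - real lo + 1 \<le> real (card {lo..hi})" by simp
      have "M / 40 \<le> real hi - real lo + 1" using lo hi muL r1 by linarith
      then show "M / 40 \<le> real (card {lo..hi})" using card by (rule order_trans)
      show "0 \<le> X" unfolding X_def using K mu by simp
    qed
    also have "\<dots> = (\<Sum>t\<in>{lo..hi}. X)" by simp
    also have "\<dots> \<le> (\<Sum>t\<in>{lo..hi}. real (c t))" using * by (rule sum_mono)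
    also have "\<dots> \<le> (\<Sum>t<Suc hi. real (c t))" by (intro sum_mono2) auto
    also have "\<dots> \<le> k * (K * L\<^sup>2)" using c(1)[of "Suc hi"] by simp
    also have "(M / 40) * X = 2 * (k * (K * L\<^sup>2))"
      unfolding X_def M_def using mu by (simp add: power2_eq_square field_simps)
    finally have "k * (K * L\<^sup>2) \<le> 0" by linarith
    moreover have "k * (K * L\<^sup>2) > 0" using k1 K L0 by simp
    ultimately show False by linarith
  qed
  then obtain t where t: "lo \<le> t" "t \<le> hi" "real (c t) \<le> X" by auto
  have tlo: "real t \<ge> M / 20" and thi: "real t \<le> M / 10" using t lo hi by linarith+
  have t8: "real t \<ge> 8 + 16 * real r" using tlo muL by linarith
  have "t + r < d v w" if "v \<in> V1" "w \<in> V3" for v w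
    using far13[OF that] thi t8 by linarith
  then obtain m q where cr: "crossing V1 V2 V4 t (c t) m q"
    using c(2)[of t] t8 by fastforce
  have steps: "\<forall>i<m. d (q i) (q (Suc i)) \<le> r" using cr unfolding crossing_def by blast
  have m: "real m \<le> 81 * k * K * L / \<mu>"
  proof -
    have "m \<le> c t + 1" using cr unfolding crossing_def by blast
    then have "real m \<le> X + 1" using t(3) by linarith
    moreover have "1 \<le> k * K * L / \<mu>" using L2 mu by (simp add: mult.commute)
    moreover have "X = 80 * (k * K * L / \<mu>)" "81 * k * K * L / \<mu> = 81 * (k * K * L / \<mu>)"
      unfolding X_def by simp_all
    ultimately show ?thesis by argo
  qed
  \<comment> \<open>The end points of a crossing are only known to be near the second and fourth
    side; their heights are read off from neighbours inside the slice, so there must be an interior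
    point.\<close>
  have m2: "2 \<le> m"
  proof (rule ccontr)
    assume "\<not> 2 \<le> m"
    then have "r * m \<le> r" by (cases m) auto
    have "\<forall>v\<in>V2. \<forall>w\<in>V4. nat \<lceil>M\<rceil> \<le> d v w" using far24 by (simp add: less_imp_le)
    from crossing_length[OF cr this] \<open>r * m \<le> r\<close> have "nat \<lceil>M\<rceil> \<le> 3 * r" by linarith
    then have "real (nat \<lceil>M\<rceil>) \<le> 3 * real r" by linarith
    then show False using muL real_nat_ceiling_ge[of M] by linarith
  qed
  have height: "(\<forall>v\<in>V1. t \<le> d v (q i) + 2 * r) \<and> (\<exists>v\<in>V1. d v (q i) \<le> t + 2 * r)" if im: "i \<le> m" for i
  proof -
    have inner: "(\<forall>v\<in>V1. t \<le> d v (q i) + r) \<and> (\<exists>v\<in>V1. d v (q i) \<le> t + r)" if "0 < i" "i < m" for i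
      using cr that unfolding crossing_def by blast
    have "\<exists>j. 0 < j \<and> j < m \<and> d (q i) (q j) \<le> r"
    proof -
      consider "i = 0" | "i = m" | "0 < i \<and> i < m" using im by linarith
      then show ?thesis
      proof cases
        case 1 then show ?thesis using m2 steps by (intro exI[of _ 1]) auto
      next
        case 2
        have "d (q (m - 1)) (q (Suc (m - 1))) \<le> r" using steps m2 by (simp del: Suc_pred)
        then show ?thesis using m2 2 d_sym by (intro exI[of _ "m - 1"]) auto
      next
        case 3 then show ?thesis by (intro exI[of _ i]) auto
      qed
    qed
    then obtain j where j: "0 < j" "j < m" "d (q i) (q j) \<le> r" by blast
    show ?thesis
    proof
      show "\<forall>v\<in>V1. t \<le> d v (q i) + 2 * r"
      proof
        fix v assume "v \<in> V1"
        then have "t \<le> d v (q j) + r" using inner[OF j(1,2)] by blast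
        then show "t \<le> d v (q i) + 2 * r" using d_tri[of v "q j" "q i"] j(3) by linarith
      qed
      obtain v where "v \<in> V1" "d v (q j) \<le> t + r" using inner[OF j(1,2)] by blast
      then show "\<exists>v\<in>V1. d v (q i) \<le> t + 2 * r"
        using d_tri[of v "q i" "q j"] j(3) d_sym[of "q i" "q j"] by (intro bexI[of _ v]) linarith+
    qed
  qed
  have "\<exists>p\<in>V1. \<forall>z\<in>V1. d p u \<le> d z u" for u
    using pth_finite[OF w1] pth_start[OF w1] ex_min_if_finite[of "(\<lambda>z. d z u) ` V1"]
    by (metis (no_types, lifting) arg_min_if_finite(1) arg_min_least empty_iff)
  then obtain P where P: "\<And>u. P u \<in> V1" "\<And>u z. z \<in> V1 \<Longrightarrow> d (P u) u \<le> d z u" by metis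
  have Ph: "d (P (q i)) (q i) \<le> t + 2 * r" if "i \<le> m" for i
    using height[OF that] P(2)[of _ "q i"] le_trans by blast
  \<comment> \<open>A block is proportional to the level: at most \<open>t / 4\<close> long, so that
    the loop through it has length at most \<open>L\<close>, yet long enough that the number of
    blocks does not depend on \<open>L\<close>.\<close>
  define B where "B = t div (4 * r)"
  have B4: "4 * r * B \<le> t" unfolding B_def by simp
  have "t < 4 * r * B + 4 * r"
    unfolding B_def using r_pos dividend_less_times_div[of "4 * r" t] by simp
  then have "real t < real (4 * r * B + 4 * r)" by (rule of_nat_less_iff[THEN iffD2])
  then have B8: "real t \<le> 8 * r * B" using t8 by simp
  have B0: "0 < B" using B8 t8 by (cases "B = 0") auto
  have close: "real (d (P (q i)) (P (q j))) \<le> 2 * N" if ij: "i \<le> j" "j \<le> m" "j - i \<le> B" for i j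
  proof (rule ccontr)
    assume "\<not> ?thesis"
    then have big: "real (d (P (q i)) (P (q j))) > 2 * N" by simp
    obtain n W b where W: "n \<le> r * (j - i)" "pth (q i) (q j) n W b"
      "\<forall>w\<in>W. \<exists>l. i \<le> l \<and> l \<le> j \<and> d (q l) w \<le> r"
      using coarse_path[OF steps ij(1,2)] by blast
    \<comment> \<open>With this height a progress above \<open>2 * N\<close> gives a rectangle with
      factors at least \<open>N / 4\<close> and \<open>N / 2\<close>, while the small loops allow
      only \<open>N\<^sup>2 / 16\<close>.\<close>
    define \<tau> where "\<tau> = nat \<lfloor>N / 2\<rfloor>"
    have tau: "real \<tau> \<le> N / 2" "real \<tau> \<ge> N / 2 - 1"
      unfolding \<tau>_def using nat_floor_bounds[of "N / 2"] L1 r1 by auto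
    have tauW: "\<forall>z\<in>V1. \<forall>w\<in>W. \<tau> \<le> d z w"
    proof (intro ballI)
      fix z w assume z: "z \<in> V1" and "w \<in> W"
      then obtain l where l: "i \<le> l" "l \<le> j" "d (q l) w \<le> r" using W(3) by blast
      then have "t \<le> d z (q l) + 2 * r" using height[of l] z ij by auto
      then have "real t \<le> d z w + 3 * r"
        using d_tri[of z "q l" w] l(3) d_sym[of "q l" w] by linarith
      moreover have "real \<tau> \<le> real t / 2" using tau(1) lamL tlo muL r1 by linarith
      ultimately have "real \<tau> \<le> d z w" using t8 by linarith
      then show "\<tau> \<le> d z w" by simp
    qed
    have "r * (j - i) \<le> r * B" using ij by simp
    then have n: "4 * n \<le> t" using W(1) B4 by linarith
    have "real (n1 + d (P (q i)) (q i) + n + d (P (q j)) (q j)) \<le> L"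
      using n1 Ph[of i] Ph[of j] ij n thi muL muL2 r1 by linarith
    then have len: "n1 + d (P (q i)) (q i) + n + d (P (q j)) (q j) \<le> L" by linarith
    have "real ((\<tau> - 2 * r) * (d (P (q i)) (P (q j)) - 2 * \<tau> - 3 * r)) \<le>
        real r * real k * (\<kappa>\<^sup>2 / (16 * r * k) * L\<^sup>2)"
      by (rule small_quadrilateral[OF w1 small P(1) P(1) W(2) _ _ tauW len]) (use P(2) in auto)
    also have "\<dots> = N\<^sup>2 / 16" unfolding N_def using r1 k1 by (simp add: power_mult_distrib)
    also have "\<dots> < (N / 4) * (N / 2)"
    proof -
      have "N > 0" unfolding N_def using lam0 L0 by simp
      then have "N * N > 0" by simp
      then show ?thesis by (simp add: power2_eq_square)
    qed
    also have "\<dots> \<le> real (\<tau> - 2 * r) * real (d (P (q i)) (P (q j)) - 2 * \<tau> - 3 * r)"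
    proof (rule mult_mono)
      have "2 * r \<le> \<tau>" using tau L1 r1 by linarith
      then have "real (\<tau> - 2 * r) = real \<tau> - 2 * r" by (simp add: of_nat_diff)
      then show "N / 4 \<le> real (\<tau> - 2 * r)" using tau L1 r1 by linarith
      have "real (d (P (q i)) (P (q j)) - 2 * \<tau> - 3 * r) \<ge> real (d (P (q i)) (P (q j))) - 2 * \<tau> - 3 * r"
        by linarith
      then show "N / 2 \<le> real (d (P (q i)) (P (q j)) - 2 * \<tau> - 3 * r)"
        using big tau L1 r1 by linarith
    qed (use L1 r1 in auto)
    finally show False by simp
  qed
  define \<Lambda> where "\<Lambda> = nat \<lfloor>2 * N\<rfloor>"
  have Lam: "real \<Lambda> \<le> 2 * N" unfolding \<Lambda>_def using nat_floor_bounds[of "2 * N"] L1 r1 by auto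
  have "d (P (q 0)) (P (q m)) \<le> (m div B + 1) * \<Lambda>"
  proof (rule blocks[of m B "\<lambda>i. P (q i)"])
    fix i j assume "i \<le> j" "j \<le> m" "j - i \<le> B"
    then show "d (P (q i)) (P (q j)) \<le> \<Lambda>" using close[of i j] unfolding \<Lambda>_def by linarith
  qed (rule B0)
  then have "real (d (P (q 0)) (P (q m))) \<le> real ((m div B + 1) * \<Lambda>)" by (rule of_nat_mono)
  also have "\<dots> = (real (m div B) + 1) * real \<Lambda>" by (simp add: distrib_right)
  also have "\<dots> \<le> (Q + 1) * (2 * N)"
  proof (rule mult_mono)
    have "real (m div B) \<le> real m / real B" by (rule of_nat_div_le_of_nat)
    also have "\<dots> \<le> Q"
    proof -
      have "real B \<ge> M / (160 * r)" using B8 tlo r1 by (simp add: field_simps)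
      then have "Q * (M / (160 * r)) \<le> Q * real B" using Q0 by (rule mult_left_mono)
      moreover have "Q * (M / (160 * r)) = 81 * k * K * L / \<mu>"
        unfolding Q M_def using mu r1 by (simp add: power2_eq_square field_simps)
      ultimately have "real m \<le> Q * real B" using m by linarith
      then show ?thesis using B0 by (simp add: field_simps)
    qed
    finally show "real (m div B) + 1 \<le> Q + 1" by simp
  qed (use Lam Q0 in auto)
  also have "\<dots> = M / 10"
  proof -
    have "(Q + 1) * (2 * N) = 2 * (\<kappa> * (Q + 1)) * L" unfolding N_def by (simp add: algebra_simps)
    then show ?thesis unfolding lamQ M_def by simp
  qed
  finally have up: "real (d (P (q 0)) (P (q m))) \<le> M / 10" .
  obtain v w where vw: "v \<in> V2" "w \<in> V4" "d v (q 0) \<le> r" "d w (q m) \<le> r"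
    using cr unfolding crossing_def by blast
  have "d v w \<le> r + (t + 2 * r) + d (P (q 0)) (P (q m)) + (t + 2 * r) + r"
    using d_tri[of v w "q 0"] d_tri[of "q 0" w "P (q 0)"] d_tri[of "P (q 0)" w "P (q m)"]
      d_tri[of "P (q m)" w "q m"] Ph[of 0] Ph[of m] vw d_sym[of "q 0" "P (q 0)"] d_sym[of "q m" w]
    by linarith
  then have "d v w \<le> 6 * r + 2 * t + d (P (q 0)) (P (q m))" by linarith
  then have "real (d v w) \<le> 6 * real r + 2 * real t + real (d (P (q 0)) (P (q m)))" by linarith
  then have "real (d v w) \<le> 6 * real r + 2 * real t + M / 10" using up by linarith
  then show False using far24[OF vw(1,2)] thi muL r1 by linarith
qed

end

section \<open>Linear area of loops\<close>

context area
begin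

text \<open>The sides are the quarters of the loop, the last one taking the remainder. From
  \<open>20 \<le> n\<close> each has length at least \<open>n / 5\<close>, and a chord between
  opposite sides leaves a whole side in either part. A chord between the second and the fourth side
  is treated by reading the loop from its second side.\<close>

lemma loop_cut:
  fixes \<delta> :: real
  assumes loop: "pth x x n V a" and n: "20 \<le> n"
    and H: "\<And>p1 p2 p3 p4 n1 n2 n3 n4 V1 V2 V3 V4 a1 a2 a3 a4.
      pth p1 p2 n1 V1 a1 \<Longrightarrow> pth p2 p3 n2 V2 a2 \<Longrightarrow> pth p3 p4 n3 V3 a3 \<Longrightarrow> pth p4 p1 n4 V4 a4 \<Longrightarrow>
      a = a1 + a2 + a3 + a4 \<Longrightarrow> real n1 \<le> n / 4 \<Longrightarrow>
      (\<exists>v\<in>V1. \<exists>w\<in>V3. real (d v w) \<le> \<delta>) \<or> (\<exists>v\<in>V2. \<exists>w\<in>V4. real (d v w) \<le> \<delta>)"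
  shows "\<exists>u v m1 m2 W1 W2 b1 b2. pth u u m1 W1 b1 \<and> pth v v m2 W2 b2 \<and> a = b1 + b2 \<and>
     real m1 + real m2 \<le> n + 2 * \<delta> \<and> n \<le> m1 + m2 \<and> real n / 5 \<le> m1 \<and> real n / 5 \<le> m2"
proof -
  define q where "q = n div 4"
  have q: "real n / 5 \<le> q" "real q \<le> n / 4" "3 * q \<le> n" "q \<le> n - 3 * q"
    unfolding q_def using n by linarith+
  have q': "q \<le> n" "q \<le> n - q" "q \<le> n - q - q" using q(3) by linarith+
  obtain p2 V1 R1 a1 c1 where 1: "pth x p2 q V1 a1" "pth p2 x (n - q) R1 c1" "a = a1 + c1"
    using pth_split[OF loop q'(1)] by blast
  obtain p3 V2 R2 a2 c2 where 2: "pth p2 p3 q V2 a2" "pth p3 x (n - q - q) R2 c2" "c1 = a2 + c2"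
    using pth_split[OF 1(2) q'(2)] by blast
  obtain p4 V3 V4 a3 a4 where 3: "pth p3 p4 q V3 a3" "pth p4 x (n - q - q - q) V4 a4" "c2 = a3 + a4"
    using pth_split[OF 2(2) q'(3)] by blast
  have a: "a = a1 + a2 + a3 + a4" "a = a2 + a3 + a4 + a1" using 1 2 3 by (simp_all add: algebra_simps)
  consider v w where "v \<in> V1" "w \<in> V3" "real (d v w) \<le> \<delta>"
    | v w where "v \<in> V2" "w \<in> V4" "real (d v w) \<le> \<delta>"
    using H[OF 1(1) 2(1) 3(1,2) a(1)] q by blast
  then show ?thesis
  proof cases
    case 1
    then obtain m1 m2 W1 W2 b1 b2 where *: "pth v v m1 W1 b1" "pth w w m2 W2 b2"
      "a = b1 + b2" "m1 + m2 = q + q + q + (n - q - q - q) + 2 * d v w" "q \<le> m1" "n - q - q - q \<le> m2"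
      using cut_loop[OF \<open>pth x p2 q V1 a1\<close> 2(1) 3(1,2)] a(1) by metis
    have "real m1 + real m2 \<le> n + 2 * \<delta>" "n \<le> m1 + m2" "real n / 5 \<le> m1" "real n / 5 \<le> m2"
      using *(4-6) 1(3) q by linarith+
    then show ?thesis using *(1-3) by blast
  next
    case C: 2
    then obtain m1 m2 W1 W2 b1 b2 where *: "pth v v m1 W1 b1" "pth w w m2 W2 b2"
      "a = b1 + b2" "m1 + m2 = q + q + (n - q - q - q) + q + 2 * d v w" "q \<le> m1" "q \<le> m2"
      using cut_loop[OF 2(1) 3(1,2) 1(1)] a(2) by metis
    have "real m1 + real m2 \<le> n + 2 * \<delta>" "n \<le> m1 + m2" "real n / 5 \<le> m1" "real n / 5 \<le> m2"
      using *(4-6) C(3) q by linarith+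
    then show ?thesis using *(1-3) by blast
  qed
qed

text \<open>
  Any exponent strictly between 1 and 2 would do: the bound for the two parts of a cut loop then
  adds up to a fraction of the bound for the loop, which leaves room for the chord.
\<close>

lemma three_halves_growth:
  fixes K :: real
  assumes quad: "\<And>n x V a. pth x x n V a \<Longrightarrow> Fil a (K * (real n)\<^sup>2 + K)" and K: "K > 0"
    and sub: "\<And>\<epsilon> N. \<epsilon> > 0 \<Longrightarrow> \<exists>L\<ge>N. loops_fill L (\<epsilon> * (real L)\<^sup>2)"
  shows "\<exists>E n0. E > 0 \<and> (\<forall>n\<ge>n0. \<forall>x V a. pth x x n V a \<longrightarrow> Fil a (E * (real n * sqrt n)))"
proof -
  have r1: "real r \<ge> 1" and k1: "real k \<ge> 1" using r_pos k_pos by simp_all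
  \<comment> \<open>Chords of length \<open>\<mu> * L\<close> increase the total length at most by
    the factor \<open>51 / 50\<close> and leave parts of length at most \<open>41 / 50 * n\<close>;
    the induction closes because \<open>51 / 50 * sqrt (41 / 50) < 1\<close>. The factor 5 in
    \<open>5 * K\<close> turns the quadratic bound at \<open>n = L + 1\<close> into one in terms of
    \<open>L\<close>.\<close>
  define \<mu> :: real where "\<mu> = 1 / 100"
  define Q where "Q = 12960 * k * (5 * K) * r / \<mu>\<^sup>2"
  define \<kappa> where "\<kappa> = \<mu> / (20 * (Q + 1))"
  define \<epsilon> where "\<epsilon> = \<kappa>\<^sup>2 / (16 * r * k) / 12"
  have "Q \<ge> 0" unfolding Q_def \<mu>_def using K r1 k1 by simp
  then have kap: "\<kappa> > 0" unfolding \<kappa>_def \<mu>_def by simp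
  then have eps: "\<epsilon> > 0" unfolding \<epsilon>_def using r1 k1 by simp
  define N where "N = nat \<lceil>(8 + 16 * real r) / \<kappa>\<rceil> + nat \<lceil>\<mu> / (5 * K * k)\<rceil> + 20"
  obtain L0 where L0: "L0 \<ge> N" "loops_fill L0 (\<epsilon> * (real L0)\<^sup>2)" using sub[OF eps] by blast
  have L20: "L0 \<ge> 20" using L0 N_def by simp
  \<comment> \<open>As \<open>12 > 5 * sqrt 5\<close>, the bound \<open>G\<close> covers all loops
    of length up to \<open>L0\<close> although its argument is cut off at \<open>L0 / 5\<close>. The
    parts of a loop longer than \<open>L0\<close> have at least this length, so the cut-off does not
    affect them.\<close>
  define E where "E = 12 * \<epsilon> * sqrt L0"
  have E0: "E > 0" unfolding E_def using eps L20 by simp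
  define G where "G x = E * (max x (real L0 / 5) * sqrt (max x (real L0 / 5)))" for x :: real
  have Gmono: "G x \<le> G y" if "x \<le> y" for x y
    unfolding G_def using that E0 by (intro mult_left_mono mult_mono) auto
  have main: "Fil a (G n)" if "pth x x n V a" for n x V a
    using that
  proof (induction n arbitrary: x V a rule: less_induct)
    case (less n)
    show ?case
    proof (cases "n \<le> L0")
      case True
      then have "Fil a (\<epsilon> * (real L0)\<^sup>2)" using L0(2) less.prems unfolding loops_fill_def by blast
      moreover have "\<epsilon> * (real L0)\<^sup>2 \<le> G n"
      proof -
        have s5: "5 / 12 * sqrt L0 \<le> sqrt (real L0 / 5)"
          by (intro real_le_rsqrt) (simp add: power_mult_distrib power_divide)
        have "\<epsilon> * (real L0)\<^sup>2 = E * (real L0 / 5 * (5 / 12 * sqrt L0))"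
          unfolding E_def by (simp add: power2_eq_square)
        also have "\<dots> \<le> E * (real L0 / 5 * sqrt (real L0 / 5))"
          using s5 E0 by (intro mult_left_mono) auto
        also have "\<dots> \<le> G n" unfolding G_def using E0 by (intro mult_left_mono mult_mono) auto
        finally show ?thesis .
      qed
      ultimately show ?thesis by (rule Fil_mono)
    next
      case False
      \<comment> \<open>The induction hypothesis below \<open>n\<close> is itself the smallness
        required at scale \<open>L\<close>: since \<open>L0 \<le> L\<close>, the value
        \<open>G L\<close> is at most \<open>12 * \<epsilon> * L\<^sup>2\<close>. This is how
        smallness propagates from \<open>L0\<close> to all larger scales.\<close>
      define L where "L = n - 1"
      have nL: "n = L + 1" "L \<ge> L0" "L \<ge> 20" unfolding L_def using False L20 by auto
      have GL: "G (real L) \<le> 12 * \<epsilon> * (real L)\<^sup>2"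
      proof -
        have "max (real L) (real L0 / 5) = real L" using nL by auto
        then have "G L = 12 * \<epsilon> * (real L * (sqrt L0 * sqrt L))" unfolding G_def E_def by simp
        also have "\<dots> \<le> 12 * \<epsilon> * (real L * (sqrt L * sqrt L))"
          using nL eps by (intro mult_left_mono mult_right_mono) auto
        finally show ?thesis by (simp add: power2_eq_square)
      qed
      have small: "loops_fill L (\<kappa>\<^sup>2 / (16 * r * k) * L\<^sup>2)"
        unfolding loops_fill_def
      proof (intro allI impI)
        fix m x V a assume "m \<le> L" "pth x x m V a"
        then have "Fil a (G m)" using less.IH[of m] nL by simp
        moreover have "G m \<le> \<kappa>\<^sup>2 / (16 * r * k) * L\<^sup>2"
        proof -
          have "12 * \<epsilon> * (real L)\<^sup>2 = \<kappa>\<^sup>2 / (16 * r * k) * L\<^sup>2" unfolding \<epsilon>_def by simp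
          moreover have "G m \<le> G L" using Gmono \<open>m \<le> L\<close> by simp
          ultimately show ?thesis using GL by linarith
        qed
        ultimately show "Fil a (\<kappa>\<^sup>2 / (16 * r * k) * L\<^sup>2)" by (rule Fil_mono)
      qed
      have NL: "real N \<le> real L" using nL L0 by simp
      have "(8 + 16 * real r) / \<kappa> \<le> real N" unfolding N_def by linarith
      then have "(8 + 16 * real r) / \<kappa> \<le> L" using NL by linarith
      then have L1: "\<kappa> * L \<ge> 8 + 16 * real r" using kap by (simp add: pos_divide_le_eq mult.commute)
      have "\<mu> / (5 * K * k) \<le> real N" unfolding N_def by linarith
      then have "\<mu> / (5 * K * k) \<le> L" using NL by linarith
      then have L2: "5 * K * k * L \<ge> \<mu>" using K k1 by (simp add: pos_divide_le_eq mult.commute)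
      have fa: "Fil a (5 * K * L\<^sup>2)"
      proof (rule Fil_mono[OF quad[OF less.prems]])
        have "real n \<le> 2 * L" using nL by linarith
        then have "(real n)\<^sup>2 \<le> (2 * real L)\<^sup>2" by (intro power_mono) auto
        moreover have "1 \<le> (real L)\<^sup>2" using nL by simp
        ultimately have "(real n)\<^sup>2 + 1 \<le> 5 * (real L)\<^sup>2" by (simp add: power_mult_distrib)
        then have "K * ((real n)\<^sup>2 + 1) \<le> K * (5 * (real L)\<^sup>2)" using K by (intro mult_left_mono) auto
        then show "K * (real n)\<^sup>2 + K \<le> 5 * K * L\<^sup>2" by (simp add: algebra_simps)
      qed
      have "\<exists>u v m1 m2 W1 W2 b1 b2. pth u u m1 W1 b1 \<and> pth v v m2 W2 b2 \<and> a = b1 + b2 \<and>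
         real m1 + real m2 \<le> n + 2 * (\<mu> * L) \<and> n \<le> m1 + m2 \<and> real n / 5 \<le> m1 \<and> real n / 5 \<le> m2"
      proof (rule loop_cut[OF less.prems], goal_cases)
        case 1 then show ?case using nL by simp
      next
        case (2 p1 p2 p3 p4 n1 n2 n3 n4 V1 V2 V3 V4 a1 a2 a3 a4)
        show ?case
        proof (rule ccontr)
          assume neg: "\<not> ?case"
          have n1: "real n1 \<le> 0.4 * L" using 2(6) nL by linarith
          show False
            by (rule short_chord_aux[OF 2(1-4) _ n1 _ _ _ Q_def \<kappa>_def small L1 L2])
               (use neg fa 2(5) K in \<open>auto simp: \<mu>_def not_le\<close>)
        qed
      qed
      then obtain u v m1 m2 W1 W2 b1 b2 where *: "pth u u m1 W1 b1" "pth v v m2 W2 b2" "a = b1 + b2"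
         "real m1 + real m2 \<le> n + 2 * (\<mu> * L)" "real n / 5 \<le> m1" "real n / 5 \<le> m2"
        by blast
      have s: "real m1 + real m2 \<le> 51 / 50 * real n" 
      proof -
        have "2 * (\<mu> * L) = real L / 50" unfolding \<mu>_def by simp
        moreover have "real n = real L + 1" using nL by simp
        ultimately show ?thesis using *(4) by linarith
      qed
      have mi: "real m1 \<le> 41 / 50 * real n" "real m2 \<le> 41 / 50 * real n" using s *(5,6) by linarith+
      have lt: "m1 < n" "m2 < n" using mi nL by linarith+
      have F: "Fil a (G m1 + G m2)"
        unfolding *(3) by (rule Fil_add[OF less.IH[OF lt(1) *(1)] less.IH[OF lt(2) *(2)]])
      have b: "G m \<le> E * (m * (91 / 100 * sqrt n))" if "real n / 5 \<le> m" "m \<le> 41 / 50 * real n" for m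
      proof -
        have "max m (real L0 / 5) = m" using that nL by auto
        moreover have "sqrt m \<le> 91 / 100 * sqrt n"
        proof (rule real_le_lsqrt)
          have "(91 / 100 * sqrt n)\<^sup>2 = 8281 / 10000 * real n"
            by (simp add: power_mult_distrib power_divide)
          then show "m \<le> (91 / 100 * sqrt n)\<^sup>2" using that by linarith
        qed simp
        ultimately show ?thesis unfolding G_def using E0 that nL by (simp add: mult_left_mono)
      qed
      have "G m1 + G m2 \<le> E * (m1 * (91 / 100 * sqrt n)) + E * (m2 * (91 / 100 * sqrt n))"
        using b[OF *(5) mi(1)] b[OF *(6) mi(2)] by linarith
      also have "\<dots> = E * 91 / 100 * sqrt n * (real m1 + real m2)" by (simp add: algebra_simps)
      also have "\<dots> \<le> E * 91 / 100 * sqrt n * (51 / 50 * real n)" using s E0 by (intro mult_left_mono) auto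
      also have "\<dots> \<le> E * (n * sqrt n)"
      proof -
        have "E * (n * sqrt n) \<ge> 0" using E0 by simp
        then show ?thesis by (simp add: algebra_simps)
      qed
      also have "\<dots> = G n" unfolding G_def using nL by simp
      finally show ?thesis using F Fil_mono by blast
    qed
  qed
  have "Fil a (E * (real n * sqrt n))" if "n \<ge> L0" "pth x x n V a" for n x V a
  proof -
    have "max (real n) (real L0 / 5) = real n" using that by auto
    then show ?thesis using main[OF that(2)] unfolding G_def by simp
  qed
  then show ?thesis using E0 by blast
qed

end

text \<open>The gain comes from concavity: write \<open>z powr (7 / 8)\<close> as
  \<open>z * z powr (- 1 / 8)\<close> and use that neither part exceeds
  \<open>9 / 10 * n\<close>.\<close>

lemma powr_splitting:
  fixes x y n :: real
  assumes "n > 0" "0 < x" "x \<le> 9 / 10 * n" "0 < y" "y \<le> 9 / 10 * n" "n \<le> x + y"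
  shows "(9 / 10) powr (- 1 / 8) * n powr (7 / 8) \<le> x powr (7 / 8) + y powr (7 / 8)"
proof -
  have *: "z * ((9 / 10) powr (- 1 / 8) * n powr (- 1 / 8)) \<le> z powr (7 / 8)"
    if z: "0 < z" "z \<le> 9 / 10 * n" for z
  proof -
    have "(9 / 10) powr (- 1 / 8) * n powr (- 1 / 8) = (9 / 10 * n) powr (- 1 / 8)"
      using assms(1) by (subst powr_mult) auto
    also have "\<dots> \<le> z powr (- 1 / 8)" using z by (intro powr_mono2') auto
    finally have "z * ((9 / 10) powr (- 1 / 8) * n powr (- 1 / 8)) \<le> z * z powr (- 1 / 8)"
      using z by (intro mult_left_mono) auto
    also have "\<dots> = z powr (1 + - 1 / 8)" using z by (subst powr_add) auto
    finally show ?thesis by simp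
  qed
  have "n powr (7 / 8) = n powr (1 + - 1 / 8)" by simp
  also have "\<dots> = n * n powr (- 1 / 8)" using assms(1) by (subst powr_add) auto
  finally have "(9 / 10) powr (- 1 / 8) * n powr (7 / 8) = n * ((9 / 10) powr (- 1 / 8) * n powr (- 1 / 8))"
    by simp
  also have "\<dots> \<le> (x + y) * ((9 / 10) powr (- 1 / 8) * n powr (- 1 / 8))"
    using assms(6) by (intro mult_right_mono) auto
  also have "\<dots> \<le> x powr (7 / 8) + y powr (7 / 8)"
    using *[OF assms(2,3)] *[OF assms(4,5)] by (simp add: distrib_right)
  finally show ?thesis .
qed

context area
begin

text \<open>If both pairs of opposite sides were further apart than \<open>\<delta>\<close>, the two
  factors in \<open>rectangle\<close> would be at least \<open>\<delta> / 2\<close>, because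
  \<open>\<delta> \<ge> 6 * r\<close>.\<close>

lemma chord_of_area:
  fixes A \<delta> :: real
  assumes "pth p1 p2 n1 V1 a1" "pth p2 p3 n2 V2 a2" "pth p3 p4 n3 V3 a3" "pth p4 p1 n4 V4 a4"
    and "Fil (a1 + a2 + a3 + a4) A" and \<delta>: "\<delta> \<ge> 6 * r" and A: "4 * r * k * A < \<delta>\<^sup>2"
  shows "(\<exists>v\<in>V1. \<exists>w\<in>V3. real (d v w) \<le> \<delta>) \<or> (\<exists>v\<in>V2. \<exists>w\<in>V4. real (d v w) \<le> \<delta>)"
proof (rule ccontr)
  assume neg: "\<not> ?thesis"
  define D where "D = nat \<lceil>\<delta>\<rceil>"
  have D: "real D \<ge> \<delta>" unfolding D_def by linarith
  have "\<forall>v\<in>V1. \<forall>w\<in>V3. D \<le> d v w" "\<forall>v\<in>V2. \<forall>w\<in>V4. D \<le> d v w"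
    unfolding D_def using neg by (fastforce simp: not_le)+
  from rectangle[OF assms(1-5) this]
  have "real (D - 2 * r) * real (D - 3 * r) \<le> real r * real k * A" by simp
  moreover have "(\<delta> / 2) * (\<delta> / 2) \<le> real (D - 2 * r) * real (D - 3 * r)"
    using D \<delta> by (intro mult_mono) linarith+
  ultimately have "\<delta>\<^sup>2 \<le> 4 * r * k * A" by (simp add: power2_eq_square)
  then show False using A by simp
qed

text \<open>
  By the previous bound the chords have length \<open>O(n powr (3 / 4))\<close>, which is absorbed by subtracting
  \<open>n powr (7 / 8)\<close> from a linear bound.
\<close>

lemma linear_area:
  fixes K :: real
  assumes quad: "\<And>n x V a. pth x x n V a \<Longrightarrow> Fil a (K * (real n)\<^sup>2 + K)" and K: "K > 0"
    and sub: "\<And>\<epsilon> N. \<epsilon> > 0 \<Longrightarrow> \<exists>L\<ge>N. loops_fill L (\<epsilon> * (real L)\<^sup>2)"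
  shows "\<exists>C\<ge>0. \<forall>n x V a. pth x x n V a \<longrightarrow> Fil a (C * (real n + 1))"
proof -
  have r1: "real r \<ge> 1" and k1: "real k \<ge> 1" using r_pos k_pos by simp_all
  obtain E N where E: "E > 0" and EN: "\<And>n x V a. n \<ge> N \<Longrightarrow> pth x x n V a \<Longrightarrow> Fil a (E * (real n * sqrt n))"
  proof -
    have "\<exists>E n0. E > 0 \<and> (\<forall>n\<ge>n0. \<forall>x V a. pth x x n V a \<longrightarrow> Fil a (E * (real n * sqrt n)))"
      by (rule three_halves_growth[where K = K]) (fact quad K sub)+
    then show thesis using that by blast
  qed
  define \<eta> :: real where "\<eta> = min (1 / 5) ((9 / 10) powr (- 1 / 8) - 1)"
  have eta: "\<eta> > 0" "\<eta> \<le> 1 / 5" "1 + \<eta> \<le> (9 / 10) powr (- 1 / 8)"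
  proof -
    have "(1 :: real) < (9 / 10) powr (- 1 / 8)"
      using powr_less_mono2_neg[of "- 1 / 8" "9 / 10" "1 :: real"] by simp
    then show "\<eta> > 0" "\<eta> \<le> 1 / 5" "1 + \<eta> \<le> (9 / 10) powr (- 1 / 8)" unfolding \<eta>_def by linarith+
  qed
  \<comment> \<open>With chords \<open>C * n powr (3 / 4)\<close> and area
    \<open>E * n * sqrt n\<close>, the conditions of \<open>chord_of_area\<close> reduce to
    \<open>C \<ge> 6 * r\<close> and \<open>4 * r * k * E < C\<^sup>2\<close>.\<close>
  define C where "C = 8 * r * k * (E + 1)"
  have C6: "C \<ge> 6 * r"
  proof -
    have "6 * real r * 1 \<le> 8 * r * (k * (E + 1))"
      using r1 k1 E by (intro mult_mono) (auto intro: mult_ge1_I order_trans[of 1 "real k * 1"] mult_left_mono)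
    then show ?thesis unfolding C_def by (simp add: mult.assoc)
  qed
  have CE: "4 * r * k * E < C\<^sup>2"
  proof -
    have "4 * r * k * E < C" unfolding C_def using r1 k1 E by (simp add: algebra_simps add_pos_pos)
    also have "C * 1 \<le> C * C" using C6 r1 by (intro mult_left_mono) auto
    finally show ?thesis by (simp add: power2_eq_square)
  qed
  \<comment> \<open>From here on \<open>n powr (1 / 8) \<ge> 4 * C / \<eta>\<close>, so the
    concavity gain \<open>\<eta> * n powr (7 / 8)\<close> pays for the chord, which enters
    \<open>G\<close> with the factor 4.\<close>
  define n0 where "n0 = N + 20 + nat \<lceil>(4 * C / \<eta>) powr 8\<rceil>"
  have n0: "n0 \<ge> 20" "n0 \<ge> N" "real n0 \<ge> (4 * C / \<eta>) powr 8" unfolding n0_def by linarith+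
  define M where "M = 5 * K * ((real n0)\<^sup>2 + 1)"
  have M: "M > 0" unfolding M_def using K by (simp add: add_nonneg_pos)
  define G where "G x = M * (2 * x - x powr (7 / 8))" for x :: real
  have G_ge: "M * x \<le> G x" if "x \<ge> 1" for x
  proof -
    have "x powr (7 / 8) \<le> x powr 1" using that by (intro powr_mono) auto
    then have "x \<le> 2 * x - x powr (7 / 8)" using that by simp
    then show ?thesis unfolding G_def using M by (intro mult_left_mono) auto
  qed
  have main: "Fil a (G n)" if "pth x x n V a" "real n0 / 5 \<le> n" for n x V a
    using that
  proof (induction n arbitrary: x V a rule: less_induct)
    case (less n)
    have n1: "real n \<ge> 1" using less.prems(2) n0(1) by linarith
    show ?case
    proof (cases "n \<le> n0")
      case True
      have "(real n)\<^sup>2 \<le> (real n0)\<^sup>2" using True by (intro power_mono) auto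
      then have "K * (real n)\<^sup>2 + K \<le> K * ((real n0)\<^sup>2 + 1)" using K by (simp add: distrib_left)
      also have "\<dots> \<le> M * 1" unfolding M_def using K by simp
      also have "\<dots> \<le> M * n" using n1 M by (intro mult_left_mono) auto
      also have "\<dots> \<le> G n" by (rule G_ge[OF n1])
      finally show ?thesis using quad[OF less.prems(1)] Fil_mono by blast
    next
      case False
      define \<delta> where "\<delta> = C * n powr (3 / 4)"
      have C0: "C > 0" using C6 r1 by linarith
      have d6: "\<delta> \<ge> 6 * r"
      proof -
        have "C * 1 \<le> \<delta>" unfolding \<delta>_def using C0 n1 by (intro mult_left_mono ge_one_powr_ge_zero) auto
        then show ?thesis using C6 by linarith
      qed
      have dA: "4 * r * k * (E * (real n * sqrt n)) < \<delta>\<^sup>2"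
      proof -
        have "\<delta>\<^sup>2 = C\<^sup>2 * (n powr (3 / 4) * n powr (3 / 4))"
          unfolding \<delta>_def by (simp add: power2_eq_square)
        also have "n powr (3 / 4) * n powr (3 / 4) = n powr (1 + 1 / 2)"
          by (subst powr_add[symmetric]) simp
        also have "\<dots> = real n * sqrt n" using n1 by (subst powr_add) (auto simp: powr_half_sqrt)
        finally have "\<delta>\<^sup>2 = C\<^sup>2 * (real n * sqrt n)" .
        moreover have "real n * sqrt n > 0" using n1 by simp
        then have "4 * r * k * E * (real n * sqrt n) < C\<^sup>2 * (real n * sqrt n)"
          by (rule mult_strict_right_mono[OF CE])
        ultimately show ?thesis by (simp add: mult.assoc)
      qed
      have d4: "4 * \<delta> \<le> \<eta> * n powr (7 / 8)"
      proof -
        have "4 * C / \<eta> = ((4 * C / \<eta>) powr 8) powr (1 / 8)"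
          unfolding powr_powr using C0 eta by simp
        also have "\<dots> \<le> n powr (1 / 8)" using n0(3) False by (intro powr_mono2) auto
        finally have "4 * C \<le> \<eta> * n powr (1 / 8)" using eta by (simp add: pos_divide_le_eq mult.commute)
        then have "4 * C * n powr (3 / 4) \<le> \<eta> * n powr (1 / 8) * n powr (3 / 4)"
          by (intro mult_right_mono) auto
        also have "\<dots> = \<eta> * n powr (7 / 8)" by (simp add: powr_add[symmetric])
        finally show ?thesis unfolding \<delta>_def by simp
      qed
      have d20: "\<delta> \<le> n / 20"
      proof -
        have "n powr (7 / 8) \<le> n powr 1" using n1 by (intro powr_mono) auto
        then have "\<eta> * n powr (7 / 8) \<le> 1 / 5 * n" using eta n1 by (intro mult_mono) auto
        then show ?thesis using d4 by linarith
      qed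
      have Fa: "Fil a (E * (real n * sqrt n))" using EN less.prems(1) False n0 by simp
      obtain u v m1 m2 W1 W2 b1 b2 where *: "pth u u m1 W1 b1" "pth v v m2 W2 b2" "a = b1 + b2"
         "real m1 + real m2 \<le> n + 2 * \<delta>" "n \<le> m1 + m2" "real n / 5 \<le> m1" "real n / 5 \<le> m2"
      proof -
        have "\<exists>u v m1 m2 W1 W2 b1 b2. pth u u m1 W1 b1 \<and> pth v v m2 W2 b2 \<and> a = b1 + b2 \<and>
          real m1 + real m2 \<le> n + 2 * \<delta> \<and> n \<le> m1 + m2 \<and> real n / 5 \<le> m1 \<and> real n / 5 \<le> m2"
        proof (rule loop_cut[OF less.prems(1)], goal_cases)
          case 1 then show ?case using False n0(1) by simp
        next
          case 2
          show ?case by (rule chord_of_area[OF 2(1-4) _ d6 dA]) (use Fa 2(5) in simp)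
        qed
        then show thesis using that by blast
      qed
      have mi: "real m1 \<le> 9 / 10 * n" "real m2 \<le> 9 / 10 * n" using *(4,6,7) d20 by linarith+
      have lt: "m1 < n" "m2 < n" using mi n1 by linarith+
      have ge: "real n0 / 5 \<le> m1" "real n0 / 5 \<le> m2" using *(6,7) False by linarith+
      have F: "Fil a (G m1 + G m2)"
        unfolding *(3) by (rule Fil_add[OF less.IH[OF lt(1) *(1) ge(1)] less.IH[OF lt(2) *(2) ge(2)]])
      have "(1 + \<eta>) * n powr (7 / 8) \<le> (9 / 10) powr (- 1 / 8) * n powr (7 / 8)"
        using eta by (intro mult_right_mono) auto
      also have "\<dots> \<le> m1 powr (7 / 8) + m2 powr (7 / 8)"
        using *(5-7) mi n1 by (intro powr_splitting) linarith+
      finally have "2 * real m1 + 2 * real m2 - (m1 powr (7 / 8) + m2 powr (7 / 8)) \<le>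
          2 * n - n powr (7 / 8)"
        using *(4) d4 by (simp add: distrib_right)
      then have "M * (2 * real m1 + 2 * real m2 - (m1 powr (7 / 8) + m2 powr (7 / 8))) \<le> G n"
        unfolding G_def using M by (intro mult_left_mono) auto
      then have "G m1 + G m2 \<le> G n" unfolding G_def by (simp add: algebra_simps)
      then show ?thesis using F Fil_mono by blast
    qed
  qed
  have "Fil a (2 * M * (real n + 1))" if p: "pth x x n V a" for n x V a
  proof (cases "real n0 / 5 \<le> n")
    case True
    have "G n \<le> M * (2 * real n)" unfolding G_def using M by (intro mult_left_mono) auto
    also have "\<dots> \<le> 2 * M * (real n + 1)" using M by (simp add: algebra_simps)
    finally show ?thesis using main[OF p True] Fil_mono by blast
  next
    case False
    then have "n \<le> n0" by linarith
    then have "(real n)\<^sup>2 \<le> (real n0)\<^sup>2" by (intro power_mono) auto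
    then have "K * (real n)\<^sup>2 + K \<le> K * ((real n0)\<^sup>2 + 1)" using K by (simp add: distrib_left)
    also have "\<dots> \<le> 2 * M * 1" unfolding M_def using K by simp
    also have "\<dots> \<le> 2 * M * (real n + 1)" using M by (intro mult_left_mono) auto
    finally show ?thesis using quad[OF p] Fil_mono by blast
  qed
  then show ?thesis using M by (intro exI[of _ "2 * M"]) auto
qed

end

section \<open>Contraction towards a base point\<close>

text \<open>
  \<open>pr s\<close> projects to the ball of radius \<open>s\<close> about \<open>p\<close>. Points at distance at most \<open>3 * D + 2\<close> come within \<open>D\<close>
  after descending by \<open>W\<close>; the slack allows to move them by \<open>D\<close> between two descents.
\<close>

context graph_metric
begin

definition contracting :: "'v \<Rightarrow> (nat \<Rightarrow> 'v \<Rightarrow> 'v) \<Rightarrow> nat \<Rightarrow> nat \<Rightarrow> bool" where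
  "contracting p pr D W \<longleftrightarrow>
     (\<forall>s x. d p (pr s x) = min s (d p x)) \<and> (\<forall>s x. d (pr s x) x \<le> d p x - s) \<and>
     (\<forall>x y s. d x y \<le> 1 \<longrightarrow> s \<le> d p x \<longrightarrow> s \<le> d p y \<longrightarrow> d (pr s x) (pr s y) \<le> D) \<and>
     (\<forall>x y s. d p x = d p y \<longrightarrow> d x y \<le> 3 * D + 2 \<longrightarrow> s + W \<le> d p x \<longrightarrow> d (pr s x) (pr s y) \<le> D)"

text \<open>One neighbour closer to \<open>p\<close> is chosen for each vertex once and for all. The
  iterates then follow a tree of geodesics, so the projections of a point to all levels lie on a
  single path.\<close>

definition parent :: "'v \<Rightarrow> 'v \<Rightarrow> 'v" where
  "parent p x = (if x = p then p else (SOME z. d p z = d p x - 1 \<and> d z x = 1))"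

definition proj :: "'v \<Rightarrow> nat \<Rightarrow> 'v \<Rightarrow> 'v" where
  "proj p s x = (parent p ^^ (d p x - s)) x"

lemma parent:
  assumes "x \<noteq> p"
  shows "d p (parent p x) = d p x - 1" "d (parent p x) x = 1"
proof -
  have "d p x = Suc (d p x - 1)" using assms d_zero[of p x] by auto
  then have "\<exists>z. d p z = d p x - 1 \<and> d z x = 1" by (rule d_step)
  from someI_ex[OF this] show "d p (parent p x) = d p x - 1" "d (parent p x) x = 1"
    unfolding parent_def using assms by auto
qed

lemma iterate_parent:
  "i \<le> d p x \<Longrightarrow> d p ((parent p ^^ i) x) = d p x - i \<and> d ((parent p ^^ i) x) x \<le> i"
proof (induction i)
  case (Suc i)
  define y where "y = (parent p ^^ i) x"
  have IH: "d p y = d p x - i" "d y x \<le> i" using Suc unfolding y_def by auto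
  then have "y \<noteq> p" using Suc.prems by (auto simp: d_zero)
  from parent[OF this] have "d p (parent p y) = d p x - Suc i" "d (parent p y) y = 1"
    using IH by auto
  then show ?case using d_tri[of "parent p y" x y] IH unfolding y_def by simp
qed simp

lemma proj_height: "d p (proj p s x) = min s (d p x)"
  unfolding proj_def using iterate_parent[of "d p x - s" p x] by auto

lemma proj_move: "d (proj p s x) x \<le> d p x - s"
  unfolding proj_def using iterate_parent[of "d p x - s" p x] by auto

lemma proj_Suc: "Suc s \<le> d p x \<Longrightarrow> d (proj p (Suc s) x) (proj p s x) \<le> 1"
proof -
  assume s: "Suc s \<le> d p x"
  have "proj p s x = parent p (proj p (Suc s) x)"
  proof -
    have "d p x - s = Suc (d p x - Suc s)" using s by simp
    then show ?thesis unfolding proj_def by simp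
  qed
  moreover have "proj p (Suc s) x \<noteq> p" using proj_height[of p "Suc s" x] s by (auto simp: d_zero)
  ultimately show ?thesis using parent(2)[of "proj p (Suc s) x" p] d_sym by simp
qed

lemma proj_le: "s \<le> t \<Longrightarrow> t \<le> d p x \<Longrightarrow> d (proj p t x) (proj p s x) \<le> t - s"
proof (induction t rule: dec_induct)
  case (step t)
  then have "d (proj p (Suc t) x) (proj p t x) \<le> 1" "d (proj p t x) (proj p s x) \<le> t - s"
    using proj_Suc by auto
  then show ?case using d_tri[of "proj p (Suc t) x" "proj p s x" "proj p t x"] step by linarith
qed simp

end

context edge_chains
begin

lemma proj_path:
  "s \<le> t \<Longrightarrow> t \<le> d p x \<Longrightarrow>
    \<exists>V a. pth (proj p t x) (proj p s x) (t - s) V a \<and> (\<forall>v\<in>V. \<exists>u. s \<le> u \<and> u \<le> t \<and> v = proj p u x)"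
proof (induction t rule: dec_induct)
  case base
  then show ?case using pth_nil[of "proj p s x"] by force
next
  case (step t)
  then obtain V a where V: "pth (proj p t x) (proj p s x) (t - s) V a"
    "\<forall>v\<in>V. \<exists>u. s \<le> u \<and> u \<le> t \<and> v = proj p u x" by auto
  have "pth (proj p (Suc t) x) (proj p s x) (Suc t - s) (insert (proj p (Suc t) x) V)
      (E (proj p (Suc t) x) (proj p t x) + a)"
    using pth_step[OF proj_Suc V(1)] step by (simp add: Suc_diff_le)
  moreover have "\<forall>v\<in>insert (proj p (Suc t) x) V. \<exists>u. s \<le> u \<and> u \<le> Suc t \<and> v = proj p u x"
    using V(2) step le_SucI by blast
  ultimately show ?case by blast
qed

end

context area
begin

text \<open>The strip between two descending geodesics has width about \<open>b / 2\<close>, hence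
  area at least proportional to \<open>b\<close> times its height, whereas its length is about twice
  the height. The choice of \<open>b\<close> makes the linear area bound account for at most half of
  the height, up to a constant depending on the two ends.\<close>

lemma strip:
  fixes C :: real
  assumes C: "\<And>n x V a. pth x x n V a \<Longrightarrow> Fil a (C * (real n + 1))" "C \<ge> 0"
    and b: "b = 2 * (2 * r + nat \<lceil>4 * r * k * C\<rceil> + 1)"
    and s: "s1 \<le> s0" "s0 \<le> d p x" "s0 \<le> d p y"
    and g: "\<And>s. s1 \<le> s \<Longrightarrow> s \<le> s0 \<Longrightarrow> b < d (proj p s x) (proj p s y)"
    and g1: "d (proj p s1 x) (proj p s1 y) \<le> b + 2" and g0: "d (proj p s0 x) (proj p s0 y) \<le> D"
  shows "s0 - s1 \<le> 3 * D + 3 * b + 9 + 6 * r"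
proof -
  obtain V1 a1 where w1: "pth (proj p s0 x) (proj p s1 x) (s0 - s1) V1 a1"
    and V1: "\<forall>v\<in>V1. \<exists>u. s1 \<le> u \<and> u \<le> s0 \<and> v = proj p u x" using proj_path[OF s(1,2)] by blast
  obtain V3 a3 where w3: "pth (proj p s0 y) (proj p s1 y) (s0 - s1) V3 a3"
    and V3: "\<forall>v\<in>V3. \<exists>u. s1 \<le> u \<and> u \<le> s0 \<and> v = proj p u y" using proj_path[OF s(1,3)] by blast
  obtain V2 a2 where w2: "pth (proj p s1 x) (proj p s1 y) (d (proj p s1 x) (proj p s1 y)) V2 a2"
    using geodesic by blast
  obtain V4 a4 where w4: "pth (proj p s0 y) (proj p s0 x) (d (proj p s0 y) (proj p s0 x)) V4 a4"
    using geodesic by blast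
  note w3' = pth_rev[OF w3]
  define n where "n = s0 - s1 + d (proj p s1 x) (proj p s1 y) + (s0 - s1) + d (proj p s0 y) (proj p s0 x)"
  have "pth (proj p s0 x) (proj p s0 x) n (V1 \<union> V2 \<union> V3 \<union> V4) (a1 + a2 + - a3 + a4)"
    unfolding n_def by (rule pth_append[OF pth_append[OF pth_append[OF w1 w2] w3'] w4])
  then have fil: "Fil (a1 + a2 + - a3 + a4) (C * (real n + 1))" by (rule C)
  \<comment> \<open>The distance is controlled at equal levels only. Moving \<open>w\<close> to the
    level of \<open>v\<close> costs the difference of levels, which is at most \<open>d v w\<close>;
    hence the loss of a factor 2.\<close>
  have D1: "\<forall>v\<in>V1. \<forall>w\<in>V3. b div 2 \<le> d v w"
  proof (intro ballI)
    fix v w assume "v \<in> V1" "w \<in> V3"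
    then obtain u u' where u: "s1 \<le> u" "u \<le> s0" "v = proj p u x" "s1 \<le> u'" "u' \<le> s0" "w = proj p u' y"
      using V1 V3 by blast
    have h: "d p v = u" "d p w = u'" using u s proj_height by auto
    have "b < d v (proj p u y)" using g[OF u(1,2)] u(3) by simp
    moreover have "d w (proj p u y) \<le> (u - u') + (u' - u)"
    proof (cases "u \<le> u'")
      case True
      then show ?thesis using proj_le[of u u' p y] u s by simp
    next
      case False
      then show ?thesis using proj_le[of u' u p y] u s d_sym[of w] by simp
    qed
    moreover have "u - u' \<le> d v w" "u' - u \<le> d v w"
      using h d_tri[of p v w] d_tri[of p w v] d_sym[of v w] by linarith+
    ultimately have "b \<le> 2 * d v w" using d_tri[of v "proj p u y" w] by linarith
    then show "b div 2 \<le> d v w" by linarith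
  qed
  define m where "m = s0 - s1"
  have D2: "\<forall>v\<in>V2. \<forall>w\<in>V4. m - D - b - 2 \<le> d v w"
  proof (intro ballI)
    fix v w assume v: "v \<in> V2" and w: "w \<in> V4"
    have "d p v \<le> s1 + (b + 2)"
      using pth_dist[OF w2 v] g1 d_tri[of p v "proj p s1 x"] proj_height[of p s1 x] s by simp
    moreover have "s0 \<le> d p w + D"
      using pth_dist[OF w4 w] g0 d_tri[of p "proj p s0 y" w] proj_height[of p s0 y] s
        d_sym[of w "proj p s0 y"] d_sym[of "proj p s0 y" "proj p s0 x"] by simp
    ultimately show "m - D - b - 2 \<le> d v w" unfolding m_def using d_tri[of p w v] by linarith
  qed
  define P where "P = real (b div 2 - 2 * r)"
  have P: "P \<ge> 1" "P \<ge> 4 * r * k * C"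
  proof -
    have "b div 2 - 2 * r = nat \<lceil>4 * r * k * C\<rceil> + 1" unfolding b by simp
    then have "P = real (nat \<lceil>4 * r * k * C\<rceil>) + 1" unfolding P_def by simp
    then show "P \<ge> 1" "P \<ge> 4 * r * k * C" by linarith+
  qed
  have "real ((b div 2 - 2 * r) * (m - D - b - 2 - 3 * r)) \<le> real r * real k * (C * (real n + 1))"
    by (rule rectangle[OF w1 w2 w3' w4 fil D1 D2])
  then have 1: "P * real (m - D - b - 2 - 3 * r) \<le> real r * real k * C * (real n + 1)"
    unfolding P_def by simp
  have "real n \<le> 2 * real m + real D + real b + 2"
    unfolding n_def m_def using g0 g1 d_sym[of "proj p s0 y" "proj p s0 x"] by linarith
  then have "real r * real k * C * (real n + 1) \<le> real r * real k * C * (2 * real m + real D + real b + 3)"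
    using C(2) by (intro mult_left_mono) auto
  also have "\<dots> \<le> (P / 4) * (2 * real m + real D + real b + 3)"
    using P(2) by (intro mult_right_mono) auto
  finally have "P * real (m - D - b - 2 - 3 * r) \<le> P * ((2 * real m + real D + real b + 3) / 4)"
    using 1 by simp
  then have "real (m - D - b - 2 - 3 * r) \<le> (2 * real m + real D + real b + 3) / 4"
    using P(1) by (simp add: mult_le_cancel_left)
  moreover have "real m - real D - real b - 2 - 3 * real r \<le> real (m - D - b - 2 - 3 * r)" by linarith
  ultimately have "4 * (real m - real D - real b - 2 - 3 * real r) \<le> 2 * real m + real D + real b + 3"
    by argo
  then have "real m \<le> 3 * real D + 3 * real b + 9 + 6 * real r" by (simp add: algebra_simps)
  then show ?thesis unfolding m_def by linarith
qed

text \<open>Finds the lower end of the excursion of \<open>g\<close> above \<open>b\<close> that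
  contains \<open>s\<close>. As \<open>g\<close> rises by at most 2 per step, its value there is
  still at most \<open>b + 2\<close>; \<open>ascend\<close> does the same for the upper end.\<close>

lemma descend:
  fixes g :: "nat \<Rightarrow> nat"
  assumes "b < g s" "g 0 \<le> b" "\<And>t. Suc t \<le> s \<Longrightarrow> g (Suc t) \<le> g t + 2"
  shows "\<exists>t\<le>s. (\<forall>u. t \<le> u \<longrightarrow> u \<le> s \<longrightarrow> b < g u) \<and> g t \<le> b + 2"
  using assms
proof (induction s)
  case (Suc s)
  show ?case
  proof (cases "b < g s")
    case True
    then obtain t where "t \<le> s" "\<forall>u. t \<le> u \<longrightarrow> u \<le> s \<longrightarrow> b < g u" "g t \<le> b + 2"
      using Suc by auto
    then show ?thesis using Suc.prems(1) by (intro exI[of _ t]) (auto simp: le_Suc_eq)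
  next
    case False
    then have "g (Suc s) \<le> b + 2" using Suc.prems(3)[of s] by simp
    then show ?thesis using Suc.prems(1) by (intro exI[of _ "Suc s"]) auto
  qed
qed simp

lemma ascend:
  fixes g :: "nat \<Rightarrow> nat"
  assumes "b < g s" "s \<le> e" "g e \<le> b" "\<And>t. Suc t \<le> e \<Longrightarrow> g t \<le> g (Suc t) + 2"
  shows "\<exists>t. s \<le> t \<and> t \<le> e \<and> (\<forall>u. s \<le> u \<longrightarrow> u \<le> t \<longrightarrow> b < g u) \<and> g t \<le> b + 2"
  using assms(2,1)
proof (induction s rule: inc_induct)
  case base
  then show ?case using assms(3) by simp
next
  case (step s)
  show ?case
  proof (cases "b < g (Suc s)")
    case True
    then obtain t where "Suc s \<le> t" "t \<le> e" "\<forall>u. Suc s \<le> u \<longrightarrow> u \<le> t \<longrightarrow> b < g u" "g t \<le> b + 2"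
      using step.IH by blast
    then show ?thesis using step.prems
      by (intro exI[of _ t]) (auto simp: not_less_eq_eq, metis le_antisym not_less_eq_eq)
  next
    case False
    then have "g s \<le> b + 2" using assms(4)[of s] step by simp
    then show ?thesis using step by (intro exI[of _ s]) auto
  qed
qed

text \<open>While two descending geodesics are more than \<open>b\<close> apart they bound a strip,
  and \<open>strip\<close> limits its height. So geodesics that were once close never separate
  beyond \<open>B\<close>, and those starting at distance \<open>3 * B + 2\<close> become close
  within \<open>W\<close> levels.\<close>

lemma contraction:
  fixes C :: real
  assumes C: "\<And>n x V a. pth x x n V a \<Longrightarrow> Fil a (C * (real n + 1))" "C \<ge> 0"
  shows "\<exists>pr D W. contracting p pr D W"
proof -
  define b where "b = 2 * (2 * r + nat \<lceil>4 * r * k * C\<rceil> + 1)"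
  have b3: "3 \<le> b" unfolding b_def using r_pos by simp
  define \<tau> where "\<tau> D = 3 * D + 3 * b + 9 + 6 * r" for D
  \<comment> \<open>An excursion between ends at distance at most \<open>b + 2\<close> has height at
    most \<open>\<tau> (b + 2)\<close>, and inside it the distance exceeds that at the upper end by
    at most twice this height. \<open>W\<close> exceeds the height of a strip with top of width at
    most \<open>3 * B + 2\<close>.\<close>
  define B where "B = b + 2 + 2 * \<tau> (b + 2)"
  define W where "W = \<tau> (3 * B + 2) + 1"
  have bB: "b \<le> B" unfolding B_def by simp
  have lip: "d (proj p s x) (proj p s y) \<le> d (proj p (Suc s) x) (proj p (Suc s) y) + 2 \<and>
     d (proj p (Suc s) x) (proj p (Suc s) y) \<le> d (proj p s x) (proj p s y) + 2"
    if "Suc s \<le> d p x" "Suc s \<le> d p y" for s x y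
    using proj_Suc[OF that(1)] proj_Suc[OF that(2)]
      d_tri[of "proj p s x" "proj p s y" "proj p (Suc s) x"]
      d_tri[of "proj p (Suc s) x" "proj p s y" "proj p (Suc s) y"]
      d_tri[of "proj p (Suc s) x" "proj p (Suc s) y" "proj p s x"]
      d_tri[of "proj p s x" "proj p (Suc s) y" "proj p s y"]
      d_sym[of "proj p s x" "proj p (Suc s) x"] d_sym[of "proj p s y" "proj p (Suc s) y"]
    by linarith
  have zero: "proj p 0 x = p" for x using proj_height[of p 0 x] by (simp add: d_zero)
  have below: "\<exists>t\<le>s. (\<forall>u. t \<le> u \<longrightarrow> u \<le> s \<longrightarrow> b < d (proj p u x) (proj p u y)) \<and>
      d (proj p t x) (proj p t y) \<le> b + 2"
    if "b < d (proj p s x) (proj p s y)" "s \<le> d p x" "s \<le> d p y" for s x y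
    by (rule descend[where g = "\<lambda>s. d (proj p s x) (proj p s y)"]) (use that zero lip in auto)
  have returns: "d (proj p s x) (proj p s y) \<le> B"
    if e: "s \<le> e" "e \<le> d p x" "e \<le> d p y" "d (proj p e x) (proj p e y) \<le> b" for s e x y
  proof (cases "b < d (proj p s x) (proj p s y)")
    case False
    then show ?thesis using bB by linarith
  next
    case True
    obtain t where t: "t \<le> s" "\<forall>u. t \<le> u \<longrightarrow> u \<le> s \<longrightarrow> b < d (proj p u x) (proj p u y)"
      "d (proj p t x) (proj p t y) \<le> b + 2" using below[OF True] e by auto
    have "\<exists>t. s \<le> t \<and> t \<le> e \<and> (\<forall>u. s \<le> u \<longrightarrow> u \<le> t \<longrightarrow> b < d (proj p u x) (proj p u y)) \<and>
       d (proj p t x) (proj p t y) \<le> b + 2"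
      by (rule ascend[where g = "\<lambda>s. d (proj p s x) (proj p s y)"]) (use True e lip in auto)
    then obtain t' where t': "s \<le> t'" "t' \<le> e" "\<forall>u. s \<le> u \<longrightarrow> u \<le> t' \<longrightarrow> b < d (proj p u x) (proj p u y)"
      "d (proj p t' x) (proj p t' y) \<le> b + 2" by blast
    have "b < d (proj p u x) (proj p u y)" if "t \<le> u" "u \<le> t'" for u
      using t t' that nle_le by blast
    then have "t' - t \<le> \<tau> (b + 2)"
      unfolding \<tau>_def using t t' e by (intro strip[OF C b_def, where p = p and x = x and y = y]) auto
    moreover have "d (proj p s x) (proj p s y) \<le> (t' - s) + (b + 2) + (t' - s)"
      using proj_le[of s t' p x] proj_le[of s t' p y] t' e
        d_tri[of "proj p s x" "proj p s y" "proj p t' x"]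
        d_tri[of "proj p t' x" "proj p s y" "proj p t' y"] d_sym[of "proj p s x" "proj p t' x"]
      by linarith
    ultimately show ?thesis unfolding B_def using t(1) by linarith
  qed
  have near: "d (proj p s x) (proj p s y) \<le> B" if "d x y \<le> 1" "s \<le> d p x" "s \<le> d p y" for x y s
  proof (rule returns[of s "min (d p x) (d p y)"])
    let ?m = "min (d p x) (d p y)"
    have "d (proj p ?m x) x \<le> 1" "d (proj p ?m y) y \<le> 1"
      using proj_move[of p ?m x] proj_move[of p ?m y] that(1)
        d_tri[of p x y] d_tri[of p y x] d_sym[of x y] by linarith+
    then show "d (proj p ?m x) (proj p ?m y) \<le> b"
      using b3 that(1) d_tri[of "proj p ?m x" "proj p ?m y" x] d_tri[of x "proj p ?m y" y]
        d_sym[of "proj p ?m y" y] by linarith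
  qed (use that in auto)
  have far: "d (proj p s x) (proj p s y) \<le> B"
    if h: "d p x = d p y" "d x y \<le> 3 * B + 2" "s + W \<le> d p x" for x y s
  proof (cases "\<exists>u. s \<le> u \<and> u \<le> d p x \<and> d (proj p u x) (proj p u y) \<le> b")
    case True
    then show ?thesis using returns h by force
  next
    case False
    then have gt: "b < d (proj p u x) (proj p u y)" if "s \<le> u" "u \<le> d p x" for u
      using that by (simp add: not_le[symmetric])
    obtain t where t: "t \<le> s" "\<forall>u. t \<le> u \<longrightarrow> u \<le> s \<longrightarrow> b < d (proj p u x) (proj p u y)"
      "d (proj p t x) (proj p t y) \<le> b + 2" using below[OF gt[of s]] h by auto
    have "b < d (proj p u x) (proj p u y)" if "t \<le> u" "u \<le> d p x" for u
      using t gt that nle_le by blast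
    moreover have "proj p (d p x) x = x" "proj p (d p x) y = y" using h(1) unfolding proj_def by simp_all
    ultimately have "d p x - t \<le> \<tau> (3 * B + 2)"
      unfolding \<tau>_def using t h by (intro strip[OF C b_def, where p = p and x = x and y = y]) auto
    then show ?thesis using h(3) t(1) unfolding W_def by linarith
  qed
  have "contracting p (proj p) B W"
    unfolding contracting_def using proj_height proj_move near far by blast
  then show ?thesis by blast
qed

end

abbreviation keys where "keys \<equiv> Poly_Mapping.keys"
abbreviation lookup where "lookup \<equiv> Poly_Mapping.lookup"
abbreviation single where "single \<equiv> Poly_Mapping.single"

section \<open>Word metrics\<close>

definition word_length :: "'g::group_add set \<Rightarrow> 'g \<Rightarrow> nat" where
  "word_length S g = (LEAST n. \<exists>xs. set xs \<subseteq> S \<and> length xs = n \<and> sum_list xs = g)"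

text \<open>The left invariant choice, so that the left action on the chain modules is by
  isometries.\<close>

definition word_dist :: "'g::group_add set \<Rightarrow> 'g \<Rightarrow> 'g \<Rightarrow> nat" where
  "word_dist S x y = word_length S (- x + y)"

locale word_metric =
  fixes S :: "'g::group_add set"
  assumes finite_S: "finite S"
    and sym_S: "s \<in> S \<Longrightarrow> - s \<in> S"
    and gen_S: "\<exists>xs. set xs \<subseteq> S \<and> sum_list xs = g"
begin

lemma word_exists: "\<exists>xs. set xs \<subseteq> S \<and> length xs = word_length S g \<and> sum_list xs = g"
  unfolding word_length_def
  by (rule LeastI_ex) (use gen_S[of g] in auto)

lemma word_length_le: "set xs \<subseteq> S \<Longrightarrow> word_length S (sum_list xs) \<le> length xs"
  unfolding word_length_def by (rule Least_le) auto

lemma word_length_zero: "word_length S 0 = 0"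
  using word_length_le[of "[]"] by simp

lemma word_length_eq_0: "word_length S g = 0 \<longleftrightarrow> g = 0"
  using word_exists[of g] word_length_zero by auto

lemma word_length_generator: "s \<in> S \<Longrightarrow> word_length S s \<le> 1"
  using word_length_le[of "[s]"] by simp

lemma word_length_add: "word_length S (a + b) \<le> word_length S a + word_length S b"
proof -
  obtain xs ys where "set xs \<subseteq> S" "length xs = word_length S a" "sum_list xs = a"
    "set ys \<subseteq> S" "length ys = word_length S b" "sum_list ys = b"
    using word_exists by meson
  then show ?thesis using word_length_le[of "xs @ ys"] by simp
qed

lemma word_length_uminus_le: "word_length S (- a) \<le> word_length S a"
proof -
  obtain xs where xs: "set xs \<subseteq> S" "length xs = word_length S a" "sum_list xs = a"
    using word_exists by meson
  have "sum_list (map uminus (rev xs)) = - sum_list xs" for xs :: "'g list"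
    by (induction xs) (auto simp: minus_add)
  moreover have "set (map uminus (rev xs)) \<subseteq> S" using xs sym_S by auto
  ultimately show ?thesis using word_length_le[of "map uminus (rev xs)"] xs by simp
qed

lemma word_length_uminus: "word_length S (- a) = word_length S a"
  using word_length_uminus_le[of a] word_length_uminus_le[of "- a"] by simp

lemma finite_word_ball: "finite {g. word_length S g \<le> n}"
proof -
  have "{g. word_length S g \<le> n} \<subseteq> sum_list ` {xs. set xs \<subseteq> S \<and> length xs \<le> n}"
  proof
    fix g assume "g \<in> {g. word_length S g \<le> n}"
    then show "g \<in> sum_list ` {xs. set xs \<subseteq> S \<and> length xs \<le> n}"
      using word_exists[of g] by (auto simp: image_iff)
  qed
  then show ?thesis using finite_lists_length_le[OF finite_S] finite_subset by blast
qed

lemma word_dist_right: "word_dist S x (x + k) = word_length S k"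
  unfolding word_dist_def by (simp add: add.assoc[symmetric])

lemma word_ball_eq: "{y. word_dist S x y \<le> n} = (+) x ` {g. word_length S g \<le> n}"
proof
  show "{y. word_dist S x y \<le> n} \<subseteq> (+) x ` {g. word_length S g \<le> n}"
  proof
    fix y assume "y \<in> {y. word_dist S x y \<le> n}"
    then show "y \<in> (+) x ` {g. word_length S g \<le> n}"
      by (intro image_eqI[of _ _ "- x + y"]) (auto simp: word_dist_def add.assoc[symmetric])
  qed
  show "(+) x ` {g. word_length S g \<le> n} \<subseteq> {y. word_dist S x y \<le> n}"
    by (auto simp: word_dist_right)
qed

lemma word_ball_card:
  "finite {y. word_dist S x y \<le> n}"
  "card {y. word_dist S x y \<le> n} = card {g. word_length S g \<le> n}"
  unfolding word_ball_eq using finite_word_ball by (auto intro: card_image)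

sublocale graph_metric "word_dist S"
proof
  fix x y z :: 'g
  show "word_dist S x y = 0 \<longleftrightarrow> x = y"
    unfolding word_dist_def word_length_eq_0 by (metis add_minus_cancel add.right_neutral left_minus)
  have "- (- x + y) = - y + x" by (simp add: minus_add)
  then show "word_dist S x y = word_dist S y x"
    unfolding word_dist_def using word_length_uminus[of "- x + y"] by simp
  have "- x + z = (- x + y) + (- y + z)" by (simp add: add.assoc)
  then show "word_dist S x z \<le> word_dist S x y + word_dist S y z"
    unfolding word_dist_def using word_length_add[of "- x + y" "- y + z"] by simp
next
  fix x y :: 'g and n assume n: "word_dist S x y = Suc n"
  obtain xs where xs: "set xs \<subseteq> S" "length xs = Suc n" "sum_list xs = - x + y"
    using word_exists[of "- x + y"] n unfolding word_dist_def by auto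
  then obtain ys s where ys: "xs = ys @ [s]" by (metis append_butlast_last_id list.size(3) nat.distinct(1))
  define h where "h = sum_list ys"
  have h: "h + s = - x + y" using xs ys h_def by simp
  have 1: "word_length S h \<le> n" using word_length_le[of ys] xs ys h_def by simp
  have 2: "word_length S s \<le> 1" using word_length_generator xs ys by simp
  have 3: "Suc n \<le> word_length S h + word_length S s"
    using word_length_add[of h s] n unfolding h word_dist_def by simp
  have "y = x + h + s" using h by (metis add.assoc add_minus_cancel)
  then have "word_dist S (x + h) y = word_length S s" using word_dist_right[of "x + h" s] by simp
  then show "\<exists>z. word_dist S x z = n \<and> word_dist S z y = 1"
    using 1 2 3 word_dist_right[of x h] by (intro exI[of _ "x + h"]) linarith
qed

end

section \<open>Based modules over a group ring\<close>

lemma lookup_free_scale: "lookup (free_scale a c) i = a * lookup c i" for a :: "'a::ring_1"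
  by (simp add: free_scale_def map.rep_eq when_def)

text \<open>The basis index is forgotten: only the position in the group matters for the
  geometry.\<close>

definition gsupp :: "('i \<Rightarrow>\<^sub>0 ('g \<Rightarrow>\<^sub>0 'r::zero)) \<Rightarrow> 'g set" where
  "gsupp c = (\<Union>z\<in>keys c. keys (lookup c z))"

definition gsize :: "('i \<Rightarrow>\<^sub>0 ('g \<Rightarrow>\<^sub>0 'r::zero)) \<Rightarrow> nat" where
  "gsize c = (\<Sum>z\<in>keys c. card (keys (lookup c z)))"

lemma gsupp_iff: "g \<in> gsupp c \<longleftrightarrow> (\<exists>z. lookup (lookup c z) g \<noteq> 0)"
  unfolding gsupp_def by (force simp: in_keys_iff)

lemma finite_gsupp [simp]: "finite (gsupp c)"
  unfolding gsupp_def by simp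

lemma gsupp_add: "gsupp (b + c) \<subseteq> gsupp b \<union> gsupp c"
  by (auto simp: gsupp_iff lookup_add)

lemma gsupp_minus [simp]: "gsupp (- c) = gsupp c" for c :: "'i \<Rightarrow>\<^sub>0 ('g \<Rightarrow>\<^sub>0 'r::ab_group_add)"
  by (auto simp: gsupp_iff)

lemma gsupp_zero [simp]: "gsupp 0 = {}"
  by (simp add: gsupp_def)

lemma gsupp_free_scale:
  "gsupp (free_scale a c) \<subseteq> {g + h |g h. g \<in> keys a \<and> h \<in> gsupp c}"
  for a :: "'g::group_add \<Rightarrow>\<^sub>0 'r::ring_1"
proof
  fix x assume "x \<in> gsupp (free_scale a c)"
  then obtain z where "x \<in> keys (a * lookup c z)"
    by (auto simp: gsupp_iff lookup_free_scale in_keys_iff)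
  then obtain g h where "x = g + h" "g \<in> keys a" "h \<in> keys (lookup c z)"
    using keys_mult by blast
  then show "x \<in> {g + h |g h. g \<in> keys a \<and> h \<in> gsupp c}"
    by (auto simp: gsupp_iff in_keys_iff)
qed

lemma gsize_superset: "finite A \<Longrightarrow> keys c \<subseteq> A \<Longrightarrow> gsize c = (\<Sum>z\<in>A. card (keys (lookup c z)))"
  unfolding gsize_def by (rule sum.mono_neutral_left) (auto simp: in_keys_iff)

lemma card_gsupp_le: "card (gsupp c) \<le> gsize c"
  unfolding gsupp_def gsize_def by (rule card_UN_le) simp

lemma gsize_add: "gsize (b + c) \<le> gsize b + gsize c"
proof -
  let ?A = "keys b \<union> keys c"
  have "gsize (b + c) = (\<Sum>z\<in>?A. card (keys (lookup b z + lookup c z)))"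
    using gsize_superset[of ?A "b + c"] keys_add[of b c] by (simp add: lookup_add)
  also have "\<dots> \<le> (\<Sum>z\<in>?A. card (keys (lookup b z)) + card (keys (lookup c z)))"
  proof (rule sum_mono)
    fix z
    have "card (keys (lookup b z + lookup c z)) \<le> card (keys (lookup b z) \<union> keys (lookup c z))"
      by (intro card_mono keys_add) auto
    also have "\<dots> \<le> card (keys (lookup b z)) + card (keys (lookup c z))" by (rule card_Un_le)
    finally show "card (keys (lookup b z + lookup c z)) \<le> card (keys (lookup b z)) + card (keys (lookup c z))" .
  qed
  also have "\<dots> = gsize b + gsize c"
    using gsize_superset[of ?A b] gsize_superset[of ?A c] by (simp add: sum.distrib)
  finally show ?thesis .
qed

text \<open>An inequality only, since products with \<open>s\<close> may vanish. That no factor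
  depending on \<open>s\<close> appears is the point of the discrete norm.\<close>

lemma gsize_single_scale: "gsize (free_scale (single g s) c) \<le> gsize c"
  for s :: "'r::ring_1" and g :: "'g::group_add"
proof -
  have "keys (free_scale (single g s) c) \<subseteq> keys c" by (auto simp: in_keys_iff lookup_free_scale)
  from gsize_superset[OF finite_keys this]
  have "gsize (free_scale (single g s) c) = (\<Sum>z\<in>keys c. card (keys (single g s * lookup c z)))"
    by (simp only: lookup_free_scale)
  also have "\<dots> \<le> (\<Sum>z\<in>keys c. card (keys (lookup c z)))"
  proof (rule sum_mono)
    fix z
    have "keys (single g s * lookup c z) \<subseteq> (+) g ` keys (lookup c z)"
      using keys_mult[of "single g s" "lookup c z"] by (auto split: if_splits)
    then show "card (keys (single g s * lookup c z)) \<le> card (keys (lookup c z))"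
      by (meson card_image_le card_mono finite_imageI finite_keys le_trans)
  qed
  finally show ?thesis unfolding gsize_def .
qed

lemma sum_singles: "(\<Sum>g\<in>keys a. single g (lookup a g)) = a"
  by (rule poly_mapping_eqI) (simp add: lookup_sum lookup_single when_def in_keys_iff)

context left_module
begin

lemma scale_zero_left [simp]: "scale 0 x = 0"
  using scale_left_distrib[of 0 0 x] by simp

lemma scale_zero_right [simp]: "scale a 0 = 0"
  using scale_right_distrib[of a 0 0] by simp

lemma scale_minus_left: "scale (- a) x = - scale a x"
  using scale_left_distrib[of a "- a" x] by (simp add: minus_unique)

lemma scale_minus_right: "scale a (- x) = - scale a x"
  using scale_right_distrib[of a x "- x"] by (simp add: minus_unique)

lemma scale_diff_right: "scale a (x - y) = scale a x - scale a y"
  using scale_right_distrib[of a x "- y"] by (simp add: scale_minus_right)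

lemma scale_sum_left: "scale (sum f A) x = (\<Sum>i\<in>A. scale (f i) x)"
  by (induction A rule: infinite_finite_induct) (auto simp: scale_left_distrib)

lemma scale_sum_right: "scale a (sum f A) = (\<Sum>i\<in>A. scale a (f i))"
  by (induction A rule: infinite_finite_induct) (auto simp: scale_right_distrib)

lemma submodule_sum: "submodule scale M \<Longrightarrow> (\<And>i. i \<in> A \<Longrightarrow> f i \<in> M) \<Longrightarrow> sum f A \<in> M"
  by (induction A rule: infinite_finite_induct) (auto simp: submodule_def)

lemma submodule_minus: "submodule scale M \<Longrightarrow> x \<in> M \<Longrightarrow> - x \<in> M"
  using scale_minus_left[of 1 x] unfolding submodule_def scale_one by metis

lemma submodule_diff: "submodule scale M \<Longrightarrow> x \<in> M \<Longrightarrow> y \<in> M \<Longrightarrow> x - y \<in> M"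
  using submodule_minus[of M y] unfolding submodule_def by (metis diff_conv_add_uminus)

lemma keys_free_scale: "keys (free_scale a c) \<subseteq> keys c" for a :: "'a" and c :: "'i \<Rightarrow>\<^sub>0 'a"
  by (auto simp: in_keys_iff lookup_free_scale)

definition linext :: "('i \<Rightarrow> 'm) \<Rightarrow> ('i \<Rightarrow>\<^sub>0 'a) \<Rightarrow> 'm" where
  "linext t c = (\<Sum>i\<in>keys c. scale (lookup c i) (t i))"

lemma linext_superset:
  "finite A \<Longrightarrow> keys c \<subseteq> A \<Longrightarrow> linext t c = (\<Sum>i\<in>A. scale (lookup c i) (t i))"
  unfolding linext_def by (rule sum.mono_neutral_left) (auto simp: in_keys_iff)

lemma linext_add: "linext t (b + c) = linext t b + linext t c"
proof -
  let ?A = "keys b \<union> keys c"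
  have "linext t (b + c) = (\<Sum>i\<in>?A. scale (lookup (b + c) i) (t i))"
    using keys_add[of b c] by (intro linext_superset) auto
  then show ?thesis
    using linext_superset[of ?A b t] linext_superset[of ?A c t]
    by (simp add: lookup_add scale_left_distrib sum.distrib)
qed

lemma linext_free_scale: "linext t (free_scale a c) = scale a (linext t c)"
proof -
  have "linext t (free_scale a c) = (\<Sum>i\<in>keys c. scale (lookup (free_scale a c) i) (t i))"
    by (intro linext_superset keys_free_scale) simp
  then show ?thesis unfolding linext_def by (simp add: lookup_free_scale scale_scale scale_sum_right)
qed

lemma lincomb_eq_linext: "lincomb scale c = linext (\<lambda>x. x) c"
  by (simp add: lincomb_def linext_def)

lemmas lincomb_superset = linext_superset[where t = "\<lambda>x. x", folded lincomb_eq_linext]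
  and lincomb_add = linext_add[where t = "\<lambda>x. x", folded lincomb_eq_linext]
  and lincomb_free_scale = linext_free_scale[where t = "\<lambda>x. x", folded lincomb_eq_linext]

end

lemma module_map_add: "module_map s M t N f \<Longrightarrow> x \<in> M \<Longrightarrow> y \<in> M \<Longrightarrow> f (x + y) = f x + f y"
  unfolding module_map_def by blast

lemma module_map_scale: "module_map s M t N f \<Longrightarrow> x \<in> M \<Longrightarrow> f (s a x) = t a (f x)"
  unfolding module_map_def by blast

lemma module_map_mem: "module_map s M t N f \<Longrightarrow> x \<in> M \<Longrightarrow> f x \<in> N"
  unfolding module_map_def by blast

lemma module_map_zero: "module_map s M t N f \<Longrightarrow> submodule s M \<Longrightarrow> f 0 = 0"
  using module_map_add[of s M t N f 0 0] unfolding submodule_def by simp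

lemma module_map_sum:
  "module_map s M t N f \<Longrightarrow> submodule s M \<Longrightarrow> (\<And>i. i \<in> A \<Longrightarrow> g i \<in> M) \<Longrightarrow>
    sum g A \<in> M \<and> f (sum g A) = (\<Sum>i\<in>A. f (g i))"
  by (induction A rule: infinite_finite_induct)
    (auto simp: module_map_zero module_map_add submodule_def)

lemma module_map_minus:
  assumes "left_module s" "module_map s M t N f" "submodule s M" "x \<in> M"
  shows "f (- x) = - f x"
  using module_map_add[OF assms(2,4), of "- x"] left_module.submodule_minus[OF assms(1,3,4)]
    module_map_zero[OF assms(2,3)] by (simp add: minus_unique)

lemma module_map_diff:
  assumes "left_module s" "module_map s M t N f" "submodule s M" "x \<in> M" "y \<in> M"
  shows "f (x - y) = f x - f y"
  using module_map_add[OF assms(2,4) left_module.submodule_minus[OF assms(1,3,5)]]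
    module_map_minus[OF assms(1-3,5)] by simp

locale based_module = left_module scale
  for scale :: "('g::group_add \<Rightarrow>\<^sub>0 'r::ring_1) \<Rightarrow> 'm::ab_group_add \<Rightarrow> 'm" +
  fixes M B :: "'m set"
  assumes submod: "submodule scale M"
    and fingen: "finitely_generated scale M"
    and basis: "free_basis scale M B"
begin

definition coords :: "'m \<Rightarrow> ('m \<Rightarrow>\<^sub>0 ('g \<Rightarrow>\<^sub>0 'r))" where "coords = free_coords scale B"
definition supp :: "'m \<Rightarrow> 'g set" where "supp x = gsupp (coords x)"
definition nrm :: "'m \<Rightarrow> nat" where "nrm x = gsize (coords x)"

lemma zero_mem: "0 \<in> M" and add_mem: "x \<in> M \<Longrightarrow> y \<in> M \<Longrightarrow> x + y \<in> M"
  and scale_mem: "x \<in> M \<Longrightarrow> scale a x \<in> M"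
  using submod unfolding submodule_def by auto

lemmas minus_mem = submodule_minus[OF submod]
lemmas diff_mem = submodule_diff[OF submod]
lemmas sum_mem = submodule_sum[OF submod]

lemma basis_mem: "z \<in> B \<Longrightarrow> z \<in> M"
  using basis unfolding free_basis_def by blast

lemma unique_coords: "x \<in> M \<Longrightarrow> \<exists>!c. keys c \<subseteq> B \<and> lincomb scale c = x"
  using basis by (simp add: free_basis_def)

lemma coords:
  assumes "x \<in> M"
  shows "keys (coords x) \<subseteq> B \<and> lincomb scale (coords x) = x"
  unfolding coords_def free_coords_def by (rule theI'[OF unique_coords[OF assms]])

lemma coords_unique:
  assumes "x \<in> M" "keys c \<subseteq> B" "lincomb scale c = x"
  shows "coords x = c"
  using ex1E[OF unique_coords[OF assms(1)]] coords[OF assms(1)] assms(2,3) by metis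

lemma lincomb_mem: "keys c \<subseteq> B \<Longrightarrow> lincomb scale c \<in> M"
  unfolding lincomb_def using basis_mem scale_mem by (intro sum_mem) auto

lemma coords_lincomb: "keys c \<subseteq> B \<Longrightarrow> coords (lincomb scale c) = c"
  using coords_unique lincomb_mem by blast

lemma coords_add: "x \<in> M \<Longrightarrow> y \<in> M \<Longrightarrow> coords (x + y) = coords x + coords y"
  using coords[of x] coords[of y] keys_add[of "coords x" "coords y"] add_mem
  by (intro coords_unique) (auto simp: lincomb_add)

lemma coords_zero: "coords 0 = 0"
  by (rule coords_unique) (auto simp: zero_mem lincomb_def)

lemma coords_scale:
  assumes "x \<in> M"
  shows "coords (scale a x) = free_scale a (coords x)"
proof (rule coords_unique[OF scale_mem[OF assms]])
  show "keys (free_scale a (coords x)) \<subseteq> B"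
    using coords[OF assms] keys_free_scale[of a "coords x"] by blast
  show "lincomb scale (free_scale a (coords x)) = scale a x"
    using coords[OF assms] by (simp add: lincomb_free_scale)
qed

lemma coords_minus: "x \<in> M \<Longrightarrow> coords (- x) = - coords x"
  using coords_add[of x "- x"] minus_mem coords_zero by (simp add: minus_unique)

lemma coords_basis: "z \<in> B \<Longrightarrow> coords z = single z 1"
  by (rule coords_unique) (auto simp: basis_mem lincomb_def scale_one)

lemma supp_zero: "supp 0 = {}"
  by (simp add: supp_def coords_zero)

lemma supp_add: "x \<in> M \<Longrightarrow> y \<in> M \<Longrightarrow> supp (x + y) \<subseteq> supp x \<union> supp y"
  unfolding supp_def by (simp add: coords_add gsupp_add)

lemma supp_minus: "x \<in> M \<Longrightarrow> supp (- x) = supp x"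
  unfolding supp_def by (simp add: coords_minus)

lemma supp_diff: "x \<in> M \<Longrightarrow> y \<in> M \<Longrightarrow> supp (x - y) \<subseteq> supp x \<union> supp y"
  using supp_add[of x "- y"] minus_mem[of y] supp_minus[of y] by simp

lemma supp_scale: "x \<in> M \<Longrightarrow> supp (scale a x) \<subseteq> {g + h |g h. g \<in> keys a \<and> h \<in> supp x}"
  unfolding supp_def by (simp add: coords_scale gsupp_free_scale)

lemma finite_supp [simp]: "finite (supp x)"
  unfolding supp_def by simp

lemma card_supp_le: "card (supp x) \<le> nrm x"
  unfolding supp_def nrm_def by (rule card_gsupp_le)

lemma nrm_zero: "nrm 0 = 0"
  by (simp add: nrm_def coords_zero gsize_def)

lemma nrm_add: "x \<in> M \<Longrightarrow> y \<in> M \<Longrightarrow> nrm (x + y) \<le> nrm x + nrm y"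
  unfolding nrm_def by (simp add: coords_add gsize_add)

lemma nrm_single: "x \<in> M \<Longrightarrow> nrm (scale (single g s) x) \<le> nrm x"
  unfolding nrm_def by (simp add: coords_scale gsize_single_scale)

lemma nrm_minus: "x \<in> M \<Longrightarrow> nrm (- x) = nrm x"
  unfolding nrm_def gsize_def by (simp add: coords_minus)

lemma l1_norm_eq: "l1_norm scale B x = real (nrm x)"
  unfolding l1_norm_def nrm_def gsize_def coords_def[symmetric] Let_def discrete_norm_def
  by (simp add: in_keys_iff)

text \<open>Every basis element occurs in its own coordinates, hence in the coordinates of one of
  finitely many generators.\<close>

lemma finite_basis: "finite B"
proof -
  obtain T where T: "finite T" "T \<subseteq> M" "\<And>x. x \<in> M \<Longrightarrow> \<exists>c. keys c \<subseteq> T \<and> lincomb scale c = x"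
    using fingen[unfolded finitely_generated_def] by (elim exE conjE) blast
  have "B \<subseteq> (\<Union>t\<in>T. keys (coords t))"
  proof
    fix z assume z: "z \<in> B"
    obtain c where c: "keys c \<subseteq> T" "lincomb scale c = z" using T(3) basis_mem[OF z] by blast
    have cs: "coords (\<Sum>t\<in>A. scale (lookup c t) t) = (\<Sum>t\<in>A. free_scale (lookup c t) (coords t))
        \<and> (\<Sum>t\<in>A. scale (lookup c t) t) \<in> M" if "finite A" "A \<subseteq> T" for A
      using that
    proof (induction rule: finite_induct)
      case empty
      then show ?case by (simp add: coords_zero zero_mem)
    next
      case (insert t A)
      then have m: "scale (lookup c t) t \<in> M" "t \<in> M" "(\<Sum>t\<in>A. scale (lookup c t) t) \<in> M"
        using T(2) scale_mem by auto
      show ?case using insert coords_add[OF m(1,3)] coords_scale[OF m(2)] add_mem[OF m(1,3)] by simp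
    qed
    have "coords (lincomb scale c) = (\<Sum>t\<in>keys c. free_scale (lookup c t) (coords t))"
      unfolding lincomb_def using cs[OF finite_keys c(1)] by (rule conjunct1)
    then have "coords z = (\<Sum>t\<in>keys c. free_scale (lookup c t) (coords t))"
      unfolding c(2) .
    moreover have "z \<in> keys (coords z)" unfolding coords_basis[OF z] by simp
    ultimately have "z \<in> (\<Union>t\<in>keys c. keys (free_scale (lookup c t) (coords t)))"
      using keys_sum[of "\<lambda>t. free_scale (lookup c t) (coords t)" "keys c"] by auto
    then obtain t where "t \<in> keys c" "z \<in> keys (free_scale (lookup c t) (coords t))" by blast
    then have "t \<in> T" "z \<in> keys (coords t)"
      using c(1) keys_free_scale[of "lookup c t" "coords t"] by (auto dest: subsetD)
    then show "z \<in> (\<Union>t\<in>T. keys (coords t))" by blast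
  qed
  then show ?thesis by (rule finite_subset) (use T(1) in auto)
qed

text \<open>Cuts a chain along a subset of the group. It is applied to a set of reachable points and
  to the sublevel sets of the distance from a side.\<close>

lemma restriction:
  assumes "x \<in> M"
  shows "\<exists>y\<in>M. supp y \<subseteq> supp x \<inter> Q \<and> supp (x - y) \<subseteq> supp x - Q"
proof -
  define res where "res a = (\<Sum>g\<in>keys a \<inter> Q. single g (lookup a g))" for a :: "'g \<Rightarrow>\<^sub>0 'r"
  have res: "lookup (res a) g = (if g \<in> Q then lookup a g else 0)" for a g
    unfolding res_def by (simp add: lookup_sum lookup_single when_def in_keys_iff)
  define c where "c = (\<Sum>z\<in>keys (coords x). single z (res (lookup (coords x) z)))"
  have "lookup c z = res (lookup (coords x) z)" for z
    unfolding c_def by (auto simp: lookup_sum lookup_single when_def in_keys_iff res_def)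
  then have c: "lookup (lookup c z) g = (if g \<in> Q then lookup (lookup (coords x) z) g else 0)" for z g
    by (simp add: res)
  have "keys c \<subseteq> keys (coords x)"
  proof
    fix z assume "z \<in> keys c"
    then have "lookup c z \<noteq> 0" by (simp add: in_keys_iff)
    then obtain g where "lookup (lookup c z) g \<noteq> 0" by (metis poly_mapping_eqI lookup_zero)
    then have "lookup (lookup (coords x) z) g \<noteq> 0" using c[of z g] by (auto split: if_splits)
    then show "z \<in> keys (coords x)" by (auto simp: in_keys_iff)
  qed
  then have k: "keys c \<subseteq> B" using coords[OF assms] by blast
  have m: "lincomb scale c \<in> M" by (rule lincomb_mem[OF k])
  have "coords (x - lincomb scale c) = coords x + - c"
    using coords_add[OF assms minus_mem[OF m]] coords_minus[OF m] coords_lincomb[OF k] by simp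
  then have "supp (x - lincomb scale c) \<subseteq> supp x - Q"
    unfolding supp_def by (auto simp: gsupp_iff lookup_minus c split: if_splits)
  moreover have "supp (lincomb scale c) \<subseteq> supp x \<inter> Q"
    unfolding supp_def coords_lincomb[OF k] by (auto simp: gsupp_iff c split: if_splits)
  ultimately show ?thesis using m by blast
qed

lemma basis_expansion:
  assumes "x \<in> M"
  shows "x = (\<Sum>z\<in>B. scale (lookup (coords x) z) z)"
proof -
  have "lincomb scale (coords x) = (\<Sum>z\<in>B. scale (lookup (coords x) z) z)"
    using coords[OF assms] by (intro lincomb_superset[OF finite_basis]) simp
  then show ?thesis using coords[OF assms] by simp
qed

lemma nrm_eq: "x \<in> M \<Longrightarrow> nrm x = (\<Sum>z\<in>B. card (keys (lookup (coords x) z)))"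
  unfolding nrm_def using gsize_superset[OF finite_basis] coords by blast

text \<open>The set \<open>\<sigma> x\<close> stands for the support of the image of
  \<open>x\<close> under a module map. By equivariance it is determined by the finitely many basis
  elements, so the map moves supports by a bounded amount.\<close>

lemma bounded_support:
  assumes "\<sigma> 0 = {}" "\<And>x y. x \<in> M \<Longrightarrow> y \<in> M \<Longrightarrow> \<sigma> (x + y) \<subseteq> \<sigma> x \<union> \<sigma> y"
    and "\<And>a x. x \<in> M \<Longrightarrow> \<sigma> (scale a x) \<subseteq> {g + h |g h. g \<in> keys a \<and> h \<in> \<sigma> x}"
    and "\<And>x. finite (\<sigma> x)"
  shows "\<exists>K. finite K \<and> (\<forall>x\<in>M. \<sigma> x \<subseteq> {g + k |g k. g \<in> supp x \<and> k \<in> K})"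
proof (intro exI conjI ballI)
  show "finite (\<Union>z\<in>B. \<sigma> z)" using finite_basis assms(4) by blast
  fix x assume x: "x \<in> M"
  have sum: "\<sigma> (sum f A) \<subseteq> (\<Union>i\<in>A. \<sigma> (f i))" if "finite A" "\<And>i. i \<in> A \<Longrightarrow> f i \<in> M" for A :: "'m set" and f
    using that
  proof (induction rule: finite_induct)
    case (insert i A)
    then have "sum f A \<in> M" by (intro sum_mem) auto
    then show ?case using insert assms(2)[of "f i" "sum f A"] by auto
  qed (simp add: assms(1))
  have "\<sigma> (\<Sum>z\<in>B. scale (lookup (coords x) z) z) \<subseteq> (\<Union>z\<in>B. \<sigma> (scale (lookup (coords x) z) z))"
    by (intro sum finite_basis scale_mem basis_mem)
  then have "\<sigma> x \<subseteq> (\<Union>z\<in>B. \<sigma> (scale (lookup (coords x) z) z))"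
    unfolding basis_expansion[OF x, symmetric] .
  also have "\<dots> \<subseteq> {g + k |g k. g \<in> supp x \<and> k \<in> (\<Union>z\<in>B. \<sigma> z)}"
  proof
    fix h assume "h \<in> (\<Union>z\<in>B. \<sigma> (scale (lookup (coords x) z) z))"
    then obtain z g k where "z \<in> B" "g \<in> keys (lookup (coords x) z)" "k \<in> \<sigma> z" "h = g + k"
      using assms(3)[OF basis_mem] by blast
    moreover from this have "g \<in> supp x" unfolding supp_def gsupp_iff by (auto simp: in_keys_iff)
    ultimately show "h \<in> {g + k |g k. g \<in> supp x \<and> k \<in> (\<Union>z\<in>B. \<sigma> z)}" by blast
  qed
  finally show "\<sigma> x \<subseteq> {g + k |g k. g \<in> supp x \<and> k \<in> (\<Union>z\<in>B. \<sigma> z)}" .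
qed

end

section \<open>Chains of a resolution in low degrees\<close>

lemma trivial_scale_single: "trivial_scale (single g r) s = r * s"
  by (simp add: trivial_scale_def)

text \<open>The condition says \<open>a + k = b + k'\<close> for some \<open>k\<close>,
  \<open>k'\<close> in \<open>K\<close>: only for such points can the boundaries of chains over
  \<open>a\<close> and over \<open>b\<close> overlap.\<close>

definition hops :: "'g::group_add set \<Rightarrow> 'g set \<Rightarrow> 'g rel" where
  "hops K A = {(a, b). - a + b \<in> {k - k' |k k'. k \<in> K \<and> k' \<in> K} \<and> a \<in> A \<and> b \<in> A}"

lemma hopsE:
  assumes "(a, b) \<in> hops K A"
  obtains k k' where "k \<in> K" "k' \<in> K" "- a + b = k - k'" "a \<in> A" "b \<in> A"
  using assms unfolding hops_def by blast

locale low_resolution = left_module scale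
  for scale :: "('g::group_add \<Rightarrow>\<^sub>0 'r::ring_1) \<Rightarrow> 'm::ab_group_add \<Rightarrow> 'm" +
  fixes C0 C1 C2 B1 B2 :: "'m set" and bd1 bd2 :: "'m \<Rightarrow> 'm" and aug :: "'m \<Rightarrow> 'r"
  assumes sub0: "submodule scale C0" and proj0: "projective scale C0"
    and based1: "based_module scale C1 B1" and based2: "based_module scale C2 B2"
    and map1: "module_map scale C1 scale C0 bd1" and map2: "module_map scale C2 scale C1 bd2"
    and map_aug: "module_map scale C0 trivial_scale UNIV aug" and surj_aug: "aug ` C0 = UNIV"
    and exact0: "bd1 ` C1 = {x \<in> C0. aug x = 0}" and exact1: "bd2 ` C2 = {x \<in> C1. bd1 x = 0}"
begin

sublocale c1: based_module scale C1 B1 by (rule based1)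
sublocale c2: based_module scale C2 B2 by (rule based2)

lemma C0_scale: "x \<in> C0 \<Longrightarrow> scale a x \<in> C0"
  using sub0 unfolding submodule_def by blast

lemma C0_add: "x \<in> C0 \<Longrightarrow> y \<in> C0 \<Longrightarrow> x + y \<in> C0"
  using sub0 unfolding submodule_def by blast

lemma C0_diff: "x \<in> C0 \<Longrightarrow> y \<in> C0 \<Longrightarrow> x - y \<in> C0"
  by (rule submodule_diff[OF sub0])

lemmas bd1_add = module_map_add[OF map1] and bd1_scale = module_map_scale[OF map1]
  and bd1_mem = module_map_mem[OF map1] and bd1_zero = module_map_zero[OF map1 c1.submod]
  and bd1_minus = module_map_minus[OF left_module_axioms map1 c1.submod]
  and bd1_diff = module_map_diff[OF left_module_axioms map1 c1.submod]
  and bd2_add = module_map_add[OF map2] and bd2_scale = module_map_scale[OF map2]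
  and bd2_mem = module_map_mem[OF map2] and bd2_zero = module_map_zero[OF map2 c2.submod]
  and bd2_diff = module_map_diff[OF left_module_axioms map2 c2.submod]
  and aug_add = module_map_add[OF map_aug] and aug_scale = module_map_scale[OF map_aug]
  and aug_zero = module_map_zero[OF map_aug sub0]
  and aug_diff = module_map_diff[OF left_module_axioms map_aug sub0]

text \<open>As the module in degree 0 need not be free, the translates of one element of
  augmentation 1 take the place of the vertices of a Cayley graph.\<close>

definition vtx0 :: 'm where "vtx0 = (SOME v. v \<in> C0 \<and> aug v = 1)"
definition vtx :: "'g \<Rightarrow> 'm" where "vtx g = scale (single g 1) vtx0"

lemma vtx0: "vtx0 \<in> C0" "aug vtx0 = 1"
proof -
  have "1 \<in> aug ` C0" using surj_aug by simp
  then have "\<exists>v. v \<in> C0 \<and> aug v = 1" by force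
  from someI_ex[OF this] show "vtx0 \<in> C0" "aug vtx0 = 1" unfolding vtx0_def by auto
qed

lemma vtx_mem: "vtx g \<in> C0"
  unfolding vtx_def by (rule C0_scale[OF vtx0(1)])

lemma aug_vtx: "aug (vtx g) = 1"
  unfolding vtx_def aug_scale[OF vtx0(1)] vtx0(2) trivial_scale_single by simp

lemma scale_vtx: "scale (single g 1) (vtx h) = vtx (g + h)"
  unfolding vtx_def scale_scale mult_single by simp

lemma vtx_path_exists: "\<exists>a\<in>C1. bd1 a = vtx y - vtx x"
proof -
  have "aug (vtx y - vtx x) = 0" using aug_diff[OF vtx_mem vtx_mem] aug_vtx by simp
  then have "vtx y - vtx x \<in> bd1 ` C1" using exact0 C0_diff[OF vtx_mem vtx_mem] by simp
  then show ?thesis by force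
qed

text \<open>The value 0 at the identity makes constant paths vanish, so that collapsed pairs
  contribute nothing to the cone.\<close>

definition epath :: "'g \<Rightarrow> 'm" where
  "epath g = (if g = 0 then 0 else (SOME a. a \<in> C1 \<and> bd1 a = vtx g - vtx 0))"

lemma epath: "epath g \<in> C1" "bd1 (epath g) = vtx g - vtx 0"
proof -
  have "epath g \<in> C1 \<and> bd1 (epath g) = vtx g - vtx 0"
  proof (cases "g = 0")
    case True
    then show ?thesis by (simp add: epath_def c1.zero_mem bd1_zero)
  next
    case False
    have "\<exists>a. a \<in> C1 \<and> bd1 a = vtx g - vtx 0" using vtx_path_exists[of g 0] by blast
    from someI_ex[OF this] show ?thesis using False by (simp add: epath_def)
  qed
  then show "epath g \<in> C1" "bd1 (epath g) = vtx g - vtx 0" by auto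
qed

definition path :: "'g \<Rightarrow> 'g \<Rightarrow> 'm" where
  "path x y = scale (single x 1) (epath (- x + y))"

lemma path_mem: "path x y \<in> C1"
  unfolding path_def by (rule c1.scale_mem[OF epath(1)])

lemma bd1_path: "bd1 (path x y) = vtx y - vtx x"
proof -
  have "x + (- x + y) = y" by (rule add_minus_cancel)
  then show ?thesis
    unfolding path_def bd1_scale[OF epath(1)] epath(2) scale_diff_right scale_vtx by simp
qed

lemma path_self: "path x x = 0"
  unfolding path_def by (simp add: epath_def)

lemma scale_path: "scale (single g 1) (path x y) = path (g + x) (g + y)"
proof -
  have "- (g + x) + (g + y) = - x + y" unfolding minus_add add.assoc by (simp only: minus_add_cancel)
  then show ?thesis unfolding path_def scale_scale mult_single by simp
qed

lemma nrm_path: "c1.nrm (path x y) \<le> c1.nrm (epath (- x + y))"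
  unfolding path_def by (rule c1.nrm_single[OF epath(1)])

lemma supp_path: "c1.supp (path x y) \<subseteq> {x + h |h. h \<in> c1.supp (epath (- x + y))}"
proof -
  have "keys (single x (1::'r)) = {x}" by simp
  then show ?thesis
    using c1.supp_scale[OF epath(1), of "single x 1" "- x + y"] unfolding path_def by simp
qed

definition fills :: "'m \<Rightarrow> real \<Rightarrow> bool" where
  "fills b A \<longleftrightarrow> (\<exists>c\<in>C2. bd2 c = b \<and> real (c2.nrm c) \<le> A)"

lemma fills_mono: "fills a A \<Longrightarrow> A \<le> B \<Longrightarrow> fills a B"
  unfolding fills_def by force

lemma fills_add:
  assumes "fills a A" "fills b B"
  shows "fills (a + b) (A + B)"
proof -
  obtain x y where "x \<in> C2" "bd2 x = a" "real (c2.nrm x) \<le> A" "y \<in> C2" "bd2 y = b" "real (c2.nrm y) \<le> B"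
    using assms unfolding fills_def by blast
  then have "x + y \<in> C2 \<and> bd2 (x + y) = a + b \<and> real (c2.nrm (x + y)) \<le> A + B"
    using c2.add_mem[of x y] bd2_add[of x y] c2.nrm_add[of x y] by simp
  then show ?thesis unfolding fills_def by blast
qed

lemma fills_zero: "fills 0 0"
  unfolding fills_def using c2.zero_mem bd2_zero c2.nrm_zero by (intro bexI[of _ 0]) auto

lemma fills_sum: "(\<And>i. i \<in> I \<Longrightarrow> fills (f i) (A i)) \<Longrightarrow> fills (sum f I) (sum A I)"
  by (induction I rule: infinite_finite_induct) (auto simp: fills_zero fills_add)

lemma fills_single:
  assumes "fills a A"
  shows "fills (scale (single g s) a) A"
proof -
  obtain x where "x \<in> C2" "bd2 x = a" "real (c2.nrm x) \<le> A"
    using assms unfolding fills_def by blast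
  then have "scale (single g s) x \<in> C2 \<and> bd2 (scale (single g s) x) = scale (single g s) a \<and>
     real (c2.nrm (scale (single g s) x)) \<le> A"
    using c2.scale_mem[of x] bd2_scale[of x] c2.nrm_single[of x g s] by simp
  then show ?thesis unfolding fills_def by blast
qed

lemma fills_cycle: "a \<in> C1 \<Longrightarrow> bd1 a = 0 \<Longrightarrow> \<exists>A. fills a A"
proof -
  assume "a \<in> C1" "bd1 a = 0"
  then have "a \<in> bd2 ` C2" using exact1 by simp
  then show ?thesis unfolding fills_def by blast
qed

text \<open>
  Restricting \<open>\<theta>\<close> to the part reachable from \<open>y\<close> gives a chain whose boundary is \<open>- vtx y\<close> unless
  \<open>x\<close> is reachable too, and \<open>- vtx y\<close> is no boundary because its augmentation is not zero.
\<close>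

lemma coarsely_connected:
  "\<exists>K. finite K \<and> (\<forall>\<theta> x y. \<theta> \<in> C1 \<longrightarrow> bd1 \<theta> = vtx x - vtx y \<longrightarrow>
     (y, x) \<in> (hops K (insert x (insert y (c1.supp \<theta>))))\<^sup>*)"
proof -
  obtain X :: "'m set" and i p where i: "module_map scale C0 free_scale {c. keys c \<subseteq> X} i"
    and p: "module_map free_scale {c. keys c \<subseteq> X} scale C0 p" and pi: "\<And>x. x \<in> C0 \<Longrightarrow> p (i x) = x"
    using proj0 unfolding projective_def by blast
  have i0: "i 0 = 0" by (rule module_map_zero[OF i sub0])
  have inj: "u = 0" if "u \<in> C0" "gsupp (i u) = {}" for u
  proof -
    have "i u = 0"
    proof (rule poly_mapping_eqI)
      fix z
      show "lookup (i u) z = lookup 0 z"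
        using that(2) by (intro poly_mapping_eqI) (auto simp: set_eq_iff gsupp_iff)
    qed
    then have "i u = i 0" using i0 by simp
    then show ?thesis using pi[OF that(1)] pi[of 0] sub0 unfolding submodule_def by simp
  qed
  define \<sigma> where "\<sigma> x = (if x \<in> C1 then gsupp (i (bd1 x)) else {})" for x
  have "\<exists>K. finite K \<and> (\<forall>x\<in>C1. \<sigma> x \<subseteq> {g + k |g k. g \<in> c1.supp x \<and> k \<in> K})"
  proof (rule c1.bounded_support)
    show "\<sigma> 0 = {}" unfolding \<sigma>_def by (simp add: bd1_zero i0)
    show "\<sigma> (x + y) \<subseteq> \<sigma> x \<union> \<sigma> y" if "x \<in> C1" "y \<in> C1" for x y
      using that gsupp_add[of "i (bd1 x)" "i (bd1 y)"] module_map_add[OF i bd1_mem bd1_mem, of x y]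
      unfolding \<sigma>_def by (simp add: c1.add_mem bd1_add)
    show "\<sigma> (scale a x) \<subseteq> {g + h |g h. g \<in> keys a \<and> h \<in> \<sigma> x}" if "x \<in> C1" for a x
      using that gsupp_free_scale[of a "i (bd1 x)"] module_map_scale[OF i bd1_mem, of x a]
      unfolding \<sigma>_def by (simp add: c1.scale_mem bd1_scale)
    show "finite (\<sigma> x)" for x unfolding \<sigma>_def by simp
  qed
  then obtain K0 where K0: "finite K0" "\<And>x. x \<in> C1 \<Longrightarrow> \<sigma> x \<subseteq> {g + k |g k. g \<in> c1.supp x \<and> k \<in> K0}"
    by blast
  define K where "K = K0 \<union> gsupp (i vtx0)"
  have Kb: "gsupp (i (bd1 x)) \<subseteq> {g + k |g k. g \<in> c1.supp x \<and> k \<in> K}" if "x \<in> C1" for x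
  proof -
    have "gsupp (i (bd1 x)) \<subseteq> {g + k |g k. g \<in> c1.supp x \<and> k \<in> K0}"
      using K0(2)[OF that] that unfolding \<sigma>_def by simp
    then show ?thesis unfolding K_def by blast
  qed
  have Kv: "gsupp (i (vtx g)) \<subseteq> {g + k |k. k \<in> K}" for g
    using gsupp_free_scale[of "single g 1" "i vtx0"] module_map_scale[OF i vtx0(1), of "single g 1"]
    unfolding vtx_def K_def by (auto split: if_splits)
  have "(y, x) \<in> (hops K (insert x (insert y (c1.supp \<theta>))))\<^sup>*"
    (is "_ \<in> ?R\<^sup>*")
    if th: "\<theta> \<in> C1" "bd1 \<theta> = vtx x - vtx y" for \<theta> x y
  proof (rule ccontr)
    assume not: "(y, x) \<notin> ?R\<^sup>*"
    define U where "U = {a. (y, a) \<in> ?R\<^sup>*}"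
    have yU: "y \<in> U" and xU: "x \<notin> U" using not unfolding U_def by auto
    obtain \<eta> where \<eta>: "\<eta> \<in> C1" "c1.supp \<eta> \<subseteq> c1.supp \<theta> \<inter> U" "c1.supp (\<theta> - \<eta>) \<subseteq> c1.supp \<theta> - U"
      using c1.restriction[OF th(1), of U] by blast
    have d: "\<theta> - \<eta> \<in> C1" by (rule c1.diff_mem[OF th(1) \<eta>(1)])
    \<comment> \<open>The left side is supported near reachable points and the right side near
      unreachable ones. The \<open>K\<close>-translates of these two sets are disjoint by definition
      of \<open>hops\<close>, so both sides vanish.\<close>
    have eq: "bd1 \<eta> + vtx y = vtx x - bd1 (\<theta> - \<eta>)"
      unfolding bd1_diff[OF th(1) \<eta>(1)] th(2) by simp
    have "gsupp (i (bd1 \<eta> + vtx y)) \<subseteq> {a + k |a k. a \<in> U \<inter> insert x (insert y (c1.supp \<theta>)) \<and> k \<in> K}"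
      (is "_ \<subseteq> ?A")
    proof -
      have "i (bd1 \<eta> + vtx y) = i (bd1 \<eta>) + i (vtx y)"
        by (rule module_map_add[OF i bd1_mem[OF \<eta>(1)] vtx_mem])
      then have "gsupp (i (bd1 \<eta> + vtx y)) \<subseteq> gsupp (i (bd1 \<eta>)) \<union> gsupp (i (vtx y))"
        using gsupp_add[of "i (bd1 \<eta>)" "i (vtx y)"] by simp
      moreover have "gsupp (i (bd1 \<eta>)) \<subseteq> ?A"
        using \<eta>(2) by (intro order_trans[OF Kb[OF \<eta>(1)]] Collect_mono) blast
      moreover have "gsupp (i (vtx y)) \<subseteq> ?A"
        using yU by (intro order_trans[OF Kv[of y]] Collect_mono) blast
      ultimately show ?thesis by blast
    qed
    moreover have "gsupp (i (bd1 \<eta> + vtx y)) \<subseteq> {a + k |a k. a \<in> insert x (c1.supp \<theta>) - U \<and> k \<in> K}"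
      (is "_ \<subseteq> ?B")
    proof -
      have "i (vtx x - bd1 (\<theta> - \<eta>)) = i (vtx x) + - i (bd1 (\<theta> - \<eta>))"
        using module_map_diff[OF left_module_axioms i sub0 vtx_mem bd1_mem[OF d]] by simp
      then have "gsupp (i (bd1 \<eta> + vtx y)) \<subseteq> gsupp (i (vtx x)) \<union> gsupp (i (bd1 (\<theta> - \<eta>)))"
        using gsupp_add[of "i (vtx x)" "- i (bd1 (\<theta> - \<eta>))"] unfolding eq gsupp_minus by simp
      moreover have "gsupp (i (bd1 (\<theta> - \<eta>))) \<subseteq> ?B"
        using \<eta>(3) by (intro order_trans[OF Kb[OF d]] Collect_mono) blast
      moreover have "gsupp (i (vtx x)) \<subseteq> ?B"
        using xU by (intro order_trans[OF Kv[of x]] Collect_mono) blast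
      ultimately show ?thesis by blast
    qed
    moreover have "a + k \<noteq> b + k'" if "a \<in> U \<inter> insert x (insert y (c1.supp \<theta>))" "k \<in> K"
      "b \<in> insert x (c1.supp \<theta>) - U" "k' \<in> K" for a b k k'
    proof
      assume "a + k = b + k'"
      then have "b = a + k - k'" by (simp add: eq_diff_eq)
      then have "- a + b = k - k'" by (simp add: add_diff_eq[symmetric])
      then have "(a, b) \<in> ?R" using that unfolding hops_def by blast
      then have "b \<in> U" using that(1) unfolding U_def by (auto intro: rtrancl_into_rtrancl)
      then show False using that(3) by blast
    qed
    ultimately have "gsupp (i (bd1 \<eta> + vtx y)) = {}" by blast
    then have "bd1 \<eta> + vtx y = 0" by (rule inj[OF C0_add[OF bd1_mem[OF \<eta>(1)] vtx_mem]])
    then have "aug (bd1 \<eta>) + aug (vtx y) = 0"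
      using aug_add[OF bd1_mem[OF \<eta>(1)] vtx_mem, of y] aug_zero by simp
    moreover have "aug (bd1 \<eta>) = 0" using exact0 \<eta>(1) by blast
    ultimately show False by (simp add: aug_vtx)
  qed
  moreover have "finite K" unfolding K_def using K0(1) by simp
  ultimately show ?thesis by blast
qed

end

section \<open>Word loops as cycles of the resolution\<close>

lemma finite_nat_bound: "finite K \<Longrightarrow> \<exists>n. \<forall>k\<in>K. f k \<le> (n :: nat)"
  using finite_nat_set_iff_bounded_le[of "f ` K"] by auto

locale metric_resolution = low_resolution scale C0 C1 C2 B1 B2 bd1 bd2 aug + word_metric S
  for scale :: "('g::group_add \<Rightarrow>\<^sub>0 'r::ring_1) \<Rightarrow> 'm::ab_group_add \<Rightarrow> 'm"
    and C0 C1 C2 B1 B2 :: "'m set" and bd1 bd2 :: "'m \<Rightarrow> 'm" and aug :: "'m \<Rightarrow> 'r"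
    and S :: "'g set"

locale edge_resolution = metric_resolution scale C0 C1 C2 B1 B2 bd1 bd2 aug S
  for scale :: "('g::group_add \<Rightarrow>\<^sub>0 'r::ring_1) \<Rightarrow> 'm::ab_group_add \<Rightarrow> 'm"
    and C0 C1 C2 B1 B2 :: "'m set" and bd1 bd2 :: "'m \<Rightarrow> 'm" and aug :: "'m \<Rightarrow> 'r"
    and S :: "'g set" +
  fixes edge :: "'g \<Rightarrow> 'g \<Rightarrow> 'm" and \<rho> :: nat
  assumes edge_anti: "edge y x = - edge x y"
    and edge_mem: "edge x y \<in> C1"
    and bd1_edge: "bd1 (edge x y) = vtx y - vtx x"
    and edge_supp: "word_dist S x y \<le> 1 \<Longrightarrow> g \<in> c1.supp (edge x y) \<Longrightarrow> word_dist S x g \<le> \<rho>"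
    and edge_nrm: "word_dist S x y \<le> 1 \<Longrightarrow> c1.nrm (edge x y) \<le> \<rho>"
    and bd2_supp: "c \<in> C2 \<Longrightarrow> g \<in> c1.supp (bd2 c) \<Longrightarrow> \<exists>h\<in>c2.supp c. word_dist S h g \<le> \<rho>"
    and connected: "\<theta> \<in> C1 \<Longrightarrow> bd1 \<theta> = vtx x - vtx y \<Longrightarrow>
      (y, x) \<in> {(a, b). word_dist S a b \<le> \<rho> \<and>
        a \<in> insert x (insert y (c1.supp \<theta>)) \<and> b \<in> insert x (insert y (c1.supp \<theta>))}\<^sup>*"
    and \<rho>_pos: "1 \<le> \<rho>"
begin

sublocale edge_chains "word_dist S" edge
  by unfold_locales (rule edge_anti)

lemma pth_props:
  "pth x y n V a \<Longrightarrow> a \<in> C1 \<and> bd1 a = vtx y - vtx x \<and> (\<forall>g\<in>c1.supp a. \<exists>v\<in>V. word_dist S v g \<le> \<rho>)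
     \<and> c1.nrm a \<le> \<rho> * n"
proof (induction rule: pth.induct)
  case (pth_nil x)
  then show ?case by (simp add: c1.zero_mem bd1_zero c1.supp_zero c1.nrm_zero)
next
  case (pth_step x y z n V a)
  have m: "edge x y \<in> C1" "a \<in> C1" using edge_mem pth_step by auto
  have "\<exists>v\<in>insert x V. word_dist S v g \<le> \<rho>" if "g \<in> c1.supp (edge x y + a)" for g
  proof -
    have "g \<in> c1.supp (edge x y) \<or> g \<in> c1.supp a" using c1.supp_add[OF m] that by blast
    then show ?thesis using edge_supp[OF pth_step.hyps(1)] pth_step.IH by blast
  qed
  moreover have "c1.nrm (edge x y + a) \<le> \<rho> * Suc n"
    using c1.nrm_add[OF m] edge_nrm[OF pth_step.hyps(1)] pth_step.IH by simp
  moreover have "bd1 (edge x y + a) = vtx z - vtx x"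
    using bd1_add[OF m] bd1_edge[of x y] pth_step.IH by simp
  ultimately show ?case using c1.add_mem[OF m] by blast
qed

definition vol :: nat where "vol = card {g. word_length S g \<le> \<rho>}"

text \<open>Let \<open>e\<close> be the part of the filling \<open>c\<close> at distance less than
  \<open>t\<close> from the first side. Then \<open>bd2 e - a1\<close> has boundary
  \<open>vtx p1 - vtx p2\<close>, so it is coarsely connected between these points. It also equals
  \<open>a2 + a3 + a4 - bd2 (c - e)\<close>. Comparing both forms, its support lies near the second
  or the fourth side or near cells of \<open>c\<close> at height about \<open>t\<close>, the third
  side being too far away.\<close>

lemma slicing:
  assumes w1: "pth p1 p2 n1 V1 a1" and w2: "pth p2 p3 n2 V2 a2"
    and w3: "pth p3 p4 n3 V3 a3" and w4: "pth p4 p1 n4 V4 a4"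
    and fil: "fills (a1 + a2 + a3 + a4) (A :: real)"
  shows "\<exists>Z. (\<forall>t. finite (Z t)) \<and> (\<forall>T. real (\<Sum>t<T. card (Z t)) \<le> real (2 * \<rho> * vol + 1) * A) \<and>
        (\<forall>t. \<forall>z\<in>Z t. (\<forall>v\<in>V1. t \<le> word_dist S v z + 3 * \<rho>) \<and> (\<exists>v\<in>V1. word_dist S v z \<le> t + 3 * \<rho>)) \<and>
        (\<forall>t\<ge>1. (\<forall>v\<in>V1. \<forall>w\<in>V3. t + 3 * \<rho> < word_dist S v w) \<longrightarrow>
           (p2, p1) \<in> {(x, y). word_dist S x y \<le> 3 * \<rho> \<and>
             x \<in> {x. \<exists>v\<in>V2 \<union> V4. word_dist S v x \<le> 3 * \<rho>} \<union> Z t \<and>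
             y \<in> {x. \<exists>v\<in>V2 \<union> V4. word_dist S v x \<le> 3 * \<rho>} \<union> Z t}\<^sup>*)"
proof -
  obtain c where c: "c \<in> C2" "bd2 c = a1 + a2 + a3 + a4" "real (c2.nrm c) \<le> A"
    using fil unfolding fills_def by blast
  define h where "h g = Min ((\<lambda>v. word_dist S v g) ` V1)" for g
  have V1: "finite V1" "V1 \<noteq> {}" using pth_finite[OF w1] pth_start[OF w1] by auto
  have h_le: "h g \<le> word_dist S v g" if "v \<in> V1" for v g
    unfolding h_def using V1 that by (intro Min_le) auto
  have h_ex: "\<exists>v\<in>V1. h g = word_dist S v g" for g
  proof -
    have "h g \<in> (\<lambda>v. word_dist S v g) ` V1" unfolding h_def using V1 by (intro Min_in) auto
    then show ?thesis by blast
  qed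
  have h_lip: "h g \<le> h g' + word_dist S g' g" for g g'
  proof -
    obtain v where v: "v \<in> V1" "h g' = word_dist S v g'" using h_ex by blast
    show ?thesis using h_le[OF v(1), of g] d_tri[of v g g'] v(2) by linarith
  qed
  \<comment> \<open>A support point of the slice has height below \<open>t + \<rho>\<close> and,
    away from the sides, lies within \<open>\<rho>\<close> of a cell of height at least
    \<open>t\<close>; this gives the width \<open>2 * \<rho>\<close>. Each cell belongs to at most
    \<open>2 * \<rho>\<close> of these layers.\<close>
  define F where "F t = {g \<in> c2.supp c. t \<le> h g \<and> h g < t + 2 * \<rho>}" for t
  define Z where "Z t = (\<Union>g\<in>F t. {q. word_dist S g q \<le> \<rho>})" for t
  have finF: "finite (F t)" for t unfolding F_def by simp
  have finZ: "finite (Z t)" for t unfolding Z_def using finF word_ball_card(1) by auto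
  have cardZ: "card (Z t) \<le> vol * card (F t)" for t
  proof -
    have "card (Z t) \<le> (\<Sum>g\<in>F t. card {q. word_dist S g q \<le> \<rho>})"
      unfolding Z_def by (rule card_UN_le[OF finF])
    also have "\<dots> = vol * card (F t)" unfolding word_ball_card(2) vol_def by simp
    finally show ?thesis .
  qed
  have sumF: "(\<Sum>t<T. card (F t)) \<le> 2 * \<rho> * card (c2.supp c)" for T
  proof -
    have "card (F t) = (\<Sum>g\<in>c2.supp c. if t \<le> h g \<and> h g < t + 2 * \<rho> then 1 else 0)" for t
      unfolding F_def by (simp add: sum.If_cases Int_def)
    then have "(\<Sum>t<T. card (F t)) = (\<Sum>g\<in>c2.supp c. \<Sum>t<T. if t \<le> h g \<and> h g < t + 2 * \<rho> then 1 else 0)"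
      by (simp only: sum.swap[of _ _ "{..<T}"])
    also have "\<dots> \<le> (\<Sum>g\<in>c2.supp c. 2 * \<rho>)"
    proof (rule sum_mono)
      fix g
      have "(\<Sum>t<T. if t \<le> h g \<and> h g < t + 2 * \<rho> then 1 else 0) =
          card {t \<in> {..<T}. t \<le> h g \<and> h g < t + 2 * \<rho>}"
        by (simp add: sum.If_cases Int_def)
      also have "\<dots> \<le> card {Suc (h g) - 2 * \<rho>..<Suc (h g)}"
        by (rule card_mono) auto
      also have "\<dots> \<le> 2 * \<rho>" by simp
      finally show "(\<Sum>t<T. if t \<le> h g \<and> h g < t + 2 * \<rho> then 1 else 0) \<le> 2 * \<rho>" .
    qed
    finally show ?thesis by (simp add: mult.commute)
  qed
  have sumZ: "real (\<Sum>t<T. card (Z t)) \<le> real (2 * \<rho> * vol + 1) * A" for T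
  proof -
    have "(\<Sum>t<T. card (Z t)) \<le> (\<Sum>t<T. vol * card (F t))" using cardZ by (rule sum_mono)
    also have "\<dots> = vol * (\<Sum>t<T. card (F t))" by (simp add: sum_distrib_left)
    also have "\<dots> \<le> vol * (2 * \<rho> * card (c2.supp c))" using sumF by (rule mult_le_mono2)
    also have "\<dots> \<le> (2 * \<rho> * vol + 1) * c2.nrm c"
    proof -
      have "(2 * \<rho> * vol) * card (c2.supp c) \<le> (2 * \<rho> * vol + 1) * c2.nrm c"
        by (intro mult_le_mono c2.card_supp_le) simp
      then show ?thesis by (simp add: ac_simps)
    qed
    finally have "real (\<Sum>t<T. card (Z t)) \<le> real (2 * \<rho> * vol + 1) * real (c2.nrm c)"
      by (metis of_nat_le_iff of_nat_mult)
    also have "\<dots> \<le> real (2 * \<rho> * vol + 1) * A" using c(3) by (intro mult_left_mono) auto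
    finally show ?thesis .
  qed
  have hZ: "t \<le> h z + \<rho> \<and> h z < t + 3 * \<rho>" if z: "z \<in> Z t" for t z
  proof -
    obtain g where g: "t \<le> h g" "h g < t + 2 * \<rho>" "word_dist S g z \<le> \<rho>"
      using z unfolding Z_def F_def by blast
    then show ?thesis using h_lip[of z g] h_lip[of g z] d_sym[of g z] by linarith
  qed
  have Zh: "(\<forall>v\<in>V1. t \<le> word_dist S v z + 3 * \<rho>) \<and> (\<exists>v\<in>V1. word_dist S v z \<le> t + 3 * \<rho>)"
    if z: "z \<in> Z t" for t z
  proof
    show "\<forall>v\<in>V1. t \<le> word_dist S v z + 3 * \<rho>"
    proof
      fix v assume "v \<in> V1"
      then show "t \<le> word_dist S v z + 3 * \<rho>" using hZ[OF z] h_le[of v z] by linarith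
    qed
    obtain v where "v \<in> V1" "h z = word_dist S v z" using h_ex by blast
    then show "\<exists>v\<in>V1. word_dist S v z \<le> t + 3 * \<rho>" using hZ[OF z] by (intro bexI[of _ v]) linarith+
  qed
  note a = pth_props[OF w1] pth_props[OF w2] pth_props[OF w3] pth_props[OF w4]
  have conn: "(p2, p1) \<in> {(x, y). word_dist S x y \<le> 3 * \<rho> \<and>
             x \<in> {x. \<exists>v\<in>V2 \<union> V4. word_dist S v x \<le> 3 * \<rho>} \<union> Z t \<and>
             y \<in> {x. \<exists>v\<in>V2 \<union> V4. word_dist S v x \<le> 3 * \<rho>} \<union> Z t}\<^sup>*"
    (is "_ \<in> ?R\<^sup>*")
    if t: "1 \<le> t" "\<forall>v\<in>V1. \<forall>w\<in>V3. t + 3 * \<rho> < word_dist S v w" for t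
  proof -
    obtain e where e: "e \<in> C2" "c2.supp e \<subseteq> c2.supp c \<inter> {g. h g < t}"
      "c2.supp (c - e) \<subseteq> c2.supp c - {g. h g < t}"
      using c2.restriction[OF c(1), of "{g. h g < t}"] by blast
    define \<theta> where "\<theta> = bd2 e - a1"
    have ce: "c - e \<in> C2" by (rule c2.diff_mem[OF c(1) e(1)])
    have m: "bd2 e \<in> C1" "bd2 (c - e) \<in> C1" using bd2_mem e(1) ce by auto
    have mem: "a1 \<in> C1" "a2 \<in> C1" "a3 \<in> C1" "a4 \<in> C1" using a by blast+
    have th: "\<theta> \<in> C1" unfolding \<theta>_def by (rule c1.diff_mem[OF m(1) mem(1)])
    have th2: "\<theta> = a2 + a3 + a4 - bd2 (c - e)"
      unfolding \<theta>_def bd2_diff[OF c(1) e(1)] c(2) by (simp add: algebra_simps)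
    have "bd1 (bd2 e) = 0" using exact1 e(1) by blast
    then have bth: "bd1 \<theta> = vtx p1 - vtx p2"
      unfolding \<theta>_def bd1_diff[OF m(1) mem(1)] using a(1) by simp
    have supp: "g \<in> {x. \<exists>v\<in>V2 \<union> V4. word_dist S v x \<le> 3 * \<rho>} \<union> Z t" if g: "g \<in> c1.supp \<theta>" for g
    proof -
      have "g \<in> c1.supp (bd2 e) \<or> g \<in> c1.supp a1"
        using c1.supp_diff[OF m(1) mem(1)] g unfolding \<theta>_def by blast
      then have ht: "h g < t + \<rho>"
      proof
        assume "g \<in> c1.supp (bd2 e)"
        then obtain g' where "g' \<in> c2.supp e" "word_dist S g' g \<le> \<rho>" using bd2_supp[OF e(1)] by blast
        then show ?thesis using e(2) h_lip[of g g'] by fastforce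
      next
        assume "g \<in> c1.supp a1"
        then obtain v where "v \<in> V1" "word_dist S v g \<le> \<rho>" using a(1) by blast
        then show ?thesis using h_le[of v g] t(1) by linarith
      qed
      have "g \<in> c1.supp a2 \<or> g \<in> c1.supp a3 \<or> g \<in> c1.supp a4 \<or> g \<in> c1.supp (bd2 (c - e))"
        using c1.supp_diff[OF c1.add_mem[OF c1.add_mem[OF mem(2,3)] mem(4)] m(2)]
          c1.supp_add[OF c1.add_mem[OF mem(2,3)] mem(4)] c1.supp_add[OF mem(2,3)] g unfolding th2 by blast
      then consider v where "v \<in> V2 \<union> V4" "word_dist S v g \<le> \<rho>"
        | v where "v \<in> V3" "word_dist S v g \<le> \<rho>" | "g \<in> c1.supp (bd2 (c - e))"
        using a(2-4) by blast
      then show ?thesis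
      proof cases
        case 1
        then have "word_dist S v g \<le> 3 * \<rho>" by linarith
        then show ?thesis using 1 by blast
      next
        case (2 w)
        obtain v where v: "v \<in> V1" "h g = word_dist S v g" using h_ex by blast
        have "t + 3 * \<rho> < word_dist S v w" using t(2) v(1) 2(1) by blast
        then show ?thesis using d_tri[of v w g] d_sym[of g w] v(2) 2(2) ht by linarith
      next
        case 3
        then obtain g' where g': "g' \<in> c2.supp (c - e)" "word_dist S g' g \<le> \<rho>"
          using bd2_supp[OF ce] by blast
        then have "g' \<in> c2.supp c" "t \<le> h g'" using e(3) by auto
        moreover have "h g' < t + 2 * \<rho>" using h_lip[of g' g] d_sym[of g g'] g'(2) ht by linarith
        ultimately have "g' \<in> F t" unfolding F_def by simp
        then show ?thesis unfolding Z_def using g'(2) by blast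
      qed
    qed
    have p12: "p1 \<in> {x. \<exists>v\<in>V2 \<union> V4. word_dist S v x \<le> 3 * \<rho>}"
      "p2 \<in> {x. \<exists>v\<in>V2 \<union> V4. word_dist S v x \<le> 3 * \<rho>}"
      using pth_finish[OF w4] pth_start[OF w2] by force+
    show ?thesis
    proof (rule subsetD[OF rtrancl_mono connected[OF th bth]])
      show "{(a, b). word_dist S a b \<le> \<rho> \<and> a \<in> insert p1 (insert p2 (c1.supp \<theta>)) \<and>
          b \<in> insert p1 (insert p2 (c1.supp \<theta>))} \<subseteq> ?R"
      proof clarify
        fix x y assume xy: "word_dist S x y \<le> \<rho>" "x \<in> insert p1 (insert p2 (c1.supp \<theta>))"
          "y \<in> insert p1 (insert p2 (c1.supp \<theta>))"
        have "word_dist S x y \<le> 3 * \<rho>" using xy(1) by linarith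
        moreover have "x \<in> {x. \<exists>v\<in>V2 \<union> V4. word_dist S v x \<le> 3 * \<rho>} \<union> Z t"
          "y \<in> {x. \<exists>v\<in>V2 \<union> V4. word_dist S v x \<le> 3 * \<rho>} \<union> Z t"
          using xy(2,3) supp p12 by blast+
        ultimately show "word_dist S x y \<le> 3 * \<rho> \<and>
           x \<in> {x. \<exists>v\<in>V2 \<union> V4. word_dist S v x \<le> 3 * \<rho>} \<union> Z t \<and>
           y \<in> {x. \<exists>v\<in>V2 \<union> V4. word_dist S v x \<le> 3 * \<rho>} \<union> Z t" by blast
      qed
    qed
  qed
  show ?thesis
    using finZ sumZ Zh conn by (intro exI[of _ Z] conjI allI ballI impI) blast+
qed

sublocale area "word_dist S" edge fills "3 * \<rho>" "2 * \<rho> * vol + 1"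
proof (unfold_locales, goal_cases)
  case 1 then show ?case by (rule fills_mono)
next
  case 2 then show ?case by (rule fills_add)
next
  case 3 then show ?case using \<rho>_pos by simp
next
  case 4 then show ?case by simp
next
  case 5 then show ?case by (rule slicing)
qed

end

section \<open>Choice of generators and the contraction property of the group\<close>

lemma difference_mem: "k \<in> K \<Longrightarrow> k' \<in> K \<Longrightarrow> k - k' \<in> {k - k' |k k'. k \<in> K \<and> k' \<in> K}"
  by (intro CollectI exI[of _ k] exI[of _ k'] conjI refl)

lemma (in low_resolution) generating_set:
  "\<exists>T :: 'g set. finite T \<and> (\<forall>S. finite S \<longrightarrow> (\<forall>s\<in>S. - s \<in> S) \<longrightarrow> T \<subseteq> S \<longrightarrow> word_metric S)"
proof -
  obtain K where K1: "finite K \<and> (\<forall>\<theta> x y. \<theta> \<in> C1 \<longrightarrow> bd1 \<theta> = vtx x - vtx y \<longrightarrow>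
     (y, x) \<in> (hops K (insert x (insert y (c1.supp \<theta>))))\<^sup>*)"
    using coarsely_connected by (rule exE)
  then have K: "finite K" "\<And>\<theta> x y. \<theta> \<in> C1 \<Longrightarrow> bd1 \<theta> = vtx x - vtx y \<Longrightarrow>
     (y, x) \<in> (hops K (insert x (insert y (c1.supp \<theta>))))\<^sup>*"
    by simp_all
  let ?T = "{k - k' |k k'. k \<in> K \<and> k' \<in> K}"
  have fin: "finite ?T" by (rule finite_image_set2) (simp_all add: K(1))
  have wm: "word_metric S" if S: "finite S" "\<forall>s\<in>S. - s \<in> S" "?T \<subseteq> S" for S
  proof
    show "finite S" by (rule S(1))
    show "- s \<in> S" if "s \<in> S" for s using S(2) that by blast
    fix g :: 'g
    obtain \<theta> where \<theta>: "\<theta> \<in> C1" "bd1 \<theta> = vtx g - vtx 0" using vtx_path_exists[of g 0] by (elim bexE)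
    have word: "\<exists>xs. set xs \<subseteq> S \<and> y + sum_list xs = x" if "(y, x) \<in> {(a, b). - a + b \<in> S}\<^sup>*" for x y
      using that
    proof (induction rule: rtrancl_induct)
      case base
      show ?case by (intro exI[of _ "[]"]) simp
    next
      case (step a b)
      from step.IH obtain xs where xs: "set xs \<subseteq> S" "y + sum_list xs = a" by (elim exE conjE)
      have "y + sum_list (xs @ [z]) = (y + sum_list xs) + z" for z by (simp add: add.assoc)
      then have "y + sum_list (xs @ [- a + b]) = a + (- a + b)" unfolding xs(2) .
      also have "\<dots> = b" by (rule add_minus_cancel)
      finally have "y + sum_list (xs @ [- a + b]) = b" .
      moreover have "set (xs @ [- a + b]) \<subseteq> S" using step(2) xs(1) by simp
      ultimately show ?case by (intro exI conjI)
    qed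
    have "(0, g) \<in> {(a, b). - a + b \<in> S}\<^sup>*"
    proof (rule subsetD[OF rtrancl_mono K(2)[OF \<theta>]], rule subrelI)
      fix a b assume "(a, b) \<in> hops K (insert g (insert 0 (c1.supp \<theta>)))"
      then obtain k k' where k: "k \<in> K" "k' \<in> K" "- a + b = k - k'" by (rule hopsE)
      have "k - k' \<in> ?T" by (rule difference_mem[OF k(1,2)])
      then have "- a + b \<in> S" unfolding k(3) using S(3) by (rule rev_subsetD)
      then show "(a, b) \<in> {(a, b). - a + b \<in> S}" by (intro CollectI case_prodI)
    qed
    from word[OF this] show "\<exists>xs. set xs \<subseteq> S \<and> sum_list xs = g" unfolding add_0_left .
  qed
  show ?thesis
    by (rule exI[of _ ?T], rule conjI[OF fin], intro allI impI, rule wm)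
qed

context metric_resolution
begin

lemma edge_resolution_exists:
  "\<exists>edge \<rho>. edge_resolution scale C0 C1 C2 B1 B2 bd1 bd2 aug S edge \<rho>"
proof -
  define N where "N = {g. word_length S g \<le> 1}"
  have finN: "finite N" unfolding N_def by (rule finite_word_ball)
  obtain r1 where r1: "\<And>g h. g \<in> N \<Longrightarrow> h \<in> c1.supp (epath g) \<Longrightarrow> word_length S h \<le> r1"
  proof -
    have "finite (\<Union>g\<in>N. c1.supp (epath g))" using finN by simp
    from finite_nat_bound[OF this, of "word_length S"] obtain r1
      where r1: "\<forall>h\<in>(\<Union>g\<in>N. c1.supp (epath g)). word_length S h \<le> r1" by (rule exE)
    show thesis by (rule that, rule bspec[OF r1], rule UN_I)
  qed
  obtain r2 where r2: "\<forall>g\<in>N. c1.nrm (epath g) \<le> r2"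
    using finite_nat_bound[OF finN, of "\<lambda>g. c1.nrm (epath g)"] by (rule exE)
  have "\<exists>K. finite K \<and> (\<forall>c\<in>C2. (if c \<in> C2 then c1.supp (bd2 c) else {}) \<subseteq> {g + k |g k. g \<in> c2.supp c \<and> k \<in> K})"
  proof (rule c2.bounded_support, goal_cases)
    case 1 then show ?case by (simp add: bd2_zero c1.supp_zero)
  next
    case (2 x y)
    then show ?case using c1.supp_add[OF bd2_mem bd2_mem, of x y] by (simp add: c2.add_mem bd2_add)
  next
    case (3 a x)
    then show ?case using c1.supp_scale[OF bd2_mem, of x a] by (simp add: c2.scale_mem bd2_scale)
  next
    case (4 x) then show ?case by simp
  qed
  then obtain K2 where K2: "finite K2" "\<And>c. c \<in> C2 \<Longrightarrow> c1.supp (bd2 c) \<subseteq> {g + k |g k. g \<in> c2.supp c \<and> k \<in> K2}"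
    by auto
  obtain r3 where r3: "\<forall>k\<in>K2. word_length S k \<le> r3" using finite_nat_bound[OF K2(1), of "word_length S"] by (rule exE)
  obtain K where K1: "finite K \<and> (\<forall>\<theta> x y. \<theta> \<in> C1 \<longrightarrow> bd1 \<theta> = vtx x - vtx y \<longrightarrow>
     (y, x) \<in> (hops K (insert x (insert y (c1.supp \<theta>))))\<^sup>*)"
    using coarsely_connected by (rule exE)
  then have K: "finite K" "\<And>\<theta> x y. \<theta> \<in> C1 \<Longrightarrow> bd1 \<theta> = vtx x - vtx y \<Longrightarrow>
     (y, x) \<in> (hops K (insert x (insert y (c1.supp \<theta>))))\<^sup>*"
    by simp_all
  have "finite {k - k' |k k'. k \<in> K \<and> k' \<in> K}" by (rule finite_image_set2) (simp_all add: K(1))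
  from finite_nat_bound[OF this, of "word_length S"] obtain r4
    where r4: "\<forall>k\<in>{k - k' |k k'. k \<in> K \<and> k' \<in> K}. word_length S k \<le> r4" by (rule exE)
  define \<rho> where "\<rho> = r1 + r2 + r3 + r4 + 1"
  from well_ordering obtain ord :: "'g rel" where ord: "Well_order ord" "Field ord = UNIV"
    by (elim exE conjE)
  have "linear_order_on UNIV ord" using ord(1) unfolding ord(2) well_order_on_def by (rule conjunct1)
  then have total: "total_on UNIV ord" and asym: "antisym ord"
    unfolding linear_order_on_def partial_order_on_def by simp_all
  have tot: "x = y \<or> (x, y) \<in> ord \<or> (y, x) \<in> ord" for x y
    using total unfolding total_on_def by (cases "x = y") (simp_all del: One_nat_def)
  have anti: "x = y" if "(x, y) \<in> ord" "(y, x) \<in> ord" for x y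
    using asym that by (rule antisymD)
  \<comment> \<open>Orienting each pair by a linear order makes the edge chains antisymmetric. They are no longer
    equivariant, but below only the uniform bounds matter.\<close>
  define edge where "edge x y = (if x = y then 0 else if (x, y) \<in> ord then path x y else - path y x)" for x y
  have cases: "edge x y = path x y \<or> edge x y = - path y x" for x y
    unfolding edge_def by (simp add: path_self)
  have psupp: "word_dist S x g \<le> r1" if d: "word_dist S x y \<le> 1" and g: "g \<in> c1.supp (path x y)" for x y g
  proof -
    obtain h where h: "g = x + h" "h \<in> c1.supp (epath (- x + y))" using subsetD[OF supp_path g] by (elim CollectE exE conjE)
    have "- x + y \<in> N" using d unfolding N_def word_dist_def by simp
    from r1[OF this h(2)] show ?thesis unfolding h(1) word_dist_right .
  qed
  have pnrm: "c1.nrm (path x y) \<le> r2" if d: "word_dist S x y \<le> 1" for x y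
  proof -
    have "- x + y \<in> N" using d unfolding N_def word_dist_def by simp
    from bspec[OF r2 this] show ?thesis by (rule order_trans[OF nrm_path])
  qed
  have "edge_resolution scale C0 C1 C2 B1 B2 bd1 bd2 aug S edge \<rho>"
  proof (unfold_locales, goal_cases)
    case (1 y x)
    then show ?case using tot[of x y] anti[of x y] unfolding edge_def by auto
  next
    case (2 x y)
    show ?case using cases[of x y] path_mem[of x y] c1.minus_mem[OF path_mem[of y x]] by auto
  next
    case (3 x y)
    have "bd1 (- path y x) = vtx y - vtx x" using bd1_minus[OF path_mem[of y x]] bd1_path[of y x] by simp
    then show ?case using cases[of x y] bd1_path[of x y] by auto
  next
    case (4 x y g)
    have "g \<in> c1.supp (path x y) \<or> g \<in> c1.supp (path y x)"
      using cases[of x y] c1.supp_minus[OF path_mem[of y x]] 4(2) by auto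
    then show ?case
    proof
      assume "g \<in> c1.supp (path x y)"
      from psupp[OF 4(1) this] show ?thesis unfolding \<rho>_def by linarith
    next
      assume 2: "g \<in> c1.supp (path y x)"
      have yx: "word_dist S y x \<le> 1" using 4(1) d_sym[of x y] by simp
      show ?thesis using psupp[OF yx 2] d_tri[of x g y] 4(1) unfolding \<rho>_def by linarith
    qed
  next
    case (5 x y)
    have "word_dist S y x \<le> 1" using 5 d_sym[of x y] by simp
    then have "c1.nrm (edge x y) \<le> r2" using pnrm[OF 5] pnrm[of y x] cases[of x y] c1.nrm_minus[OF path_mem[of y x]] by auto
    then show ?case unfolding \<rho>_def by simp
  next
    case (6 c g)
    from subsetD[OF K2(2)[OF 6(1)] 6(2)] obtain h k where hk: "g = h + k" "h \<in> c2.supp c" "k \<in> K2"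
      by (elim CollectE exE conjE)
    have "word_dist S h g \<le> \<rho>"
      unfolding hk(1) word_dist_right using bspec[OF r3 hk(3)] unfolding \<rho>_def by linarith
    then show ?case using hk(2) by (rule bexI)
  next
    case (7 \<theta> x y)
    show ?case
    proof (rule subsetD[OF rtrancl_mono K(2)[OF 7]], rule subrelI)
      fix a b assume "(a, b) \<in> hops K (insert x (insert y (c1.supp \<theta>)))"
      then obtain k k' where ab: "k \<in> K" "k' \<in> K" "- a + b = k - k'"
        "a \<in> insert x (insert y (c1.supp \<theta>))" "b \<in> insert x (insert y (c1.supp \<theta>))" by (rule hopsE)
      have "word_dist S a b \<le> r4" unfolding word_dist_def ab(3) by (rule bspec[OF r4 difference_mem[OF ab(1,2)]])
      then have "word_dist S a b \<le> \<rho>" unfolding \<rho>_def by simp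
      then show "(a, b) \<in> {(a, b). word_dist S a b \<le> \<rho> \<and>
        a \<in> insert x (insert y (c1.supp \<theta>)) \<and> b \<in> insert x (insert y (c1.supp \<theta>))}"
        using ab(4,5) by simp
    qed
  next
    case 8 then show ?case unfolding \<rho>_def by simp
  qed
  then show ?thesis by (intro exI)
qed

text \<open>Turns bounds for cycles into a property of the word metric alone: a loop of length
  \<open>n\<close> is a cycle of norm at most \<open>\<rho> * n\<close>, so the bounds for cycles
  carry over to loops with other constants.\<close>

lemma contracting_of_fills:
  fixes K :: real
  assumes quad: "\<And>b. b \<in> C1 \<Longrightarrow> bd1 b = 0 \<Longrightarrow> fills b (K * (real (c1.nrm b))\<^sup>2 + K)" and K: "K > 0"
    and sub: "\<And>\<epsilon> N. \<epsilon> > 0 \<Longrightarrow> \<exists>l\<ge>N. \<forall>b\<in>C1. bd1 b = 0 \<longrightarrow> c1.nrm b \<le> l \<longrightarrow> fills b (\<epsilon> * (real l)\<^sup>2)"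
  shows "\<exists>pr D W. contracting p pr D W"
proof -
  obtain edge \<rho> where "edge_resolution scale C0 C1 C2 B1 B2 bd1 bd2 aug S edge \<rho>"
    using edge_resolution_exists by blast
  then interpret er: edge_resolution scale C0 C1 C2 B1 B2 bd1 bd2 aug S edge \<rho> .
  have loop: "a \<in> C1" "bd1 a = 0" "c1.nrm a \<le> \<rho> * n" if "er.pth x x n V a" for x n V a
    using er.pth_props[OF that] by auto
  have q: "fills a (K * \<rho>\<^sup>2 * (real n)\<^sup>2 + K * \<rho>\<^sup>2)" if p: "er.pth x x n V a" for n x V a
  proof (rule fills_mono[OF quad[OF loop(1,2)[OF p]]])
    have "real (c1.nrm a) \<le> real \<rho> * real n" using loop(3)[OF p] by (metis of_nat_le_iff of_nat_mult)
    then have "(real (c1.nrm a))\<^sup>2 \<le> (real \<rho> * real n)\<^sup>2" by (intro power_mono) auto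
    then have "K * (real (c1.nrm a))\<^sup>2 \<le> K * (real \<rho> * real n)\<^sup>2" using K by (intro mult_left_mono) auto
    moreover have "K * 1 \<le> K * (real \<rho>)\<^sup>2" using K er.\<rho>_pos by (intro mult_left_mono) auto
    ultimately show "K * (real (c1.nrm a))\<^sup>2 + K \<le> K * \<rho>\<^sup>2 * (real n)\<^sup>2 + K * \<rho>\<^sup>2"
      by (simp add: power_mult_distrib)
  qed
  have s: "\<exists>L\<ge>N. er.loops_fill L (\<epsilon> * (real L)\<^sup>2)" if e: "\<epsilon> > 0" for \<epsilon> N
  proof -
    have rp: "real \<rho> \<ge> 1" using er.\<rho>_pos by simp
    \<comment> \<open>Dividing the scale \<open>l\<close> by \<open>\<rho>\<close> and rounding down
      loses at most a factor 2, so \<open>l \<le> 2 * \<rho> * L\<close>; its square is the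
      denominator.\<close>
    define \<epsilon>' where "\<epsilon>' = \<epsilon> / (4 * \<rho>\<^sup>2)"
    have e': "\<epsilon>' > 0" unfolding \<epsilon>'_def using e rp by simp
    obtain l where l: "l \<ge> \<rho> * (N + 1)" "\<And>b. b \<in> C1 \<Longrightarrow> bd1 b = 0 \<Longrightarrow> c1.nrm b \<le> l \<Longrightarrow> fills b (\<epsilon>' * (real l)\<^sup>2)"
      using sub[OF e', of "\<rho> * (N + 1)"] by blast
    define L where "L = l div \<rho>"
    have L: "N + 1 \<le> L" "\<rho> * L \<le> l" "l \<le> \<rho> * L + \<rho>"
    proof -
      have "\<rho> * (N + 1) div \<rho> \<le> l div \<rho>" by (rule div_le_mono[OF l(1)])
      then show "N + 1 \<le> L" unfolding L_def using er.\<rho>_pos by simp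
      show "\<rho> * L \<le> l" unfolding L_def by simp
      show "l \<le> \<rho> * L + \<rho>" unfolding L_def
        using er.\<rho>_pos dividend_less_times_div[of \<rho> l] by simp
    qed
    have "\<rho> \<le> \<rho> * L" using L(1) by simp
    then have "l \<le> 2 * (\<rho> * L)" using L(3) by linarith
    then have "real l \<le> 2 * \<rho> * L" by (metis mult.assoc of_nat_le_iff of_nat_mult of_nat_numeral)
    then have "(real l)\<^sup>2 \<le> (2 * real \<rho> * real L)\<^sup>2" by (intro power_mono) auto
    then have "\<epsilon>' * (real l)\<^sup>2 \<le> \<epsilon>' * (2 * real \<rho> * real L)\<^sup>2" using e' by (intro mult_left_mono) auto
    also have "\<dots> = \<epsilon> * (real L)\<^sup>2" unfolding \<epsilon>'_def using rp by (simp add: power_mult_distrib)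
    finally have le: "\<epsilon>' * (real l)\<^sup>2 \<le> \<epsilon> * (real L)\<^sup>2" .
    have "fills a (\<epsilon> * (real L)\<^sup>2)" if n: "n \<le> L" and p: "er.pth x x n V a" for n x V a
    proof -
      have "\<rho> * n \<le> \<rho> * L" using n by simp
      then have "c1.nrm a \<le> l" using loop(3)[OF p] L(2) by linarith
      then show ?thesis using l(2)[OF loop(1,2)[OF p]] le fills_mono by blast
    qed
    then have "er.loops_fill L (\<epsilon> * (real L)\<^sup>2)" unfolding er.loops_fill_def by blast
    then show ?thesis using L(1) by (intro exI[of _ L]) simp
  qed
  have "\<exists>C\<ge>0. \<forall>n x V a. er.pth x x n V a \<longrightarrow> fills a (C * (real n + 1))"
    by (rule er.linear_area[of "K * \<rho>\<^sup>2"]) (use q s K er.\<rho>_pos in auto)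
  then obtain C where C: "C \<ge> 0" "\<And>n x V a. er.pth x x n V a \<Longrightarrow> fills a (C * (real n + 1))" by blast
  show ?thesis by (rule er.contraction[of C]) (use C in auto)
qed

end

section \<open>Filling cycles by a contracting cone\<close>

lemma card_filter_split:
  assumes "finite A"
  shows "card A = card {x \<in> A. P x} + card {x \<in> A. \<not> P x}"
proof -
  have "A = {x \<in> A. P x} \<union> {x \<in> A. \<not> P x}" by blast
  then have "card A = card ({x \<in> A. P x} \<union> {x \<in> A. \<not> P x})" by (rule arg_cong)
  also have "\<dots> = card {x \<in> A. P x} + card {x \<in> A. \<not> P x}"
    using assms by (intro card_Un_disjoint) auto
  finally show ?thesis .
qed

context graph_metric
begin

text \<open>Greedy choice: the heaviest point dominates the weight of its
  \<open>R\<close>-neighbourhood up to the factor \<open>N\<close>; discard this neighbourhood and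
  continue.\<close>

lemma separated_subset:
  fixes w :: "'v \<Rightarrow> nat"
  assumes "finite V" and N: "\<And>x. card {y \<in> V. d x y \<le> R} \<le> N"
  shows "\<exists>U\<subseteq>V. (\<forall>x\<in>U. \<forall>y\<in>U. d x y \<le> R \<longrightarrow> x = y) \<and> sum w V \<le> N * sum w U"
  using assms
proof (induction "card V" arbitrary: V rule: less_induct)
  case less
  show ?case
  proof (cases "V = {}")
    case True
    then show ?thesis by simp
  next
    case False
    have "Max (w ` V) \<in> w ` V" using less.prems(1) False by (intro Max_in) auto
    then obtain x where x: "x \<in> V" "w x = Max (w ` V)" by auto
    have wx: "w y \<le> w x" if "y \<in> V" for y
      unfolding x(2) using less.prems(1) that by (intro Max_ge) auto
    let ?near = "{y \<in> V. d x y \<le> R}"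
    let ?V = "V - ?near"
    have "x \<in> ?near" using x(1) by simp
    then have "?V \<subset> V" by blast
    then have lt: "card ?V < card V" by (rule psubset_card_mono[OF less.prems(1)])
    have "card {y \<in> ?V. d z y \<le> R} \<le> N" for z
      using less.prems(1) by (intro order_trans[OF card_mono less.prems(2)[of z]]) auto
    then obtain U where U: "U \<subseteq> ?V" "\<forall>a\<in>U. \<forall>b\<in>U. d a b \<le> R \<longrightarrow> a = b" "sum w ?V \<le> N * sum w U"
      using less.hyps[OF lt] less.prems(1) by auto
    have "sum w V = sum w ?V + sum w ?near"
      using less.prems(1) by (intro sum.subset_diff) auto
    also have "sum w ?near \<le> (\<Sum>y\<in>?near. w x)" using wx by (intro sum_mono) auto
    also have "\<dots> \<le> N * w x" using less.prems(2)[of x] by simp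
    finally have "sum w V \<le> N * (w x + sum w U)" using U(3) by (simp add: algebra_simps)
    moreover have "finite U" "x \<notin> U" using U(1) less.prems(1) \<open>x \<in> ?near\<close> finite_subset by auto
    ultimately have "sum w V \<le> N * sum w (insert x U)" by simp
    moreover have "\<forall>a\<in>insert x U. \<forall>b\<in>insert x U. d a b \<le> R \<longrightarrow> a = b"
    proof -
      have far: "\<not> d x b \<le> R" if "b \<in> U" for b using U(1) that by auto
      then have "\<not> d b x \<le> R" if "b \<in> U" for b using that d_sym[of b x] by simp
      then show ?thesis using far U(2) by auto
    qed
    moreover have "insert x U \<subseteq> V" using U(1) x(1) by auto
    ultimately show ?thesis by (intro exI[of _ "insert x U"] conjI)
  qed
qed

text \<open>
  A derandomised collapse: the points of a separated subset of \<open>u ` J\<close> of large weight absorb their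
  \<open>D\<close>-neighbourhoods, which identifies the ends of a fixed proportion of the pairs.
\<close>

lemma collapse:
  fixes u v :: "'i \<Rightarrow> 'v"
  assumes "finite J" and N: "\<And>x. finite {y. d x y \<le> 2 * D}" "\<And>x. card {y. d x y \<le> 2 * D} \<le> N"
    and uv: "\<And>j. j \<in> J \<Longrightarrow> d (u j) (v j) \<le> D" and s: "\<And>j. j \<in> J \<Longrightarrow> d p (u j) = s"
  shows "\<exists>r. (\<forall>z. d p z = s \<longrightarrow> d p (r z) = s) \<and> (\<forall>z. d z (r z) \<le> D) \<and>
     card J \<le> N * card {j \<in> J. r (u j) = r (v j)}"
proof -
  define w where "w x = card {j \<in> J. u j = x}" for x
  have "card {y \<in> u ` J. d x y \<le> 2 * D} \<le> N" for x
    by (rule order_trans[OF card_mono[OF N(1)[of x]] N(2)[of x]]) auto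
  then obtain U where U: "U \<subseteq> u ` J" "\<And>x y. x \<in> U \<Longrightarrow> y \<in> U \<Longrightarrow> d x y \<le> 2 * D \<Longrightarrow> x = y"
    "sum w (u ` J) \<le> N * sum w U"
    using separated_subset[of "u ` J" "2 * D" N w] assms(1) by auto
  define r where "r z = (if \<exists>x\<in>U. d x z \<le> D then (SOME x. x \<in> U \<and> d x z \<le> D) else z)" for z
  have r: "r z \<in> U \<and> d (r z) z \<le> D" if "x \<in> U" "d x z \<le> D" for x z
  proof -
    have "\<exists>x. x \<in> U \<and> d x z \<le> D" using that by blast
    from someI_ex[OF this] show ?thesis unfolding r_def using that by auto
  qed
  \<comment> \<open>Points of \<open>U\<close> are more than \<open>2 * D\<close> apart, so their
    \<open>D\<close>-neighbourhoods are disjoint and the choice in \<open>r\<close> is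
    forced.\<close>
  have r_eq: "r z = x" if "x \<in> U" "d x z \<le> D" for x z
    using r[OF that] that d_tri[of "r z" x z] d_sym[of z x] by (intro U(2)) auto
  have rest: "r z = z" if "\<not> (\<exists>x\<in>U. d x z \<le> D)" for z unfolding r_def using that by simp
  have 1: "d p (r z) = s" if "d p z = s" for z
  proof (cases "\<exists>x\<in>U. d x z \<le> D")
    case True
    then obtain x where "x \<in> U" "d x z \<le> D" by blast
    then have "r z \<in> u ` J" using r U(1) by blast
    then show ?thesis using s by auto
  qed (simp add: rest that)
  have 2: "d z (r z) \<le> D" for z
  proof (cases "\<exists>x\<in>U. d x z \<le> D")
    case True
    then obtain x where "x \<in> U" "d x z \<le> D" by blast
    then show ?thesis using r[of x z] d_sym[of z "r z"] by simp
  qed (simp add: rest)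
  have card_fibres: "sum w A = card {j \<in> J. u j \<in> A}" if "A \<subseteq> u ` J" for A
  proof -
    have "card (\<Union>x\<in>A. {j \<in> J. u j = x}) = (\<Sum>x\<in>A. card {j \<in> J. u j = x})"
      using finite_subset[OF that finite_imageI[OF assms(1)]] assms(1) by (intro card_UN_disjoint) auto
    moreover have "(\<Union>x\<in>A. {j \<in> J. u j = x}) = {j \<in> J. u j \<in> A}" by auto
    ultimately show ?thesis unfolding w_def by simp
  qed
  have "{j \<in> J. u j \<in> U} \<subseteq> {j \<in> J. r (u j) = r (v j)}"
    using r_eq uv by auto
  then have "card {j \<in> J. u j \<in> U} \<le> card {j \<in> J. r (u j) = r (v j)}"
    using assms(1) by (intro card_mono) auto
  then have "N * sum w U \<le> N * card {j \<in> J. r (u j) = r (v j)}"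
    unfolding card_fibres[OF U(1)] by (rule mult_le_mono2)
  moreover have "sum w (u ` J) = card J"
    unfolding card_fibres[OF subset_refl] by (rule arg_cong[of _ _ card]) auto
  ultimately have "card J \<le> N * card {j \<in> J. r (u j) = r (v j)}" using U(3) by linarith
  then show ?thesis using 1 2 by (intro exI[of _ r]) simp
qed

end

section \<open>Quadrilaterals of paths and the cone\<close>

context low_resolution
begin

lemma fills_finite:
  assumes "finite Q" "\<And>b. b \<in> Q \<Longrightarrow> b \<in> C1 \<and> bd1 b = 0"
  shows "\<exists>A\<ge>0. \<forall>b\<in>Q. fills b A"
  using assms
proof (induction rule: finite_induct)
  case empty
  then show ?case by (intro exI[of _ 0]) simp
next
  case (insert b Q)
  then obtain A where A: "A \<ge> 0" "\<And>b. b \<in> Q \<Longrightarrow> fills b A" by auto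
  have "b \<in> C1" "bd1 b = 0" using insert.prems[of b] by simp_all
  from fills_cycle[OF this] obtain B where B: "fills b B" by (rule exE)
  have "fills b' (max A B)" if "b' \<in> insert b Q" for b'
  proof (cases "b' = b")
    case True
    then show ?thesis using B fills_mono[of b B "max A B"] by simp
  next
    case False
    then show ?thesis using that A(2)[of b'] fills_mono[of b' A "max A B"] by simp
  qed
  then show ?case using A(1) by (intro exI[of _ "max A B"]) simp
qed

definition quad :: "'g \<Rightarrow> 'g \<Rightarrow> 'g \<Rightarrow> 'g \<Rightarrow> 'm" where
  "quad x y x' y' = path x y + path y y' - path x' y' - path x x'"

lemma quad_cycle: "quad x y x' y' \<in> C1 \<and> bd1 (quad x y x' y') = 0"
proof -
  have 1: "path x y + path y y' \<in> C1" by (rule c1.add_mem[OF path_mem path_mem])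
  have 2: "path x y + path y y' - path x' y' \<in> C1" by (rule c1.diff_mem[OF 1 path_mem])
  show ?thesis
    unfolding quad_def bd1_diff[OF 2 path_mem] bd1_diff[OF 1 path_mem] bd1_add[OF path_mem path_mem] bd1_path
    using c1.diff_mem[OF 2 path_mem] by simp
qed

lemma scale_quad: "scale (single g 1) (quad x y x' y') = quad (g + x) (g + y) (g + x') (g + y')"
  unfolding quad_def scale_diff_right scale_right_distrib scale_path ..

end

context metric_resolution
begin

text \<open>By equivariance of \<open>path\<close> the first corner can be moved to 0. Finitely many
  quadrilaterals remain, and each is a cycle, hence has a filling.\<close>

lemma quad_fills: "\<exists>A\<ge>0. \<forall>x y x' y'. word_dist S x y \<le> m \<longrightarrow> word_dist S x x' \<le> m \<longrightarrow>
    word_dist S y y' \<le> m \<longrightarrow> fills (quad x y x' y') A"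
proof -
  let ?N = "{g. word_length S g \<le> 2 * m}"
  have "finite ((\<lambda>(a, b, c). quad 0 a b c) ` (?N \<times> ?N \<times> ?N))"
    using finite_word_ball by (intro finite_imageI finite_cartesian_product)
  moreover have "b \<in> C1 \<and> bd1 b = 0" if "b \<in> (\<lambda>(a, b, c). quad 0 a b c) ` (?N \<times> ?N \<times> ?N)" for b
    using that quad_cycle by auto
  ultimately obtain A where A: "A \<ge> 0" "\<And>b. b \<in> (\<lambda>(a, b, c). quad 0 a b c) ` (?N \<times> ?N \<times> ?N) \<Longrightarrow> fills b A"
    using fills_finite by (metis (no_types, lifting))
  have "fills (quad x y x' y') A"
    if "word_dist S x y \<le> m" "word_dist S x x' \<le> m" "word_dist S y y' \<le> m" for x y x' y'
  proof -
    have "word_dist S x y' \<le> 2 * m" using d_tri[of x y' y] that by linarith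
    then have "(- x + y, - x + x', - x + y') \<in> ?N \<times> ?N \<times> ?N"
      using that unfolding word_dist_def by simp
    from imageI[OF this, of "\<lambda>(a, b, c). quad 0 a b c"]
    have "quad 0 (- x + y) (- x + x') (- x + y') \<in> (\<lambda>(a, b, c). quad 0 a b c) ` (?N \<times> ?N \<times> ?N)"
      by simp
    from fills_single[OF A(2)[OF this], of x 1] show ?thesis
      unfolding scale_quad by (simp only: add_minus_cancel add_0_right)
  qed
  then show ?thesis using A(1) by blast
qed


text \<open>
  Pushing every point to \<open>p\<close> fills the cycle by quadrilaterals of bounded size. At each level a fixed
  proportion of the remaining pairs collapses, so that a pair is pushed a bounded number of
  times on average; this is why the bound has no logarithmic factor.
\<close>

lemma cone_fills:
  assumes con: "contracting p pr D W"
  shows "\<exists>K\<ge>0. \<forall>(I :: 'i set) (c :: 'i \<Rightarrow> 'r) x y. finite I \<longrightarrow> (\<forall>i\<in>I. word_dist S (x i) (y i) \<le> 1) \<longrightarrow>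
     (\<forall>q :: 'g \<Rightarrow> 'm. (\<Sum>i\<in>I. scale (single 0 (c i)) (q (y i))) = (\<Sum>i\<in>I. scale (single 0 (c i)) (q (x i)))) \<longrightarrow>
     fills (\<Sum>i\<in>I. scale (single 0 (c i)) (path (x i) (y i))) (K * real (card I))"
proof -
  define h where "h = word_dist S p"
  \<comment> \<open>Levels are \<open>W + 1\<close> apart. The extra step keeps them distinct for
    \<open>W = 0\<close> too, so that a pair, whose heights differ by at most 1, straddles at most
    one level.\<close>
  define W' where "W' = Suc W"
  have pr: "h (pr s z) = min s (h z)" "word_dist S (pr s z) z \<le> h z - s" for s z
    using con unfolding contracting_def h_def by simp_all
  have near: "word_dist S (pr s a) (pr s b) \<le> D" if "word_dist S a b \<le> 1" "s \<le> h a" "s \<le> h b" for s a b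
    using con that unfolding contracting_def h_def by simp
  have far: "word_dist S (pr s a) (pr s b) \<le> D"
    if "h a = h b" "word_dist S a b \<le> 3 * D + 2" "s + W' \<le> h a" for s a b
    using con that unfolding contracting_def h_def W'_def by simp
  have h_adj: "h a \<le> h b + 1" if "word_dist S a b \<le> 1" for a b
    using d_tri[of p a b] d_sym[of a b] that unfolding h_def by linarith
  define N where "N = card {g. word_length S g \<le> 2 * D}"
  obtain A where A: "A \<ge> 0" "\<And>a b a' b'. word_dist S a b \<le> 3 * D + 2 + W' \<Longrightarrow>
      word_dist S a a' \<le> 3 * D + 2 + W' \<Longrightarrow> word_dist S b b' \<le> 3 * D + 2 + W' \<Longrightarrow> fills (quad a b a' b') A"
    using quad_fills[of "3 * D + 2 + W'"] by (elim exE conjE) simp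
  have main: "fills (\<Sum>i\<in>I. scale (single 0 (c i)) (path (x i) (y i))) (A * (N + 1) * real (card I))"
    if I: "finite I" and adj: "\<forall>i\<in>I. word_dist S (x i) (y i) \<le> 1"
      and cyc: "\<forall>q :: 'g \<Rightarrow> 'm. (\<Sum>i\<in>I. scale (single 0 (c i)) (q (y i))) = (\<Sum>i\<in>I. scale (single 0 (c i)) (q (x i)))"
    for I :: "'i set" and c :: "'i \<Rightarrow> 'r" and x y
  proof -
    define lo hi where "lo i = min (h (x i)) (h (y i))" and "hi i = max (h (x i)) (h (y i))" for i
    have hilo: "hi i \<le> lo i + 1" if "i \<in> I" for i
      using h_adj[of "x i" "y i"] h_adj[of "y i" "x i"] adj that d_sym[of "x i" "y i"]
      unfolding lo_def hi_def by auto
    define chain where "chain F = (\<Sum>i\<in>I. scale (single 0 (c i)) (path (F (x i)) (F (y i))))" for F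
    \<comment> \<open>\<open>F\<close> pushes all points above level \<open>n\<close> down to that level. The number \<open>T\<close> of quadrilaterals
      used so far is paid for by the pairs that are already collapsed and by the pairs that
      have crossed a level.\<close>
    define good where "good n F \<longleftrightarrow> (\<forall>z. h z \<le> n * W' \<longrightarrow> F z = z) \<and> (\<forall>z. n * W' < h z \<longrightarrow> h (F z) = n * W') \<and>
        (\<forall>i\<in>I. word_dist S (F (x i)) (F (y i)) \<le> 3 * D + 2) \<and>
        (\<exists>T. fills (chain id - chain F) (A * real T) \<and>
          T + N * card {i \<in> I. n * W' < lo i \<and> F (x i) \<noteq> F (y i)} \<le>
            N * card {i \<in> I. n * W' < lo i} + card {i \<in> I. n * W' < hi i})" for n F
    have step: "\<exists>F. good n F" if "good (Suc n) F'" for n F'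
    proof -
      define s where "s = n * W'"
      have s': "Suc n * W' = s + W'" unfolding s_def by simp
      have W1: "1 \<le> W'" unfolding W'_def by simp
      from that[unfolded good_def s'] obtain T' where
        F1: "\<And>z. h z \<le> s + W' \<Longrightarrow> F' z = z" and F2: "\<And>z. s + W' < h z \<Longrightarrow> h (F' z) = s + W'"
        and F3: "\<And>i. i \<in> I \<Longrightarrow> word_dist S (F' (x i)) (F' (y i)) \<le> 3 * D + 2"
        and T': "fills (chain id - chain F') (A * real T')"
          "T' + N * card {i \<in> I. s + W' < lo i \<and> F' (x i) \<noteq> F' (y i)} \<le>
            N * card {i \<in> I. s + W' < lo i} + card {i \<in> I. s + W' < hi i}"
        by (elim exE conjE) simp
      have Fh: "h (F' z) = min (s + W') (h z)" for z
        using F1[of z] F2[of z] by (cases "h z \<le> s + W'") auto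
      define G where "G z = pr s (F' z)" for z
      have Gh: "h (G z) = s" if "s < h z" for z
        unfolding G_def pr(1) Fh using that by simp
      have GD: "word_dist S (G (x i)) (G (y i)) \<le> D" if i: "i \<in> I" "s < lo i" for i
      proof (cases "hi i \<le> s + W'")
        case True
        then have "F' (x i) = x i" "F' (y i) = y i" unfolding hi_def by (auto intro: F1)
        then show ?thesis unfolding G_def using near adj i unfolding lo_def by auto
      next
        case False
        then have "s + W' \<le> lo i" using hilo[OF i(1)] by linarith
        then have "h (F' (x i)) = s + W'" "h (F' (y i)) = s + W'" unfolding Fh lo_def by auto
        then show ?thesis unfolding G_def using F3[OF i(1)] by (intro far) auto
      qed
      define J where "J = {i \<in> I. s < lo i \<and> F' (x i) \<noteq> F' (y i)}"
      have finJ: "finite J" unfolding J_def using I by simp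
      have "\<exists>r. (\<forall>z. h z = s \<longrightarrow> h (r z) = s) \<and> (\<forall>z. word_dist S z (r z) \<le> D) \<and>
          card J \<le> N * card {j \<in> J. r (G (x j)) = r (G (y j))}"
        unfolding h_def
      proof (rule collapse[OF finJ])
        show "finite {y. word_dist S x y \<le> 2 * D}" "card {y. word_dist S x y \<le> 2 * D} \<le> N" for x
          unfolding N_def using word_ball_card[of x "2 * D"] by simp_all
        show "word_dist S (G (x j)) (G (y j)) \<le> D" if "j \<in> J" for j
          using GD that unfolding J_def by simp
        show "word_dist S p (G (x j)) = s" if "j \<in> J" for j
          using Gh[of "x j"] that unfolding J_def lo_def h_def by simp
      qed
      then obtain r where r': "\<forall>z. h z = s \<longrightarrow> h (r z) = s" "\<forall>z. word_dist S z (r z) \<le> D"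
        "card J \<le> N * card {j \<in> J. r (G (x j)) = r (G (y j))}" by (elim exE conjE)
      have r: "\<And>z. h z = s \<Longrightarrow> h (r z) = s" "\<And>z. word_dist S z (r z) \<le> D"
        "card J \<le> N * card {j \<in> J. r (G (x j)) = r (G (y j))}" using r' by simp_all
      define F where "F z = (if h z \<le> s then z else r (G z))" for z
      have Fs: "F z = z" if "h z \<le> s" for z unfolding F_def using that by simp
      have Fb: "F z = r (G z)" if "s < h z" for z unfolding F_def using that by simp
      have move: "word_dist S (F' z) (F z) \<le> 3 * D + 2 + W'" for z
      proof (cases "h z \<le> s")
        case True
        then show ?thesis using Fs F1 by simp
      next
        case False
        have "word_dist S (pr s (F' z)) (F' z) \<le> W'" using pr(2)[of s "F' z"] Fh[of z] by linarith
        then show ?thesis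
          using d_tri[of "F' z" "r (G z)" "G z"] r(2)[of "G z"] Fb[of z] False d_sym[of "G z" "F' z"]
          unfolding G_def by simp
      qed
      \<comment> \<open>If both ends are pushed, the distance \<open>D\<close> after the descent
        grows by \<open>2 * D\<close> under \<open>r\<close>. If only one is, it starts at level
        \<open>s + 1\<close>: one step down, a move by \<open>D\<close> and the edge itself give
        \<open>D + 2\<close>. So \<open>3 * D + 2\<close> is stable.\<close>
      have FD: "word_dist S (F (x i)) (F (y i)) \<le> 3 * D + 2" if i: "i \<in> I" for i
      proof -
        have mixed: "word_dist S (F a) (F b) \<le> 3 * D + 2"
          if ab: "word_dist S a b \<le> 1" "s < h a" "h b \<le> s" for a b
        proof -
          have "h a = s + 1" using ab h_adj[OF ab(1)] by linarith
          then have "F' a = a" using W1 by (intro F1) simp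
          then have "word_dist S (G a) a \<le> 1" using pr(2)[of s a] \<open>h a = s + 1\<close> unfolding G_def by simp
          then have "word_dist S (r (G a)) b \<le> D + 2"
            using d_tri[of "r (G a)" b "G a"] d_tri[of "G a" b a] r(2)[of "G a"] ab(1) d_sym[of "G a" "r (G a)"]
            by linarith
          then show ?thesis using Fb[OF ab(2)] Fs[OF ab(3)] by simp
        qed
        have a: "word_dist S (x i) (y i) \<le> 1" "word_dist S (y i) (x i) \<le> 1"
          using adj i d_sym[of "x i" "y i"] by auto
        consider "s < h (x i)" "s < h (y i)" | "s < h (x i)" "h (y i) \<le> s" | "h (x i) \<le> s" "s < h (y i)"
          | "h (x i) \<le> s" "h (y i) \<le> s" by linarith
        then show ?thesis
        proof cases
          case 1
          have "word_dist S (G (x i)) (G (y i)) \<le> D" using GD[OF i] 1 unfolding lo_def by simp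
          then show ?thesis
            using Fb 1 r(2)[of "G (x i)"] r(2)[of "G (y i)"] d_sym[of "G (x i)" "r (G (x i))"]
              d_tri[of "r (G (x i))" "r (G (y i))" "G (x i)"] d_tri[of "G (x i)" "r (G (y i))" "G (y i)"]
            by simp
        next
          case 2 then show ?thesis using mixed[OF a(1)] by simp
        next
          case 3 then show ?thesis using mixed[OF a(2)] d_sym[of "F (x i)" "F (y i)"] by simp
        next
          case 4 then show ?thesis using Fs a by simp
        qed
      qed
      \<comment> \<open>Only two kinds of pairs can have a nonzero quadrilateral: those in
        \<open>J\<close>, above level \<open>s\<close> and not yet collapsed, and those in
        \<open>M\<close>, which straddle the level.\<close>
      define M where "M = {i \<in> I. lo i \<le> s \<and> s < hi i}"
      \<comment> \<open>The vertical sides of the quadrilaterals cancel. Here \<open>cyc\<close>,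
        which expresses that the formal boundary of the pairs vanishes, is tested on the paths from
        \<open>F' z\<close> to \<open>F z\<close>.\<close>
      have diff: "chain F' - chain F =
          (\<Sum>i\<in>I. scale (single 0 (c i)) (quad (F' (x i)) (F' (y i)) (F (x i)) (F (y i))))"
      proof -
        have "(\<Sum>i\<in>I. scale (single 0 (c i)) (path (F' (y i)) (F (y i)))) =
            (\<Sum>i\<in>I. scale (single 0 (c i)) (path (F' (x i)) (F (x i))))"
          by (rule cyc[rule_format, of "\<lambda>z. path (F' z) (F z)"])
        then show ?thesis
          unfolding chain_def quad_def
          by (simp add: scale_diff_right scale_right_distrib sum.distrib sum_subtractf)
      qed
      have zero: "quad (F' (x i)) (F' (y i)) (F (x i)) (F (y i)) = 0" if i: "i \<in> I" "i \<notin> J \<union> M" for i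
      proof -
        have "hi i \<le> s \<or> (s < lo i \<and> F' (x i) = F' (y i))" using i unfolding J_def M_def by auto
        then show ?thesis
        proof
          assume "hi i \<le> s"
          then have "h (x i) \<le> s" "h (y i) \<le> s" unfolding hi_def by auto
          then show ?thesis using Fs F1 unfolding quad_def by (simp add: path_self)
        next
          assume *: "s < lo i \<and> F' (x i) = F' (y i)"
          then have "F (x i) = F (y i)" using Fb unfolding lo_def G_def by simp
          then show ?thesis using * unfolding quad_def by (simp add: path_self)
        qed
      qed
      have "fills (chain F' - chain F) (A * real (card (J \<union> M)))"
      proof -
        have "fills (\<Sum>i\<in>J \<union> M. scale (single 0 (c i)) (quad (F' (x i)) (F' (y i)) (F (x i)) (F (y i))))
            (\<Sum>i\<in>J \<union> M. A)"
        proof (rule fills_sum)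
          fix i assume "i \<in> J \<union> M"
          then have "i \<in> I" unfolding J_def M_def by auto
          then have "word_dist S (F' (x i)) (F' (y i)) \<le> 3 * D + 2 + W'" using F3 by fastforce
          from fills_single[OF A(2)[OF this move move]]
          show "fills (scale (single 0 (c i)) (quad (F' (x i)) (F' (y i)) (F (x i)) (F (y i)))) A" .
        qed
        moreover have "(\<Sum>i\<in>J \<union> M. scale (single 0 (c i)) (quad (F' (x i)) (F' (y i)) (F (x i)) (F (y i)))) =
            chain F' - chain F"
          unfolding diff using I zero by (intro sum.mono_neutral_left) (auto simp: J_def M_def)
        ultimately show ?thesis by (simp add: mult.commute)
      qed
      from fills_add[OF T'(1) this]
      have fil: "fills (chain id - chain F) (A * real (T' + card (J \<union> M)))"
        by (simp add: algebra_simps)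
      have count: "T' + card (J \<union> M) + N * card {i \<in> I. s < lo i \<and> F (x i) \<noteq> F (y i)} \<le>
            N * card {i \<in> I. s < lo i} + card {i \<in> I. s < hi i}"
      proof -
        let ?a = "card {i \<in> I. s < lo i \<and> F (x i) \<noteq> F (y i)}"
        let ?a' = "card {i \<in> I. s + W' < lo i \<and> F' (x i) \<noteq> F' (y i)}"
        let ?e = "card {i \<in> I. s < lo i}" and ?e' = "card {i \<in> I. s + W' < lo i}"
        let ?col = "card {j \<in> J. r (G (x j)) = r (G (y j))}"
        \<comment> \<open>Each collapsed pair releases a credit of \<open>N\<close>, and at least
          \<open>card J / N\<close> pairs collapse, which pays for the quadrilaterals over
          \<open>J\<close>. Pairs newly lying above the level bring their own credit, and each pair
          in \<open>M\<close> is charged once.\<close>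
        have "?a + ?col \<le> card J"
        proof -
          have "{i \<in> I. s < lo i \<and> F (x i) \<noteq> F (y i)} \<subseteq> {j \<in> J. \<not> r (G (x j)) = r (G (y j))}"
            unfolding J_def lo_def by (auto simp: Fb G_def)
          then have "?a \<le> card {j \<in> J. \<not> r (G (x j)) = r (G (y j))}"
            using finJ by (intro card_mono) auto
          then show ?thesis
            using card_filter_split[OF finJ, of "\<lambda>j. r (G (x j)) = r (G (y j))"] by linarith
        qed
        then have "N * (?a + ?col) \<le> N * card J" by (rule mult_le_mono2)
        then have "N * ?a + N * ?col \<le> N * card J" unfolding distrib_left .
        then have 1: "N * ?a + card J \<le> N * card J" using r(3) by linarith
        have 2: "card J + ?e' \<le> ?a' + ?e"
        proof -
          let ?B = "{i \<in> I. s < lo i \<and> \<not> s + W' < lo i}"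
          have "J \<subseteq> {i \<in> I. s + W' < lo i \<and> F' (x i) \<noteq> F' (y i)} \<union> ?B" unfolding J_def by auto
          then have "card J \<le> card ({i \<in> I. s + W' < lo i \<and> F' (x i) \<noteq> F' (y i)} \<union> ?B)"
            using I by (intro card_mono) auto
          also have "\<dots> \<le> ?a' + card ?B" by (rule card_Un_le)
          finally have "card J \<le> ?a' + card ?B" .
          moreover have "?e = ?e' + card ?B"
          proof -
            have "{j \<in> {i \<in> I. s < lo i}. s + W' < lo j} = {i \<in> I. s + W' < lo i}"
              "{j \<in> {i \<in> I. s < lo i}. \<not> s + W' < lo j} = ?B" by auto
            moreover have "finite {i \<in> I. s < lo i}" using I by simp
            ultimately show ?thesis using card_filter_split[of "{i \<in> I. s < lo i}" "\<lambda>j. s + W' < lo j"] by simp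
          qed
          ultimately show ?thesis by linarith
        qed
        have 3: "card M + card {i \<in> I. s + W' < hi i} \<le> card {i \<in> I. s < hi i}"
        proof -
          have "M \<inter> {i \<in> I. s + W' < hi i} = {}" 
          proof -
            have "\<not> s + W' < hi i" if "i \<in> M" for i
              using that hilo[of i] W1 unfolding M_def by simp
            then show ?thesis by blast
          qed
          then have "card M + card {i \<in> I. s + W' < hi i} = card (M \<union> {i \<in> I. s + W' < hi i})"
            using I unfolding M_def by (intro card_Un_disjoint[symmetric]) auto
          also have "\<dots> \<le> card {i \<in> I. s < hi i}"
            using I unfolding M_def by (intro card_mono) auto
          finally show ?thesis .
        qed
        have "N * card J + N * ?e' \<le> N * ?a' + N * ?e" using mult_le_mono2[OF 2, of N] by (simp add: distrib_left)
        moreover have "card (J \<union> M) \<le> card J + card M" by (rule card_Un_le)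
        ultimately show ?thesis using 1 3 T'(2) by linarith
      qed
      have "good n F"
        unfolding good_def s_def[symmetric] using Fs Fb Gh r(1) FD fil count
        by (intro conjI allI impI ballI exI[of _ "T' + card (J \<union> M)"]) auto
      then show ?thesis by (rule exI[of _ F])
    qed
    obtain n0 where n0: "\<And>i. i \<in> I \<Longrightarrow> hi i \<le> n0"
    proof -
      have "finite (hi ` I)" using I by simp
      then obtain n0 where "\<forall>k\<in>hi ` I. k \<le> n0" unfolding finite_nat_set_iff_bounded_le by (rule exE)
      then show thesis by (intro that[of n0]) simp
    qed
    \<comment> \<open>The starting level is at least as high as all ends of pairs, so no pair is
      moved and nothing has to be filled yet; the projection only concerns other points.\<close>
    define init where "init z = (if h z \<le> n0 * W' then z else pr (n0 * W') z)" for z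
    have in0: "init (x i) = x i" "init (y i) = y i" if "i \<in> I" for i
    proof -
      have "n0 \<le> n0 * W'" unfolding W'_def by simp
      moreover have "h (x i) \<le> n0" "h (y i) \<le> n0" using n0[OF that] unfolding hi_def by simp_all
      ultimately have "h (x i) \<le> n0 * W'" "h (y i) \<le> n0 * W'" by (blast intro: order_trans)+
      then show "init (x i) = x i" "init (y i) = y i" unfolding init_def by simp_all
    qed
    have "good n0 init"
    proof -
      have "chain id - chain init = 0" unfolding chain_def using in0 by simp
      then have "fills (chain id - chain init) (A * real 0)" using fills_zero by simp
      moreover have e: "{i \<in> I. n0 * W' < lo i \<and> init (x i) \<noteq> init (y i)} = {}"
      proof -
        have "lo i \<le> n0 * W'" if "i \<in> I" for i
        proof -
          have "lo i \<le> n0" using n0[OF that] unfolding hi_def lo_def by linarith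
          moreover have "n0 \<le> n0 * W'" unfolding W'_def by simp
          ultimately show ?thesis by (rule order_trans)
        qed
        then show ?thesis by (auto simp: not_less[symmetric])
      qed
      moreover have "word_dist S (init (x i)) (init (y i)) \<le> 3 * D + 2" if "i \<in> I" for i
      proof -
        have "word_dist S (x i) (y i) \<le> 1" using adj that by blast
        then show ?thesis unfolding in0[OF that] by simp
      qed
      moreover have "0 + N * card {i \<in> I. n0 * W' < lo i \<and> init (x i) \<noteq> init (y i)} \<le>
          N * card {i \<in> I. n0 * W' < lo i} + card {i \<in> I. n0 * W' < hi i}"
        unfolding e by simp
      moreover have "\<forall>z. h z \<le> n0 * W' \<longrightarrow> init z = z" "\<forall>z. n0 * W' < h z \<longrightarrow> h (init z) = n0 * W'"
        unfolding init_def using pr(1) by simp_all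
      ultimately show ?thesis
        unfolding good_def by blast
    qed
    then have "\<exists>F. good n0 F" by (rule exI[of _ init])
    then have "\<exists>F. good 0 F"
    proof (induction n0)
      case (Suc n)
      from Suc.prems obtain F where "good (Suc n) F" by (rule exE)
      from Suc.IH[OF step[OF this]] show ?case .
    qed
    then obtain F where "good 0 F" by (rule exE)
    from this[unfolded good_def] obtain T where F0: "\<And>z. h z \<le> 0 \<Longrightarrow> F z = z" "\<And>z. 0 < h z \<Longrightarrow> h (F z) = 0"
      and T: "fills (chain id - chain F) (A * real T)"
        "T + N * card {i \<in> I. 0 < lo i \<and> F (x i) \<noteq> F (y i)} \<le>
            N * card {i \<in> I. 0 < lo i} + card {i \<in> I. 0 < hi i}"
      by (elim exE conjE) simp
    have "F z = p" for z
    proof -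
      have "h (F z) = 0" using F0[of z] by (cases "h z = 0") auto
      then show ?thesis unfolding h_def d_zero by simp
    qed
    then have "chain F = 0" unfolding chain_def by (simp add: path_self)
    then have f: "fills (chain id) (A * real T)" using T(1) by simp
    have "card {i \<in> I. 0 < lo i} \<le> card I" "card {i \<in> I. 0 < hi i} \<le> card I"
      using I by (auto intro: card_mono)
    then have "N * card {i \<in> I. 0 < lo i} + card {i \<in> I. 0 < hi i} \<le> N * card I + card I"
      by (intro add_mono mult_le_mono2)
    then have "T \<le> (N + 1) * card I" using T(2) by simp
    then have "real T \<le> real ((N + 1) * card I)" by (rule of_nat_mono)
    then have "A * real T \<le> A * (N + 1) * real (card I)"
      using A(1) mult_left_mono[of "real T" "real ((N + 1) * card I)" A] by (simp add: algebra_simps)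
    from fills_mono[OF f this] show ?thesis unfolding chain_def by simp
  qed
  show ?thesis
    by (rule exI[of _ "A * (N + 1)"]) (use main A(1) in simp)
qed

end

section \<open>Reduction of cycles to combinations of paths\<close>

lemma trivial_scale_superset:
  "finite A \<Longrightarrow> keys a \<subseteq> A \<Longrightarrow> trivial_scale a r = (\<Sum>g\<in>A. lookup a g * r)"
  unfolding trivial_scale_def by (rule sum.mono_neutral_left) (auto simp: in_keys_iff)

lemma trivial_scale_add: "trivial_scale (a + b) r = trivial_scale a r + trivial_scale b r"
proof -
  let ?A = "keys a \<union> keys b"
  have "trivial_scale (a + b) r = (\<Sum>g\<in>?A. lookup (a + b) g * r)"
    using keys_add[of a b] by (intro trivial_scale_superset) auto
  then show ?thesis
    using trivial_scale_superset[of ?A a r] trivial_scale_superset[of ?A b r]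
    by (simp add: lookup_add distrib_right sum.distrib)
qed

lemma trivial_scale_zero: "trivial_scale 0 r = 0"
  by (simp add: trivial_scale_def)

lemma trivial_scale_sum: "trivial_scale (sum f A) r = (\<Sum>i\<in>A. trivial_scale (f i) r)"
  by (induction A rule: infinite_finite_induct) (auto simp: trivial_scale_zero trivial_scale_add)

lemma trivial_scale_mult: "trivial_scale (a * single 0 s) 1 = trivial_scale a s"
proof -
  have "a * single 0 s = (\<Sum>g\<in>keys a. single g (lookup a g)) * single 0 s"
    by (simp only: sum_singles)
  also have "\<dots> = (\<Sum>g\<in>keys a. single g (lookup a g * s))"
    by (simp add: sum_distrib_right mult_single)
  finally have "trivial_scale (a * single 0 s) 1 = (\<Sum>g\<in>keys a. lookup a g * s)"
    by (simp add: trivial_scale_sum trivial_scale_single)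
  then show ?thesis by (simp add: trivial_scale_def)
qed

lemma single_sum: "single k (sum f A) = (\<Sum>i\<in>A. single k (f i))"
  by (induction A rule: infinite_finite_induct) (auto simp: single_add)

lemma left_module_times: "left_module ((*) :: 'a::ring_1 \<Rightarrow> 'a \<Rightarrow> 'a)"
  by unfold_locales (auto simp: distrib_left distrib_right mult.assoc)

context low_resolution
begin

text \<open>A lift \<open>\<psi>\<close> of the augmentation to the group ring and a homotopy
  \<open>\<tau>\<close> from the identity to \<open>u \<mapsto> scale (\<psi> u) vtx0\<close>. Both
  are prescribed on a free module having \<open>C0\<close> as a retract, where exactness provides
  the values of \<open>\<tau>\<close>, and are then composed with the inclusion
  \<open>i\<close>.\<close>

lemma splitting_maps:
  "\<exists>(\<psi> :: 'm \<Rightarrow> ('g \<Rightarrow>\<^sub>0 'r)) \<tau>. module_map scale C0 (*) UNIV \<psi> \<and> module_map scale C0 scale C1 \<tau> \<and>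
     (\<forall>u\<in>C0. trivial_scale (\<psi> u) 1 = aug u) \<and> (\<forall>u\<in>C0. bd1 (\<tau> u) = scale (\<psi> u) vtx0 - u)"
proof -
  interpret T: left_module "(*) :: ('g \<Rightarrow>\<^sub>0 'r) \<Rightarrow> _" by (rule left_module_times)
  obtain X :: "'m set" and i p where i: "module_map scale C0 free_scale {c. keys c \<subseteq> X} i"
    and p: "module_map free_scale {c. keys c \<subseteq> X} scale C0 p" and pi: "\<And>x. x \<in> C0 \<Longrightarrow> p (i x) = x"
    using proj0 unfolding projective_def by blast
  define F where "F = {c :: 'm \<Rightarrow>\<^sub>0 ('g \<Rightarrow>\<^sub>0 'r). keys c \<subseteq> X}"
  note i = i[folded F_def] and p = p[folded F_def]
  have subF: "submodule free_scale F"
    unfolding submodule_def F_def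
  proof (intro conjI ballI allI)
    show "0 \<in> {c :: 'm \<Rightarrow>\<^sub>0 ('g \<Rightarrow>\<^sub>0 'r). keys c \<subseteq> X}" by simp
    show "x + y \<in> {c. keys c \<subseteq> X}" if "x \<in> {c. keys c \<subseteq> X}" "y \<in> {c. keys c \<subseteq> X}" for x y :: "'m \<Rightarrow>\<^sub>0 ('g \<Rightarrow>\<^sub>0 'r)"
      using that keys_add[of x y] by auto
    show "free_scale a x \<in> {c. keys c \<subseteq> X}" if "x \<in> {c. keys c \<subseteq> X}" for a and x :: "'m \<Rightarrow>\<^sub>0 ('g \<Rightarrow>\<^sub>0 'r)"
      using that keys_free_scale[of a x] by auto
  qed
  define e :: "'m \<Rightarrow> ('m \<Rightarrow>\<^sub>0 ('g \<Rightarrow>\<^sub>0 'r))" where "e x = single x 1" for x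
  have eF: "e x \<in> F" if "x \<in> X" for x using that unfolding e_def F_def by simp
  have eC: "p (e x) \<in> C0" if "x \<in> X" for x using module_map_mem[OF p eF[OF that]] .
  have decomp: "c = (\<Sum>x\<in>keys c. free_scale (lookup c x) (e x))" for c :: "'m \<Rightarrow>\<^sub>0 ('g \<Rightarrow>\<^sub>0 'r)"
    by (rule poly_mapping_eqI)
      (simp add: lookup_sum lookup_free_scale e_def lookup_single when_def in_keys_iff if_distrib[of "(*) _"] cong: if_cong)
  have pc: "p c = (\<Sum>x\<in>keys c. scale (lookup c x) (p (e x)))" if c: "c \<in> F" for c
  proof -
    have m: "free_scale (lookup c x) (e x) \<in> F" if "x \<in> keys c" for x
    proof -
      have "x \<in> X" using c that unfolding F_def by auto
      then have "keys (e x) \<subseteq> X" unfolding e_def by simp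
      then show ?thesis using keys_free_scale[of "lookup c x" "e x"] unfolding F_def by auto
    qed
    have "p c = p (\<Sum>x\<in>keys c. free_scale (lookup c x) (e x))" by (simp only: decomp[symmetric])
    also have "\<dots> = (\<Sum>x\<in>keys c. p (free_scale (lookup c x) (e x)))"
      by (rule conjunct2[OF module_map_sum[OF p subF m]])
    also have "\<dots> = (\<Sum>x\<in>keys c. scale (lookup c x) (p (e x)))"
    proof (rule sum.cong[OF refl])
      fix x assume "x \<in> keys c"
      then have "x \<in> X" using c unfolding F_def by auto
      show "p (free_scale (lookup c x) (e x)) = scale (lookup c x) (p (e x))"
        by (rule module_map_scale[OF p eF[OF \<open>x \<in> X\<close>]])
    qed
    finally show ?thesis .
  qed
  define \<alpha> where "\<alpha> x = aug (p (e x))" for x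
  have "\<forall>x\<in>X. \<exists>t. t \<in> C1 \<and> bd1 t = scale (single 0 (\<alpha> x)) vtx0 - p (e x)"
  proof
    fix x assume x: "x \<in> X"
    have m: "scale (single 0 (\<alpha> x)) vtx0 \<in> C0" by (rule C0_scale[OF vtx0(1)])
    have "aug (scale (single 0 (\<alpha> x)) vtx0 - p (e x)) = 0"
      unfolding aug_diff[OF m eC[OF x]] aug_scale[OF vtx0(1)] vtx0(2) trivial_scale_single
      by (simp add: \<alpha>_def)
    then have "scale (single 0 (\<alpha> x)) vtx0 - p (e x) \<in> bd1 ` C1"
      using exact0 C0_diff[OF m eC[OF x]] by simp
    then obtain t where "t \<in> C1" "scale (single 0 (\<alpha> x)) vtx0 - p (e x) = bd1 t" by (rule imageE)
    then show "\<exists>t. t \<in> C1 \<and> bd1 t = scale (single 0 (\<alpha> x)) vtx0 - p (e x)"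
      by (intro exI[of _ t]) simp
  qed
  from bchoice[OF this] obtain t
    where t: "\<forall>x\<in>X. t x \<in> C1 \<and> bd1 (t x) = scale (single 0 (\<alpha> x)) vtx0 - p (e x)" by (rule exE)
  define \<psi> where "\<psi> u = T.linext (\<lambda>x. single 0 (\<alpha> x)) (i u)" for u
  define \<tau> where "\<tau> u = linext t (i u)" for u
  have iX: "x \<in> X" if "u \<in> C0" "x \<in> keys (i u)" for u x
    using module_map_mem[OF i that(1)] that(2) unfolding F_def by auto
  have "module_map scale C0 (*) UNIV \<psi>"
    unfolding module_map_def \<psi>_def
    by (simp add: module_map_add[OF i] module_map_scale[OF i] T.linext_add T.linext_free_scale)
  moreover have \<tau>C: "\<tau> u \<in> C1" if "u \<in> C0" for u
    unfolding \<tau>_def linext_def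
  proof (intro c1.sum_mem c1.scale_mem)
    fix x assume "x \<in> keys (i u)"
    from bspec[OF t iX[OF that this]] show "t x \<in> C1" by (rule conjunct1)
  qed
  then have "module_map scale C0 scale C1 \<tau>"
    unfolding module_map_def
    by (auto simp: \<tau>_def module_map_add[OF i] module_map_scale[OF i] linext_add linext_free_scale)
  moreover have "trivial_scale (\<psi> u) 1 = aug u" if u: "u \<in> C0" for u
  proof -
    have m: "scale (lookup (i u) x) (p (e x)) \<in> C0" if "x \<in> keys (i u)" for x
      by (rule C0_scale[OF eC[OF iX[OF u that]]])
    have "u = (\<Sum>x\<in>keys (i u). scale (lookup (i u) x) (p (e x)))"
      using pc[OF module_map_mem[OF i u]] pi[OF u] by simp
    then have "aug u = aug (\<Sum>x\<in>keys (i u). scale (lookup (i u) x) (p (e x)))" by (rule arg_cong)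
    also have "\<dots> = (\<Sum>x\<in>keys (i u). aug (scale (lookup (i u) x) (p (e x))))"
      by (rule conjunct2[OF module_map_sum[OF map_aug sub0 m]])
    also have "\<dots> = (\<Sum>x\<in>keys (i u). trivial_scale (lookup (i u) x) (\<alpha> x))"
      unfolding \<alpha>_def by (rule sum.cong[OF refl], rule aug_scale[OF eC[OF iX[OF u]]])
    finally show ?thesis
      unfolding \<psi>_def T.linext_def by (simp add: trivial_scale_sum trivial_scale_mult)
  qed
  moreover have "bd1 (\<tau> u) = scale (\<psi> u) vtx0 - u" if u: "u \<in> C0" for u
  proof -
    have tx: "t x \<in> C1" "bd1 (t x) = scale (single 0 (\<alpha> x)) vtx0 - p (e x)" if "x \<in> keys (i u)" for x
      using bspec[OF t iX[OF u that]] by simp_all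
    have "bd1 (\<tau> u) = (\<Sum>x\<in>keys (i u). bd1 (scale (lookup (i u) x) (t x)))"
      unfolding \<tau>_def linext_def by (rule conjunct2[OF module_map_sum[OF map1 c1.submod c1.scale_mem[OF tx(1)]]])
    also have "\<dots> = (\<Sum>x\<in>keys (i u). scale (lookup (i u) x * single 0 (\<alpha> x)) vtx0 - scale (lookup (i u) x) (p (e x)))"
      by (rule sum.cong[OF refl]) (simp add: bd1_scale tx scale_diff_right scale_scale)
    also have "\<dots> = scale (\<psi> u) vtx0 - p (i u)"
      unfolding pc[OF module_map_mem[OF i u]] \<psi>_def T.linext_def
      by (simp add: sum_subtractf scale_sum_left)
    finally show ?thesis unfolding pi[OF u] .
  qed
  ultimately show ?thesis by (intro exI[of _ \<psi>] exI[of _ \<tau>]) simp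
qed


text \<open>The \<open>R\<close>-linear extension of \<open>q\<close> to the group ring. The map
  \<open>q\<close> need not be equivariant, which the pushes of the cone are not.\<close>

definition rsum :: "('g \<Rightarrow> 'm) \<Rightarrow> ('g \<Rightarrow>\<^sub>0 'r) \<Rightarrow> 'm" where
  "rsum q a = (\<Sum>g\<in>keys a. scale (single 0 (lookup a g)) (q g))"

lemma rsum_superset:
  "finite A \<Longrightarrow> keys a \<subseteq> A \<Longrightarrow> rsum q a = (\<Sum>g\<in>A. scale (single 0 (lookup a g)) (q g))"
  unfolding rsum_def by (rule sum.mono_neutral_left) (auto simp: in_keys_iff)

lemma rsum_add: "rsum q (a + b) = rsum q a + rsum q b"
proof -
  let ?A = "keys a \<union> keys b"
  have "rsum q (a + b) = (\<Sum>g\<in>?A. scale (single 0 (lookup (a + b) g)) (q g))"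
    using keys_add[of a b] by (intro rsum_superset) auto
  then show ?thesis
    using rsum_superset[of ?A a q] rsum_superset[of ?A b q]
    by (simp add: lookup_add single_add scale_left_distrib sum.distrib)
qed

lemma rsum_zero: "rsum q 0 = 0"
  by (simp add: rsum_def)

lemma rsum_sum: "rsum q (sum f A) = (\<Sum>i\<in>A. rsum q (f i))"
  by (induction A rule: infinite_finite_induct) (auto simp: rsum_zero rsum_add)

lemma rsum_single: "rsum q (single g s) = scale (single 0 s) (q g)"
  unfolding rsum_def by (cases "s = 0") auto

text \<open>
  Over each basis element \<open>z\<close> the chain \<open>\<phi> z\<close>, a combination of the paths from \<open>0\<close> to the elements
  in the support of \<open>\<psi> (bd1 z)\<close>, differs from \<open>z + \<tau> (bd1 z)\<close> by a cycle \<open>h z\<close>. As \<open>\<tau>\<close> drops out on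
  cycles, this reduces an arbitrary cycle to one made of paths, to which the cone applies.
\<close>

lemma linear_filling:
  "\<exists>T :: 'g set. finite T \<and> (\<forall>S pr D W. word_metric S \<longrightarrow> T \<subseteq> S \<longrightarrow>
     graph_metric.contracting (word_dist S) 0 pr D W \<longrightarrow>
     (\<exists>K\<ge>0. \<forall>b\<in>C1. bd1 b = 0 \<longrightarrow> fills b (K * real (c1.nrm b))))"
proof -
  obtain \<psi> :: "'m \<Rightarrow> ('g \<Rightarrow>\<^sub>0 'r)" and \<tau> where psi: "module_map scale C0 (*) UNIV \<psi>"
    and tau: "module_map scale C0 scale C1 \<tau>"
    and aug_psi: "\<forall>u\<in>C0. trivial_scale (\<psi> u) 1 = aug u"
    and bd_tau: "\<forall>u\<in>C0. bd1 (\<tau> u) = scale (\<psi> u) vtx0 - u"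
    using splitting_maps by (elim exE conjE)
  define w where "w z = \<psi> (bd1 z)" for z
  define T where "T = (\<Union>z\<in>B1. keys (w z))"
  have finT: "finite T" unfolding T_def using c1.finite_basis by simp
  have w0: "(\<Sum>j\<in>keys (w z). lookup (w z) j) = 0" if "z \<in> B1" for z
  proof -
    have "bd1 z \<in> bd1 ` C1" by (rule imageI[OF c1.basis_mem[OF that]])
    then have z: "bd1 z \<in> C0" "aug (bd1 z) = 0" unfolding exact0 by simp_all
    then have "trivial_scale (w z) 1 = 0" unfolding w_def using aug_psi by simp
    then show ?thesis unfolding trivial_scale_def by simp
  qed
  define \<phi> where "\<phi> z = (\<Sum>j\<in>keys (w z). scale (single 0 (lookup (w z) j)) (path 0 j))" for z
  have phiC: "\<phi> z \<in> C1" for z unfolding \<phi>_def by (intro c1.sum_mem c1.scale_mem path_mem)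
  have bd_phi: "bd1 (\<phi> z) = scale (w z) vtx0" if z: "z \<in> B1" for z
  proof -
    have m: "scale (single 0 (lookup (w z) j)) (path 0 j) \<in> C1" for j by (rule c1.scale_mem[OF path_mem])
    have "bd1 (\<phi> z) = (\<Sum>j\<in>keys (w z). bd1 (scale (single 0 (lookup (w z) j)) (path 0 j)))"
      unfolding \<phi>_def by (rule conjunct2[OF module_map_sum[OF map1 c1.submod m]])
    also have "\<dots> = (\<Sum>j\<in>keys (w z). scale (single j (lookup (w z) j)) vtx0 - scale (single 0 (lookup (w z) j)) vtx0)"
      by (rule sum.cong[OF refl])
        (simp add: bd1_scale[OF path_mem] bd1_path scale_diff_right vtx_def scale_scale mult_single)
    also have "\<dots> = scale (w z) vtx0 - scale (single 0 (\<Sum>j\<in>keys (w z). lookup (w z) j)) vtx0"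
      by (simp only: sum_subtractf scale_sum_left[symmetric] single_sum sum_singles)
    finally show ?thesis unfolding w0[OF z] by simp
  qed
  define h where "h z = z + \<tau> (bd1 z) - \<phi> z" for z
  have zC: "z \<in> C1" "bd1 z \<in> C0" "\<tau> (bd1 z) \<in> C1" if "z \<in> B1" for z
    using c1.basis_mem[OF that] bd1_mem[of z] module_map_mem[OF tau, of "bd1 z"] by auto
  have "\<exists>A\<ge>0. \<forall>b\<in>h ` B1. fills b A"
  proof (rule fills_finite)
    show "finite (h ` B1)" using c1.finite_basis by simp
    fix b assume "b \<in> h ` B1"
    then obtain z where z: "z \<in> B1" "b = h z" by blast
    have m: "z + \<tau> (bd1 z) \<in> C1" by (rule c1.add_mem[OF zC(1,3)[OF z(1)]])
    have "bd1 (h z) = 0"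
      unfolding h_def bd1_diff[OF m phiC] bd1_add[OF zC(1,3)[OF z(1)]] bd_phi[OF z(1)]
      using bd_tau zC(2)[OF z(1)] unfolding w_def by simp
    moreover have "h z \<in> C1" unfolding h_def by (rule c1.diff_mem[OF m phiC])
    ultimately show "b \<in> C1 \<and> bd1 b = 0" unfolding z(2) by simp
  qed
  then obtain A where A: "A \<ge> 0" "\<forall>b\<in>h ` B1. fills b A" by (elim exE conjE)
  obtain M where M: "\<forall>k\<in>(\<lambda>z. card (keys (w z))) ` B1. k \<le> M"
    using c1.finite_basis finite_nat_set_iff_bounded_le[of "(\<lambda>z. card (keys (w z))) ` B1"] by auto
  have main: "\<exists>K\<ge>0. \<forall>b\<in>C1. bd1 b = 0 \<longrightarrow> fills b (K * real (c1.nrm b))"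
    if S: "word_metric S" "T \<subseteq> S" and con: "graph_metric.contracting (word_dist S) 0 pr D W" for S pr D W
  proof -
    interpret ms: metric_resolution scale C0 C1 C2 B1 B2 bd1 bd2 aug S
      by (rule metric_resolution.intro[OF low_resolution_axioms S(1)])
    obtain K where K: "K \<ge> 0" "\<forall>(I :: ('m \<times> 'g \<times> 'g) set) (c :: 'm \<times> 'g \<times> 'g \<Rightarrow> 'r) x y. finite I \<longrightarrow>
     (\<forall>i\<in>I. word_dist S (x i) (y i) \<le> 1) \<longrightarrow>
     (\<forall>q :: 'g \<Rightarrow> 'm. (\<Sum>i\<in>I. scale (single 0 (c i)) (q (y i))) = (\<Sum>i\<in>I. scale (single 0 (c i)) (q (x i)))) \<longrightarrow>
     fills (\<Sum>i\<in>I. scale (single 0 (c i)) (path (x i) (y i))) (K * real (card I))"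
      using ms.cone_fills[OF con] by (elim exE conjE)
    have "fills b ((K * real M + A) * real (c1.nrm b))" if b: "b \<in> C1" "bd1 b = 0" for b
    proof -
      define \<beta> where "\<beta> z = lookup (c1.coords b) z" for z
      \<comment> \<open>Each \<open>R\<close>-coordinate \<open>(z, g)\<close> of \<open>b\<close>
        yields the translate by \<open>g\<close> of \<open>\<phi> z\<close>, that is one pair
        \<open>(g, g + j)\<close> for each \<open>j\<close> in the support of \<open>w z\<close>. So
        the number of pairs is at most \<open>M * c1.nrm b\<close>.\<close>
      define I where "I = Sigma B1 (\<lambda>z. keys (\<beta> z) \<times> keys (w z))"
      define c where "c = (\<lambda>(z, g, j). lookup (\<beta> z) g * lookup (w z) j)"
      define x y where "x = (\<lambda>(z :: 'm, g :: 'g, j :: 'g). g)" and "y = (\<lambda>(z :: 'm, g :: 'g, j). g + j)"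
      have finI: "finite I" unfolding I_def using c1.finite_basis by simp
      have sumI: "(\<Sum>i\<in>I. f (fst i) (fst (snd i)) (snd (snd i))) = (\<Sum>z\<in>B1. \<Sum>g\<in>keys (\<beta> z). \<Sum>j\<in>keys (w z). f z g j)"
        for f :: "'m \<Rightarrow> 'g \<Rightarrow> 'g \<Rightarrow> 'm"
      proof -
        have "(\<Sum>z\<in>B1. \<Sum>g\<in>keys (\<beta> z). \<Sum>j\<in>keys (w z). f z g j) =
            (\<Sum>z\<in>B1. \<Sum>p\<in>keys (\<beta> z) \<times> keys (w z). f z (fst p) (snd p))"
          by (simp add: sum.cartesian_product split_beta)
        also have "\<dots> = (\<Sum>(z, p)\<in>I. f z (fst p) (snd p))"
          unfolding I_def by (rule sum.Sigma) (simp_all add: c1.finite_basis)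
        finally show ?thesis by (simp add: split_beta)
      qed
      have bexp: "b = (\<Sum>z\<in>B1. scale (\<beta> z) z)" unfolding \<beta>_def by (rule c1.basis_expansion[OF b(1)])
      have sb: "scale (\<beta> z) m = (\<Sum>g\<in>keys (\<beta> z). scale (single g (lookup (\<beta> z) g)) m)" for z m
        by (simp only: scale_sum_left[symmetric] sum_singles)
      have m1: "scale (\<beta> z) z \<in> C1" if "z \<in> B1" for z by (rule c1.scale_mem[OF zC(1)[OF that]])
      have m0: "scale (\<beta> z) (bd1 z) \<in> C0" if "z \<in> B1" for z by (rule C0_scale[OF zC(2)[OF that]])
      have "bd1 (\<Sum>z\<in>B1. scale (\<beta> z) z) = (\<Sum>z\<in>B1. bd1 (scale (\<beta> z) z))"
        by (rule conjunct2[OF module_map_sum[OF map1 c1.submod m1]])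
      then have "bd1 b = (\<Sum>z\<in>B1. bd1 (scale (\<beta> z) z))" unfolding bexp[symmetric] .
      also have "\<dots> = (\<Sum>z\<in>B1. scale (\<beta> z) (bd1 z))"
        by (rule sum.cong[OF refl], rule bd1_scale[OF zC(1)])
      finally have bd0: "(\<Sum>z\<in>B1. scale (\<beta> z) (bd1 z)) = 0" using b(2) by simp
      have "\<psi> (\<Sum>z\<in>B1. scale (\<beta> z) (bd1 z)) = (\<Sum>z\<in>B1. \<psi> (scale (\<beta> z) (bd1 z)))"
        by (rule conjunct2[OF module_map_sum[OF psi sub0 m0]])
      also have "\<dots> = (\<Sum>z\<in>B1. \<beta> z * w z)"
        unfolding w_def by (rule sum.cong[OF refl], rule module_map_scale[OF psi zC(2)])
      finally have psi0: "(\<Sum>z\<in>B1. \<beta> z * w z) = 0" unfolding bd0 module_map_zero[OF psi sub0] by simp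
      have "\<tau> (\<Sum>z\<in>B1. scale (\<beta> z) (bd1 z)) = (\<Sum>z\<in>B1. \<tau> (scale (\<beta> z) (bd1 z)))"
        by (rule conjunct2[OF module_map_sum[OF tau sub0 m0]])
      also have "\<dots> = (\<Sum>z\<in>B1. scale (\<beta> z) (\<tau> (bd1 z)))"
        by (rule sum.cong[OF refl], rule module_map_scale[OF tau zC(2)])
      finally have tau0: "(\<Sum>z\<in>B1. scale (\<beta> z) (\<tau> (bd1 z))) = 0"
        unfolding bd0 module_map_zero[OF tau sub0] by simp
      have mult: "\<beta> z * w z = (\<Sum>g\<in>keys (\<beta> z). \<Sum>j\<in>keys (w z). single (g + j) (lookup (\<beta> z) g * lookup (w z) j))" for z
      proof -
        have "\<beta> z * w z = (\<Sum>g\<in>keys (\<beta> z). single g (lookup (\<beta> z) g)) * (\<Sum>j\<in>keys (w z). single j (lookup (w z) j))"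
          by (simp only: sum_singles)
        then show ?thesis by (simp only: sum_product mult_single)
      qed
      \<comment> \<open>The second ends add up to \<open>rsum q\<close> of
        \<open>\<psi> (bd1 b) = 0\<close>. The first ends carry the coefficient sum of each
        \<open>w z\<close>, which is the augmentation of a boundary. So both sides are 0.\<close>
      have cyc: "(\<Sum>i\<in>I. scale (single 0 (c i)) (q (y i))) = (\<Sum>i\<in>I. scale (single 0 (c i)) (q (x i)))" for q :: "'g \<Rightarrow> 'm"
      proof -
        have "(\<Sum>i\<in>I. scale (single 0 (c i)) (q (y i))) =
            (\<Sum>z\<in>B1. \<Sum>g\<in>keys (\<beta> z). \<Sum>j\<in>keys (w z). scale (single 0 (lookup (\<beta> z) g * lookup (w z) j)) (q (g + j)))"
          unfolding sumI[symmetric] c_def y_def by (simp add: split_beta)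
        also have "\<dots> = rsum q (\<Sum>z\<in>B1. \<beta> z * w z)"
          unfolding mult by (simp only: rsum_sum rsum_single)
        also have "\<dots> = 0" unfolding psi0 by (rule rsum_zero)
        finally have 1: "(\<Sum>i\<in>I. scale (single 0 (c i)) (q (y i))) = 0" .
        have "(\<Sum>i\<in>I. scale (single 0 (c i)) (q (x i))) =
            (\<Sum>z\<in>B1. \<Sum>g\<in>keys (\<beta> z). \<Sum>j\<in>keys (w z). scale (single 0 (lookup (\<beta> z) g * lookup (w z) j)) (q g))"
          unfolding sumI[symmetric] c_def x_def by (simp add: split_beta)
        also have "\<dots> = (\<Sum>z\<in>B1. \<Sum>g\<in>keys (\<beta> z). scale (single 0 (lookup (\<beta> z) g * (\<Sum>j\<in>keys (w z). lookup (w z) j))) (q g))"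
          by (simp only: scale_sum_left[symmetric] single_sum[symmetric] sum_distrib_left[symmetric])
        also have "\<dots> = 0" using w0 by simp
        finally show ?thesis using 1 by simp
      qed
      have adj: "\<forall>i\<in>I. word_dist S (x i) (y i) \<le> 1"
      proof
        fix i assume "i \<in> I"
        obtain z g j where i: "i = (z, g, j)" by (cases i)
        have "z \<in> B1" "j \<in> keys (w z)" using \<open>i \<in> I\<close> unfolding I_def i by auto
        then have "j \<in> T" unfolding T_def by (rule UN_I)
        then have "j \<in> S" using S(2) by (rule rev_subsetD)
        then show "word_dist S (x i) (y i) \<le> 1"
          unfolding i x_def y_def using ms.word_length_generator[of j] by (simp add: ms.word_dist_right)
      qed
      define \<Phi> where "\<Phi> = (\<Sum>i\<in>I. scale (single 0 (c i)) (path (x i) (y i)))"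
      have f1: "fills \<Phi> (K * real (card I))"
        unfolding \<Phi>_def
        by (rule mp[OF mp[OF mp[OF spec[OF spec[OF spec[OF spec[OF K(2), of I], of c], of x], of y] finI] adj]
              allI[OF cyc]])
      have "\<Phi> = (\<Sum>z\<in>B1. \<Sum>g\<in>keys (\<beta> z). \<Sum>j\<in>keys (w z). scale (single 0 (lookup (\<beta> z) g * lookup (w z) j)) (path g (g + j)))"
        unfolding \<Phi>_def sumI[symmetric] c_def x_def y_def by (simp add: split_beta)
      also have "\<dots> = (\<Sum>z\<in>B1. scale (\<beta> z) (\<phi> z))"
      proof (rule sum.cong[OF refl])
        fix z
        have "scale (single 0 (s * s')) (path g (g + j)) = scale (single g s) (scale (single 0 s') (path 0 j))" for s s' g j
        proof -
          have "path g (g + j) = scale (single g 1) (path 0 j)" unfolding scale_path by simp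
          then show ?thesis by (simp add: scale_scale mult_single)
        qed
        then have "(\<Sum>j\<in>keys (w z). scale (single 0 (lookup (\<beta> z) g * lookup (w z) j)) (path g (g + j))) =
            scale (single g (lookup (\<beta> z) g)) (\<phi> z)" for g
          unfolding \<phi>_def scale_sum_right by (rule sum.cong[OF refl])
        then show "(\<Sum>g\<in>keys (\<beta> z). \<Sum>j\<in>keys (w z). scale (single 0 (lookup (\<beta> z) g * lookup (w z) j)) (path g (g + j))) =
            scale (\<beta> z) (\<phi> z)"
          unfolding sb[of z "\<phi> z"] by (rule sum.cong[OF refl])
      qed
      finally have Phi: "\<Phi> = (\<Sum>z\<in>B1. scale (\<beta> z) (\<phi> z))" .
      \<comment> \<open>The terms with \<open>\<tau>\<close> combine to
        \<open>\<tau> (bd1 b) = 0\<close>.\<close>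
      have "(\<Sum>z\<in>B1. scale (\<beta> z) (h z)) = b - \<Phi>"
        unfolding h_def Phi by (simp add: scale_diff_right scale_right_distrib sum_subtractf sum.distrib tau0 bexp[symmetric])
      moreover have "fills (\<Sum>z\<in>B1. scale (\<beta> z) (h z)) (\<Sum>z\<in>B1. \<Sum>g\<in>keys (\<beta> z). A)"
      proof (rule fills_sum)
        fix z assume "z \<in> B1"
        then have "fills (h z) A" using A(2) by simp
        then show "fills (scale (\<beta> z) (h z)) (\<Sum>g\<in>keys (\<beta> z). A)"
          unfolding sb[of z "h z"] by (intro fills_sum fills_single)
      qed
      ultimately have f2: "fills (b - \<Phi>) (A * real (c1.nrm b))"
        unfolding c1.nrm_eq[OF b(1)] \<beta>_def by (simp add: sum_distrib_left mult.commute)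
      have "card I = (\<Sum>z\<in>B1. card (keys (\<beta> z)) * card (keys (w z)))"
        unfolding I_def using c1.finite_basis by (simp add: card_SigmaI card_cartesian_product)
      also have "\<dots> \<le> (\<Sum>z\<in>B1. card (keys (\<beta> z)) * M)" using M by (intro sum_mono mult_le_mono2) simp
      also have "\<dots> = M * c1.nrm b" unfolding c1.nrm_eq[OF b(1)] \<beta>_def by (simp add: sum_distrib_left mult.commute)
      finally have "real (card I) \<le> real (M * c1.nrm b)" by (rule of_nat_mono)
      then have "K * real (card I) \<le> K * real (M * c1.nrm b)" using K(1) by (rule mult_left_mono)
      from fills_add[OF fills_mono[OF f1 this] f2] show ?thesis by (simp add: algebra_simps)
    qed
    then show ?thesis using K(1) A(1) by (intro exI[of _ "K * real M + A"]) simp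
  qed
  show ?thesis
    by (rule exI[of _ T], rule conjI[OF finT], intro allI impI, rule main)
qed

end

section \<open>Isoperimetric functions\<close>

context low_resolution
begin

definition iso :: "real \<Rightarrow> ennreal" where
  "iso l = (SUP b \<in> {b \<in> bd2 ` C2. l1_norm scale B1 b \<le> l}.
     INF c \<in> {c \<in> C2. bd2 c = b}. ennreal (l1_norm scale B2 c))"

text \<open>The strict inequality yields a filling directly, without the question whether the
  infimum is attained.\<close>

lemma fills_of_iso:
  assumes "b \<in> C1" "bd1 b = 0" "real (c1.nrm b) \<le> l" "iso l < ennreal A"
  shows "fills b A"
proof -
  have "b \<in> bd2 ` C2" using assms(1,2) exact1 by simp
  then have "(INF c \<in> {c \<in> C2. bd2 c = b}. ennreal (l1_norm scale B2 c)) \<le> iso l"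
    unfolding iso_def using assms(3) by (intro SUP_upper) (simp add: c1.l1_norm_eq)
  also have "\<dots> < ennreal A" by (rule assms(4))
  finally obtain c where c: "c \<in> C2" "bd2 c = b" "ennreal (l1_norm scale B2 c) < ennreal A"
    unfolding INF_less_iff by auto
  have "real (c2.nrm c) < A" using c(3) unfolding c2.l1_norm_eq by (simp add: ennreal_less_iff)
  then show ?thesis unfolding fills_def using c(1,2) by (intro bexI[of _ c]) auto
qed

lemma iso_le:
  assumes "\<And>b. b \<in> C1 \<Longrightarrow> bd1 b = 0 \<Longrightarrow> real (c1.nrm b) \<le> l \<Longrightarrow> fills b A"
  shows "iso l \<le> ennreal A"
  unfolding iso_def
proof (rule SUP_least)
  fix b assume "b \<in> {b \<in> bd2 ` C2. l1_norm scale B1 b \<le> l}"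
  then have "b \<in> C1" "bd1 b = 0" "real (c1.nrm b) \<le> l" using exact1 by (auto simp: c1.l1_norm_eq)
  from assms[OF this] obtain c where c: "c \<in> C2" "bd2 c = b" "real (c2.nrm c) \<le> A"
    unfolding fills_def by blast
  have "(INF c \<in> {c \<in> C2. bd2 c = b}. ennreal (l1_norm scale B2 c)) \<le> ennreal (l1_norm scale B2 c)"
    using c(1,2) by (intro INF_lower) simp
  also have "\<dots> \<le> ennreal A" unfolding c2.l1_norm_eq using c(3) by (rule ennreal_leI)
  finally show "(INF c \<in> {c \<in> C2. bd2 c = b}. ennreal (l1_norm scale B2 c)) \<le> ennreal A" .
qed

lemma quadratic_fills:
  assumes "growth_le iso (\<lambda>x. ennreal (x\<^sup>2))"
  shows "\<exists>K>0. \<forall>b\<in>C1. bd1 b = 0 \<longrightarrow> fills b (K * (real (c1.nrm b))\<^sup>2 + K)"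
proof -
  obtain C K :: real where CK: "C > 0" "K > 0"
    "\<And>x. x \<ge> 0 \<Longrightarrow> iso x \<le> ennreal K * ennreal ((K * x + C)\<^sup>2) + ennreal (K * x + C)"
    using assms unfolding growth_le_def by blast
  define M where "M = 2 * K * K\<^sup>2 + 2 * K * C\<^sup>2 + K + C + 1"
  have "M > 0" unfolding M_def using CK by (simp add: add_pos_pos)
  moreover have "fills b (M * (real (c1.nrm b))\<^sup>2 + M)" if b: "b \<in> C1" "bd1 b = 0" for b
  proof -
    define n where "n = real (c1.nrm b)"
    have n0: "n \<ge> 0" unfolding n_def by simp
    \<comment> \<open>Norms are natural numbers, so linear terms are absorbed by quadratic
      ones.\<close>
    have nn: "n \<le> n\<^sup>2" unfolding n_def by (cases "c1.nrm b") (auto simp: power2_eq_square)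
    have "iso n \<le> ennreal K * ennreal ((K * n + C)\<^sup>2) + ennreal (K * n + C)" by (rule CK(3)[OF n0])
    also have "\<dots> = ennreal (K * (K * n + C)\<^sup>2 + (K * n + C))"
      using CK n0 by (simp add: ennreal_mult ennreal_plus)
    also have "\<dots> < ennreal (K * (K * n + C)\<^sup>2 + (K * n + C) + 1)"
      using CK n0 by (subst ennreal_less_iff) auto
    finally have f: "fills b (K * (K * n + C)\<^sup>2 + (K * n + C) + 1)"
      unfolding n_def by (rule fills_of_iso[OF b order_refl])
    have "(K * n + C)\<^sup>2 \<le> 2 * (K\<^sup>2 * n\<^sup>2) + 2 * C\<^sup>2"
      using zero_le_power2[of "K * n - C"] by (simp add: power2_eq_square algebra_simps)
    then have 1: "K * (K * n + C)\<^sup>2 \<le> K * (2 * (K\<^sup>2 * n\<^sup>2) + 2 * C\<^sup>2)" using CK by (intro mult_left_mono) auto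
    have 2: "K * n \<le> K * n\<^sup>2" using CK nn by (intro mult_left_mono) auto
    have 3: "M * n\<^sup>2 + M = 2 * K * K\<^sup>2 * n\<^sup>2 + 2 * K * C\<^sup>2 * n\<^sup>2 + K * n\<^sup>2 + C * n\<^sup>2 + n\<^sup>2 +
        (2 * K * K\<^sup>2 + 2 * K * C\<^sup>2 + K + C + 1)"
      unfolding M_def by (simp add: algebra_simps)
    have "0 \<le> 2 * K * C\<^sup>2 * n\<^sup>2" "0 \<le> C * n\<^sup>2" "0 \<le> n\<^sup>2" "0 \<le> 2 * K * K\<^sup>2" "0 \<le> K" using CK by auto
    moreover have "K * (2 * (K\<^sup>2 * n\<^sup>2) + 2 * C\<^sup>2) = 2 * K * K\<^sup>2 * n\<^sup>2 + 2 * K * C\<^sup>2" by (simp add: algebra_simps)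
    ultimately have "K * (K * n + C)\<^sup>2 + (K * n + C) + 1 \<le> M * n\<^sup>2 + M" using 1 2 3 by linarith
    from fills_mono[OF f this] show ?thesis unfolding n_def .
  qed
  ultimately show ?thesis by (intro exI[of _ M]) simp
qed

text \<open>Failure of domination at the constants \<open>K\<close> and \<open>C\<close> gives an
  \<open>x\<close> with \<open>iso (K * x + C) < x\<^sup>2 / K\<close>, and
  \<open>K \<ge> 1 / \<epsilon>\<close> makes this at most \<open>\<epsilon> * l\<^sup>2\<close> for
  the integer part \<open>l\<close> of \<open>K * x + C\<close>. Taking \<open>C = N + 1\<close>
  forces \<open>l \<ge> N\<close>, however small \<open>x\<close> is.\<close>

lemma sparse_fills:
  assumes "\<not> growth_le (\<lambda>x. ennreal (x\<^sup>2)) iso" and eps: "\<epsilon> > 0"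
  shows "\<exists>l\<ge>N. \<forall>b\<in>C1. bd1 b = 0 \<longrightarrow> c1.nrm b \<le> l \<longrightarrow> fills b (\<epsilon> * (real l)\<^sup>2)"
proof -
  define K where "K = max 1 (1 / \<epsilon>)"
  define C where "C = real N + 1"
  have K: "K \<ge> 1" "K \<ge> 1 / \<epsilon>" unfolding K_def by auto
  have C: "C \<ge> 1" unfolding C_def by simp
  have "\<not> (\<forall>x\<ge>0. ennreal (x\<^sup>2) \<le> ennreal K * iso (K * x + C) + ennreal (K * x + C))"
    using assms(1) K(1) C unfolding growth_le_def by (metis less_le_trans zero_less_one)
  then obtain x where x: "x \<ge> 0" "ennreal K * iso (K * x + C) + ennreal (K * x + C) < ennreal (x\<^sup>2)"
    by (auto simp: not_le)
  have small: "iso (K * x + C) < ennreal (x\<^sup>2 / K)"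
  proof (rule ccontr)
    assume "\<not> ?thesis"
    then have "ennreal K * ennreal (x\<^sup>2 / K) \<le> ennreal K * iso (K * x + C)"
      by (intro mult_left_mono) (auto simp: not_less)
    moreover have "ennreal K * ennreal (x\<^sup>2 / K) = ennreal (x\<^sup>2)"
      using K(1) by (subst ennreal_mult[symmetric]) auto
    ultimately have "ennreal (x\<^sup>2) \<le> ennreal K * iso (K * x + C) + ennreal (K * x + C)"
      by (metis add_increasing2 zero_le)
    then show False using x(2) by simp
  qed
  define l where "l = nat \<lfloor>K * x + C\<rfloor>"
  have Kx: "0 \<le> K * x" using K x by simp
  have l: "real l \<le> K * x + C" "K * x + C - 1 \<le> real l"
    unfolding l_def using Kx C nat_floor_bounds[of "K * x + C"] by auto
  have "N \<le> l" using l(2) Kx unfolding C_def by linarith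
  moreover have "fills b (\<epsilon> * (real l)\<^sup>2)" if b: "b \<in> C1" "bd1 b = 0" "c1.nrm b \<le> l" for b
  proof (rule fills_mono)
    have "real (c1.nrm b) \<le> K * x + C" using b(3) l(1) by linarith
    from fills_of_iso[OF b(1,2) this small] show "fills b (x\<^sup>2 / K)" .
    have "K * x \<le> real l" using l(2) C by linarith
    then have "(K * x)\<^sup>2 \<le> (real l)\<^sup>2" using Kx by (intro power_mono) auto
    then have 1: "\<epsilon> * (K\<^sup>2 * x\<^sup>2) \<le> \<epsilon> * (real l)\<^sup>2" using eps by (simp add: power_mult_distrib)
    have "1 \<le> \<epsilon> * K" using K(2) eps by (simp add: pos_divide_le_eq mult.commute)
    then have "1 * 1 \<le> (\<epsilon> * K) * (K * K)" using K(1) mult_mono[of 1 K 1 K] by (intro mult_mono) auto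
    then have "1 / K \<le> \<epsilon> * K\<^sup>2" using K(1) by (simp add: pos_divide_le_eq power2_eq_square mult.assoc)
    then have "1 / K * x\<^sup>2 \<le> \<epsilon> * K\<^sup>2 * x\<^sup>2" by (rule mult_right_mono) simp
    then show "x\<^sup>2 / K \<le> \<epsilon> * (real l)\<^sup>2" using 1 by (simp add: mult.assoc)
  qed
  ultimately show ?thesis by (intro exI[of _ l]) simp
qed

end

section \<open>Transfer from one resolution to the other\<close>

lemma admissible_low_resolution:
  assumes "admissible 1 C"
  shows "low_resolution (scal C) (chains C 0) (chains C 1) (chains C 2) (basis C 1) (basis C 2)
     (bdry C 1) (bdry C 2) (augm C)"
proof -
  have pr: "projective_resolution C" using assms unfolding admissible_def by simp
  have L: "left_module (scal C)" using pr unfolding projective_resolution_def by simp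
  have S: "submodule (scal C) (chains C k)" "projective (scal C) (chains C k)" for k
    using pr unfolding projective_resolution_def by simp_all
  have F: "finitely_generated (scal C) (chains C 1)" "free_basis (scal C) (chains C 1) (basis C 1)"
    "finitely_generated (scal C) (chains C (Suc 1))" "free_basis (scal C) (chains C (Suc 1)) (basis C (Suc 1))"
    using assms unfolding admissible_def by simp_all
  have M: "module_map (scal C) (chains C (Suc k)) (scal C) (chains C k) (bdry C (Suc k))" for k
    using pr unfolding projective_resolution_def by simp
  have E: "bdry C (Suc (Suc k)) ` chains C (Suc (Suc k)) = {x \<in> chains C (Suc k). bdry C (Suc k) x = 0}" for k
    using pr unfolding projective_resolution_def by simp
  have A: "module_map (scal C) (chains C 0) trivial_scale UNIV (augm C)" "augm C ` chains C 0 = UNIV"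
    "bdry C 1 ` chains C 1 = {x \<in> chains C 0. augm C x = 0}"
    using pr unfolding projective_resolution_def by simp_all
  have two: "2 = Suc 1" by simp
  have B: "based_module (scal C) (chains C 1) (basis C 1)" "based_module (scal C) (chains C (Suc 1)) (basis C (Suc 1))"
    using L S(1) F by (intro based_module.intro based_module_axioms.intro; simp)+
  show ?thesis
    unfolding two
    by (intro low_resolution.intro low_resolution_axioms.intro)
      (use L S[of 0] B M[of 0] M[of 1] E[of 0] A in simp_all)
qed

theorem theorem5p1:
  fixes C :: "('g::group_add, 'r::ring_1, 'm::ab_group_add) based_complex"
    and D :: "('g, 'r, 'n::ab_group_add) based_complex"
  assumes "type_FP TYPE('g) TYPE('r) 2"
    and "admissible 1 C"
    and "admissible 1 D"
    and "subquadratic_growth (isoperimetric_function 1 C)"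
  shows "linear_growth (isoperimetric_function 1 D)"
proof -
  interpret c: low_resolution "scal C" "chains C 0" "chains C 1" "chains C 2" "basis C 1" "basis C 2"
    "bdry C 1" "bdry C 2" "augm C"
    by (rule admissible_low_resolution[OF assms(2)])
  interpret e: low_resolution "scal D" "chains D 0" "chains D 1" "chains D 2" "basis D 1" "basis D 2"
    "bdry D 1" "bdry D 2" "augm D"
    by (rule admissible_low_resolution[OF assms(3)])
  have two: "Suc 1 = 2" by simp
  have isoC: "isoperimetric_function 1 C = c.iso"
    by (rule ext) (simp only: isoperimetric_function_def c.iso_def two)
  have isoD: "isoperimetric_function 1 D = e.iso"
    by (rule ext) (simp only: isoperimetric_function_def e.iso_def two)
  have growth: "growth_le c.iso (\<lambda>x. ennreal (x\<^sup>2))" "\<not> growth_le (\<lambda>x. ennreal (x\<^sup>2)) c.iso"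
    using assms(4) unfolding isoC subquadratic_growth_def growth_equiv_def by simp_all
  obtain U :: "'g set" where U: "finite U"
    "\<forall>S. finite S \<longrightarrow> (\<forall>s\<in>S. - s \<in> S) \<longrightarrow> U \<subseteq> S \<longrightarrow> word_metric S"
    using c.generating_set by (elim exE conjE)
  obtain V :: "'g set" where V: "finite V" "\<forall>S pr D' W. word_metric S \<longrightarrow> V \<subseteq> S \<longrightarrow>
     graph_metric.contracting (word_dist S) 0 pr D' W \<longrightarrow>
     (\<exists>K\<ge>0. \<forall>b\<in>chains D 1. bdry D 1 b = 0 \<longrightarrow> e.fills b (K * real (e.c1.nrm b)))"
    using e.linear_filling by (elim exE conjE)
  \<comment> \<open>One metric for both resolutions: \<open>U\<close>, from \<open>C\<close>, makes
    \<open>S\<close> generate the group, and \<open>V\<close>, from \<open>D\<close>, turns the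
    pairs in the cone into edges.\<close>
  define S where "S = U \<union> V \<union> uminus ` (U \<union> V)"
  have "finite S" "\<forall>s\<in>S. - s \<in> S" "U \<subseteq> S" and VS: "V \<subseteq> S"
    unfolding S_def using U(1) V(1) by auto
  then have S: "word_metric S" using U(2) by simp
  interpret m: metric_resolution "scal C" "chains C 0" "chains C 1" "chains C 2" "basis C 1" "basis C 2"
    "bdry C 1" "bdry C 2" "augm C" S
    by (rule metric_resolution.intro[OF c.low_resolution_axioms S])
  obtain K where K: "K > 0" "\<forall>b\<in>chains C 1. bdry C 1 b = 0 \<longrightarrow> c.fills b (K * (real (c.c1.nrm b))\<^sup>2 + K)"
    using c.quadratic_fills[OF growth(1)] by (elim exE conjE)
  have "\<exists>pr D' W. m.contracting 0 pr D' W"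
  proof (rule m.contracting_of_fills[OF _ K(1)])
    show "c.fills b (K * (real (c.c1.nrm b))\<^sup>2 + K)" if "b \<in> chains C 1" "bdry C 1 b = 0" for b
      using K(2) that by simp
    show "\<exists>l\<ge>N. \<forall>b\<in>chains C 1. bdry C 1 b = 0 \<longrightarrow> c.c1.nrm b \<le> l \<longrightarrow> c.fills b (\<epsilon> * (real l)\<^sup>2)"
      if "\<epsilon> > 0" for \<epsilon> and N :: nat
      by (rule c.sparse_fills[OF growth(2) that])
  qed
  then obtain pr D' W where con: "m.contracting 0 pr D' W" by (elim exE)
  have "\<exists>K\<ge>0. \<forall>b\<in>chains D 1. bdry D 1 b = 0 \<longrightarrow> e.fills b (K * real (e.c1.nrm b))"
    by (rule mp[OF mp[OF mp[OF spec[OF spec[OF spec[OF spec[OF V(2), of S], of pr], of D'], of W] S] VS] con])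
  then obtain K' where K': "K' \<ge> 0"
    "\<forall>b\<in>chains D 1. bdry D 1 b = 0 \<longrightarrow> e.fills b (K' * real (e.c1.nrm b))" by (elim exE conjE)
  have up: "e.iso x \<le> ennreal (K' + 1) * ennreal ((K' + 1) * x + 1) + ennreal ((K' + 1) * x + 1)"
    if x: "x \<ge> 0" for x
  proof -
    have "e.iso x \<le> ennreal (K' * x)"
    proof (rule e.iso_le)
      fix b assume b: "b \<in> chains D 1" "bdry D 1 b = 0" "real (e.c1.nrm b) \<le> x"
      have "e.fills b (K' * real (e.c1.nrm b))" using K'(2) b(1,2) by simp
      then show "e.fills b (K' * x)"
        by (rule e.fills_mono) (use K'(1) b(3) in \<open>simp add: mult_left_mono\<close>)
    qed
    also have "\<dots> \<le> ennreal ((K' + 1) * x + 1)"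
      using x by (intro ennreal_leI) (simp add: distrib_right)
    also have "\<dots> \<le> ennreal (K' + 1) * ennreal ((K' + 1) * x + 1) + ennreal ((K' + 1) * x + 1)"
      by (simp add: add_increasing)
    finally show ?thesis .
  qed
  have "growth_le e.iso (\<lambda>x. ennreal x)"
    unfolding growth_le_def using up K'(1) by (intro exI[of _ 1] exI[of _ "K' + 1"]) simp
  moreover have "growth_le (\<lambda>x. ennreal x) e.iso"
    unfolding growth_le_def
  proof (intro exI[of _ 1] conjI allI impI)
    fix x :: real assume "x \<ge> 0"
    \<comment> \<open>The lower bound is automatic, because the linear term in
      \<open>growth_le\<close> already dominates \<open>x\<close>.\<close>
    have "ennreal x \<le> ennreal (1 * x + 1)" by (intro ennreal_leI) simp
    then show "ennreal x \<le> ennreal 1 * e.iso (1 * x + 1) + ennreal (1 * x + 1)"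
      by (simp add: add_increasing)
  qed simp_all
  ultimately show ?thesis unfolding isoD linear_growth_def growth_equiv_def by simp
qed

end
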